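(* Let $(M,\phi_\alpha,\xi_\alpha,\eta_\alpha,g)_{\alpha\in\{1,2,3\}}$ be a $3$-quasi-Sasakian manifold of rank $4l+3$. For $\lambda=(\lambda_1,\lambda_2,\lambda_3)\in\mathbb{S}^2$ put $\phi_\lambda:=\sum_{\alpha}\lambda_\alpha\phi_\alpha$, $\xi_\lambda:=\sum_\alpha\lambda_\alpha\xi_\alpha$, $\eta_\lambda:=\sum_\alpha\lambda_\alpha\eta_\alpha$. Then for every $\lambda\in\mathbb{S}^2$, $(\phi_\lambda,\xi_\lambda,\eta_\lambda,g)$ is a quasi-Sasakian structure on $M$ of the same rank $4l+3$. In particular, the almost cosymplectic sphere generated by $\{(\eta_1,\Omega_1),(\eta_2,\Omega_2),(\eta_3,\Omega_3)\}$, where $\Omega_\alpha:=g(\cdot,\phi_\alpha\cdot)$, is quasi-contact of rank $4l+3$.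
   Context: An almost contact structure on $M$ is a triple $(\phi,\xi,\eta)$ of a $(1,1)$-tensor field, a vector field and a $1$-form with $\phi^2=-I+\eta\otimes\xi$ and $\eta(\xi)=1$. A Riemannian metric $g$ is compatible if $g(\phi X,\phi Y)=g(X,Y)-\eta(X)\eta(Y)$; then $(\phi,\xi,\eta,g)$ is an almost contact metric structure, with fundamental $2$-form $\Omega(X,Y)=g(X,\phi Y)$. The structure is normal if $\phi^2[X,Y]+[\phi X,\phi Y]-\phi[\phi X,Y]-\phi[X,\phi Y]+\big(X(\eta(Y))-Y(\eta(X))-\eta([X,Y])\big)\xi=0$ for all vector fields $X,Y$. It is quasi-Sasakian if it is normal and $d\Omega=0$. An almost contact $3$-structure is a triple of almost contact structures $(\phi_\alpha,\xi_\alpha,\eta_\alpha)$, $\alpha=1,2,3$, such that for every even permutation $(\alpha,\beta,\gamma)$ of $\{1,2,3\}$: $\phi_\gamma=\phi_\alpha\phi_\beta-\eta_\beta\otimes\xi_\alpha=-\phi_\beta\phi_\alpha+\eta_\alpha\otimes\xi_\beta$, $\xi_\gamma=\phi_\alpha\xi_\beta=-\phi_\beta\xi_\alpha$, $\eta_\gamma=\eta_\alpha\circ\phi_\beta=-\eta_\beta\circ\phi_\alpha$. With a Riemannian metric $g$ compatible with all three, it is an almost contact metric $3$-structure. It is $3$-quasi-Sasakian if each $(\phi_\alpha,\xi_\alpha,\eta_\alpha,g)$ is quasi-Sasakian. A $1$-form $\eta$ has (constant) rank, or Cartan class, $2r+1$ if $\eta\wedge(d\eta)^r$ is nowhere zero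 and $(d\eta)^{r+1}=0$, and $2r$ if $(d\eta)^r$ is nowhere zero and $\eta\wedge(d\eta)^r=0$. The rank of a quasi-Sasakian structure is the rank of its $\eta$. On a $3$-quasi-Sasakian manifold the forms $\eta_1,\eta_2,\eta_3$ are known to have the same rank, called the rank of the manifold; it is either $1$ (the $3$-cosymplectic case) or of the form $4l+3$. An almost cosymplectic structure on a $(2m+1)$-dimensional manifold is a pair $(\eta,\Omega)$ of a $1$-form and a $2$-form with $\eta\wedge\Omega^m$ a volume form. For $p\ge1$, almost cosymplectic structures $(\eta_i,\Omega_i)$, $1\le i\le p+1$, generate an almost cosymplectic $p$-sphere if $(\eta_\lambda,\Omega_\lambda):=(\sum_i\lambda_i\eta_i,\sum_i\lambda_i\Omega_i)$ is almost cosymplectic for every $\lambda\in\mathbb{S}^p$; for $p=2$ it is called an almost cosymplectic sphere. An almost cosymplectic $p$-sphere is quasi-contact of rank $k$ ($k$ a positive integer) if $d\Omega_\lambda=0$ and $\eta_\lambda$ has constant rank (Cartan class) $k$ for every $\lambda\in\mathbb{S}^p$. *)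

theory Defs
  imports
    "HOL-Analysis.Analysis"
    "HOL-Library.Function_Algebras"
    "HOL-Combinatorics.Permutations"
begin

section \<open>Smooth manifolds\<close>

text \<open>\<open>Ck_on k S f\<close> is meant for open \<open>S\<close>.\<close>

primrec Ck_on :: "nat \<Rightarrow> 'e::euclidean_space set \<Rightarrow> ('e \<Rightarrow> 'b::real_normed_vector) \<Rightarrow> bool" where
  "Ck_on 0 S f \<longleftrightarrow> continuous_on S f"
| "Ck_on (Suc k) S f \<longleftrightarrow>
     (\<forall>x\<in>S. f differentiable (at x)) \<and>
     (\<forall>v. Ck_on k S (\<lambda>x. frechet_derivative f (at x) v))"

definition smooth_on :: "'e::euclidean_space set \<Rightarrow> ('e \<Rightarrow> 'b::real_normed_vector) \<Rightarrow> bool" where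
  "smooth_on S f \<longleftrightarrow> (\<forall>k. Ck_on k S f)"

text \<open>The manifold is the whole type \<open>'a\<close>, which carries its topology; its dimension is
  \<open>DIM('e)\<close>. A chart is a pair of an open domain and a map that is relevant only on that domain.
  The atlas need not be maximal.\<close>

type_synonym ('a, 'e) atlas = "('a set \<times> ('a \<Rightarrow> 'e)) set"

definition smooth_atlas ::
    "('a::{t2_space,second_countable_topology}, 'e::euclidean_space) atlas \<Rightarrow> bool" where
  "smooth_atlas A \<longleftrightarrow>
     (\<forall>(U, c)\<in>A. open U \<and> open (c ` U) \<and> homeomorphism U (c ` U) c (inv_into U c)) \<and>
     (\<Union>(U, c)\<in>A. U) = UNIV \<and>
     (\<forall>(U, c)\<in>A. \<forall>(V, d)\<in>A. smooth_on (c ` (U \<inter> V)) (d \<circ> inv_into U c))"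

definition smooth_functions ::
    "('a::{t2_space,second_countable_topology}, 'e::euclidean_space) atlas \<Rightarrow> ('a \<Rightarrow> real) set" where
  "smooth_functions A = {f. \<forall>(U, c)\<in>A. smooth_on (c ` U) (f \<circ> inv_into U c)}"


section \<open>Vector fields and tensor fields\<close>

text \<open>
  A smooth vector field is a derivation of the algebra of smooth functions, and a smooth tensor
  field is a map on vector fields that is multilinear over the smooth functions. Functions on the
  manifold, vector fields and tensor fields are added and multiplied pointwise (the \<open>fun\<close>
  instances of Function_Algebras); in particular \<open>1\<close> is the constant function, and a real
  constant \<open>a\<close> enters as \<open>\<lambda>_. a\<close>. Derivations are set to \<open>0\<close> on non-smooth functions, so that
  equality of vector fields is equality in HOL.
\<close>

type_synonym 'a vfield = "('a \<Rightarrow> real) \<Rightarrow> 'a \<Rightarrow> real"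

definition vector_fields ::
    "('a::{t2_space,second_countable_topology}, 'e::euclidean_space) atlas \<Rightarrow> 'a vfield set" where
  "vector_fields A = {X.
     (\<forall>f\<in>smooth_functions A. X f \<in> smooth_functions A) \<and>
     (\<forall>f. f \<notin> smooth_functions A \<longrightarrow> X f = 0) \<and>
     (\<forall>f\<in>smooth_functions A. \<forall>h\<in>smooth_functions A. X (f + h) = X f + X h) \<and>
     (\<forall>f\<in>smooth_functions A. \<forall>a. X ((\<lambda>_. a) * f) = (\<lambda>_. a) * X f) \<and>
     (\<forall>f\<in>smooth_functions A. \<forall>h\<in>smooth_functions A. X (f * h) = X f * h + f * X h)}"

definition fscale :: "('a \<Rightarrow> real) \<Rightarrow> 'a vfield \<Rightarrow> 'a vfield" (infixr "\<odot>" 75) where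
  "h \<odot> X = (\<lambda>f. h * X f)"

definition lie_bracket :: "'a vfield \<Rightarrow> 'a vfield \<Rightarrow> 'a vfield" where
  "lie_bracket X Y = (\<lambda>f. X (Y f) - Y (X f))"

definition vanishes_at :: "'a vfield \<Rightarrow> 'a \<Rightarrow> bool" where
  "vanishes_at X p \<longleftrightarrow> (\<forall>f. X f p = 0)"

definition one_form ::
    "('a::{t2_space,second_countable_topology}, 'e::euclidean_space) atlas \<Rightarrow>
      ('a vfield \<Rightarrow> 'a \<Rightarrow> real) \<Rightarrow> bool" where
  "one_form A \<eta> \<longleftrightarrow>
     (\<forall>X\<in>vector_fields A. \<eta> X \<in> smooth_functions A) \<and>
     (\<forall>X\<in>vector_fields A. \<forall>Y\<in>vector_fields A. \<eta> (X + Y) = \<eta> X + \<eta> Y) \<and>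
     (\<forall>h\<in>smooth_functions A. \<forall>X\<in>vector_fields A. \<eta> (h \<odot> X) = h * \<eta> X)"

text \<open>(1,1)-tensor fields\<close>

definition endomorphism_field ::
    "('a::{t2_space,second_countable_topology}, 'e::euclidean_space) atlas \<Rightarrow>
      ('a vfield \<Rightarrow> 'a vfield) \<Rightarrow> bool" where
  "endomorphism_field A \<phi> \<longleftrightarrow>
     (\<forall>X\<in>vector_fields A. \<phi> X \<in> vector_fields A) \<and>
     (\<forall>X\<in>vector_fields A. \<forall>Y\<in>vector_fields A. \<phi> (X + Y) = \<phi> X + \<phi> Y) \<and>
     (\<forall>h\<in>smooth_functions A. \<forall>X\<in>vector_fields A. \<phi> (h \<odot> X) = h \<odot> \<phi> X)"

text \<open>(0,2)-tensor fields\<close>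

definition bilinear_field ::
    "('a::{t2_space,second_countable_topology}, 'e::euclidean_space) atlas \<Rightarrow>
      ('a vfield \<Rightarrow> 'a vfield \<Rightarrow> 'a \<Rightarrow> real) \<Rightarrow> bool" where
  "bilinear_field A b \<longleftrightarrow>
     (\<forall>X\<in>vector_fields A. one_form A (b X)) \<and>
     (\<forall>Y\<in>vector_fields A. one_form A (\<lambda>X. b X Y))"

definition two_form ::
    "('a::{t2_space,second_countable_topology}, 'e::euclidean_space) atlas \<Rightarrow>
      ('a vfield \<Rightarrow> 'a vfield \<Rightarrow> 'a \<Rightarrow> real) \<Rightarrow> bool" where
  "two_form A \<Omega> \<longleftrightarrow> bilinear_field A \<Omega> \<and> (\<forall>X\<in>vector_fields A. \<Omega> X X = 0)"

definition riemannian_metric ::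
    "('a::{t2_space,second_countable_topology}, 'e::euclidean_space) atlas \<Rightarrow>
      ('a vfield \<Rightarrow> 'a vfield \<Rightarrow> 'a \<Rightarrow> real) \<Rightarrow> bool" where
  "riemannian_metric A g \<longleftrightarrow> bilinear_field A g \<and>
     (\<forall>X\<in>vector_fields A. \<forall>Y\<in>vector_fields A. g X Y = g Y X) \<and>
     (\<forall>X\<in>vector_fields A. \<forall>p. \<not> vanishes_at X p \<longrightarrow> g X X p > 0)"

text \<open>Exterior derivatives of 1-forms and 2-forms (without normalising factors 1/2 and 1/3)\<close>

definition d1 :: "('a vfield \<Rightarrow> 'a \<Rightarrow> real) \<Rightarrow> 'a vfield \<Rightarrow> 'a vfield \<Rightarrow> 'a \<Rightarrow> real" where
  "d1 \<eta> X Y = X (\<eta> Y) - Y (\<eta> X) - \<eta> (lie_bracket X Y)"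

definition d2 :: "('a vfield \<Rightarrow> 'a vfield \<Rightarrow> 'a \<Rightarrow> real) \<Rightarrow>
    'a vfield \<Rightarrow> 'a vfield \<Rightarrow> 'a vfield \<Rightarrow> 'a \<Rightarrow> real" where
  "d2 \<Omega> X Y Z = X (\<Omega> Y Z) + Y (\<Omega> Z X) + Z (\<Omega> X Y)
     - \<Omega> (lie_bracket X Y) Z - \<Omega> (lie_bracket Y Z) X - \<Omega> (lie_bracket Z X) Y"

definition closed_two_form ::
    "('a::{t2_space,second_countable_topology}, 'e::euclidean_space) atlas \<Rightarrow>
      ('a vfield \<Rightarrow> 'a vfield \<Rightarrow> 'a \<Rightarrow> real) \<Rightarrow> bool" where
  "closed_two_form A \<Omega> \<longleftrightarrow>
     (\<forall>X\<in>vector_fields A. \<forall>Y\<in>vector_fields A. \<forall>Z\<in>vector_fields A. d2 \<Omega> X Y Z = 0)"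


section \<open>Exterior products and Cartan class\<close>

text \<open>A \<open>k\<close>-form takes a sequence of vector fields, of which it uses the entries \<open>0, \<dots>, k - 1\<close>;
  its degree is not recorded in the type and is passed to the wedge product.\<close>

type_synonym 'a form = "(nat \<Rightarrow> 'a vfield) \<Rightarrow> 'a \<Rightarrow> real"

definition of_one_form :: "('a vfield \<Rightarrow> 'a \<Rightarrow> real) \<Rightarrow> 'a form" where
  "of_one_form \<eta> = (\<lambda>X. \<eta> (X 0))"

definition of_two_form :: "('a vfield \<Rightarrow> 'a vfield \<Rightarrow> 'a \<Rightarrow> real) \<Rightarrow> 'a form" where
  "of_two_form \<Omega> = (\<lambda>X. \<Omega> (X 0) (X 1))"

definition wedge :: "nat \<Rightarrow> nat \<Rightarrow> 'a form \<Rightarrow> 'a form \<Rightarrow> 'a form" where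
  "wedge k l \<omega> \<tau> = (\<lambda>X p. 1 / (fact k * fact l) *
     (\<Sum>\<sigma> | \<sigma> permutes {..<k + l}.
        of_int (sign \<sigma>) * \<omega> (\<lambda>i. X (\<sigma> i)) p * \<tau> (\<lambda>i. X (\<sigma> (k + i))) p))"

text \<open>The \<open>r\<close>-th exterior power of a 2-form, a \<open>2r\<close>-form\<close>

primrec wedge_power :: "('a vfield \<Rightarrow> 'a vfield \<Rightarrow> 'a \<Rightarrow> real) \<Rightarrow> nat \<Rightarrow> 'a form" where
  "wedge_power \<Omega> 0 = (\<lambda>X. 1)"
| "wedge_power \<Omega> (Suc r) = wedge 2 (2 * r) (of_two_form \<Omega>) (wedge_power \<Omega> r)"

definition identically_zero ::
    "('a::{t2_space,second_countable_topology}, 'e::euclidean_space) atlas \<Rightarrow> 'a form \<Rightarrow> bool" where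
  "identically_zero A \<omega> \<longleftrightarrow> (\<forall>X. (\<forall>i. X i \<in> vector_fields A) \<longrightarrow> \<omega> X = 0)"

definition nowhere_zero ::
    "('a::{t2_space,second_countable_topology}, 'e::euclidean_space) atlas \<Rightarrow> 'a form \<Rightarrow> bool" where
  "nowhere_zero A \<omega> \<longleftrightarrow> (\<forall>p. \<exists>X. (\<forall>i. X i \<in> vector_fields A) \<and> \<omega> X p \<noteq> 0)"

definition cartan_class ::
    "('a::{t2_space,second_countable_topology}, 'e::euclidean_space) atlas \<Rightarrow>
      ('a vfield \<Rightarrow> 'a \<Rightarrow> real) \<Rightarrow> nat \<Rightarrow> bool" where
  "cartan_class A \<eta> k \<longleftrightarrow>
     (\<exists>r. k = 2 * r + 1 \<and>
        nowhere_zero A (wedge 1 (2 * r) (of_one_form \<eta>) (wedge_power (d1 \<eta>) r)) \<and>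
        identically_zero A (wedge_power (d1 \<eta>) (r + 1))) \<or>
     (\<exists>r. k = 2 * r \<and>
        nowhere_zero A (wedge_power (d1 \<eta>) r) \<and>
        identically_zero A (wedge 1 (2 * r) (of_one_form \<eta>) (wedge_power (d1 \<eta>) r)))"


section \<open>Almost contact and quasi-Sasakian structures\<close>

definition almost_contact ::
    "('a::{t2_space,second_countable_topology}, 'e::euclidean_space) atlas \<Rightarrow>
      ('a vfield \<Rightarrow> 'a vfield) \<Rightarrow> 'a vfield \<Rightarrow> ('a vfield \<Rightarrow> 'a \<Rightarrow> real) \<Rightarrow> bool" where
  "almost_contact A \<phi> \<xi> \<eta> \<longleftrightarrow>
     endomorphism_field A \<phi> \<and> \<xi> \<in> vector_fields A \<and> one_form A \<eta> \<and>
     (\<forall>X\<in>vector_fields A. \<phi> (\<phi> X) = - X + \<eta> X \<odot> \<xi>) \<and> \<eta> \<xi> = 1"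

definition compatible_metric ::
    "('a::{t2_space,second_countable_topology}, 'e::euclidean_space) atlas \<Rightarrow>
      ('a vfield \<Rightarrow> 'a vfield) \<Rightarrow> ('a vfield \<Rightarrow> 'a \<Rightarrow> real) \<Rightarrow>
      ('a vfield \<Rightarrow> 'a vfield \<Rightarrow> 'a \<Rightarrow> real) \<Rightarrow> bool" where
  "compatible_metric A \<phi> \<eta> g \<longleftrightarrow> riemannian_metric A g \<and>
     (\<forall>X\<in>vector_fields A. \<forall>Y\<in>vector_fields A. g (\<phi> X) (\<phi> Y) = g X Y - \<eta> X * \<eta> Y)"

definition almost_contact_metric ::
    "('a::{t2_space,second_countable_topology}, 'e::euclidean_space) atlas \<Rightarrow>
      ('a vfield \<Rightarrow> 'a vfield) \<Rightarrow> 'a vfield \<Rightarrow> ('a vfield \<Rightarrow> 'a \<Rightarrow> real) \<Rightarrow>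
      ('a vfield \<Rightarrow> 'a vfield \<Rightarrow> 'a \<Rightarrow> real) \<Rightarrow> bool" where
  "almost_contact_metric A \<phi> \<xi> \<eta> g \<longleftrightarrow> almost_contact A \<phi> \<xi> \<eta> \<and> compatible_metric A \<phi> \<eta> g"

definition fundamental_form :: "('a vfield \<Rightarrow> 'a vfield \<Rightarrow> 'a \<Rightarrow> real) \<Rightarrow>
    ('a vfield \<Rightarrow> 'a vfield) \<Rightarrow> 'a vfield \<Rightarrow> 'a vfield \<Rightarrow> 'a \<Rightarrow> real" where
  "fundamental_form g \<phi> X Y = g X (\<phi> Y)"

definition normal_structure ::
    "('a::{t2_space,second_countable_topology}, 'e::euclidean_space) atlas \<Rightarrow>
      ('a vfield \<Rightarrow> 'a vfield) \<Rightarrow> 'a vfield \<Rightarrow> ('a vfield \<Rightarrow> 'a \<Rightarrow> real) \<Rightarrow> bool" where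
  "normal_structure A \<phi> \<xi> \<eta> \<longleftrightarrow>
     (\<forall>X\<in>vector_fields A. \<forall>Y\<in>vector_fields A.
        \<phi> (\<phi> (lie_bracket X Y)) + lie_bracket (\<phi> X) (\<phi> Y)
        - \<phi> (lie_bracket (\<phi> X) Y) - \<phi> (lie_bracket X (\<phi> Y))
        + (X (\<eta> Y) - Y (\<eta> X) - \<eta> (lie_bracket X Y)) \<odot> \<xi> = 0)"

definition quasi_sasakian ::
    "('a::{t2_space,second_countable_topology}, 'e::euclidean_space) atlas \<Rightarrow>
      ('a vfield \<Rightarrow> 'a vfield) \<Rightarrow> 'a vfield \<Rightarrow> ('a vfield \<Rightarrow> 'a \<Rightarrow> real) \<Rightarrow>
      ('a vfield \<Rightarrow> 'a vfield \<Rightarrow> 'a \<Rightarrow> real) \<Rightarrow> bool" where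
  "quasi_sasakian A \<phi> \<xi> \<eta> g \<longleftrightarrow> almost_contact_metric A \<phi> \<xi> \<eta> g \<and>
     normal_structure A \<phi> \<xi> \<eta> \<and> closed_two_form A (fundamental_form g \<phi>)"

text \<open>Families indexed by \<open>\<alpha> = 1, 2, 3\<close> are functions on \<open>nat\<close>; other indices are not used.\<close>

definition almost_contact_3 ::
    "('a::{t2_space,second_countable_topology}, 'e::euclidean_space) atlas \<Rightarrow>
      (nat \<Rightarrow> 'a vfield \<Rightarrow> 'a vfield) \<Rightarrow> (nat \<Rightarrow> 'a vfield) \<Rightarrow>
      (nat \<Rightarrow> 'a vfield \<Rightarrow> 'a \<Rightarrow> real) \<Rightarrow> bool" where
  "almost_contact_3 A \<phi> \<xi> \<eta> \<longleftrightarrow>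
     (\<forall>\<alpha>\<in>{1,2,3}. almost_contact A (\<phi> \<alpha>) (\<xi> \<alpha>) (\<eta> \<alpha>)) \<and>
     (\<forall>(\<alpha>, \<beta>, \<gamma>)\<in>{(1,2,3), (2,3,1), (3,1,2)}.
        (\<forall>X\<in>vector_fields A.
           \<phi> \<gamma> X = \<phi> \<alpha> (\<phi> \<beta> X) - \<eta> \<beta> X \<odot> \<xi> \<alpha> \<and>
           \<phi> \<gamma> X = - \<phi> \<beta> (\<phi> \<alpha> X) + \<eta> \<alpha> X \<odot> \<xi> \<beta>) \<and>
        \<xi> \<gamma> = \<phi> \<alpha> (\<xi> \<beta>) \<and> \<xi> \<gamma> = - \<phi> \<beta> (\<xi> \<alpha>) \<and>
        (\<forall>X\<in>vector_fields A. \<eta> \<gamma> X = \<eta> \<alpha> (\<phi> \<beta> X) \<and> \<eta> \<gamma> X = - \<eta> \<beta> (\<phi> \<alpha> X)))"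

definition almost_contact_metric_3 ::
    "('a::{t2_space,second_countable_topology}, 'e::euclidean_space) atlas \<Rightarrow>
      (nat \<Rightarrow> 'a vfield \<Rightarrow> 'a vfield) \<Rightarrow> (nat \<Rightarrow> 'a vfield) \<Rightarrow>
      (nat \<Rightarrow> 'a vfield \<Rightarrow> 'a \<Rightarrow> real) \<Rightarrow> ('a vfield \<Rightarrow> 'a vfield \<Rightarrow> 'a \<Rightarrow> real) \<Rightarrow> bool" where
  "almost_contact_metric_3 A \<phi> \<xi> \<eta> g \<longleftrightarrow>
     almost_contact_3 A \<phi> \<xi> \<eta> \<and> (\<forall>\<alpha>\<in>{1,2,3}. compatible_metric A (\<phi> \<alpha>) (\<eta> \<alpha>) g)"

definition three_quasi_sasakian ::
    "('a::{t2_space,second_countable_topology}, 'e::euclidean_space) atlas \<Rightarrow>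
      (nat \<Rightarrow> 'a vfield \<Rightarrow> 'a vfield) \<Rightarrow> (nat \<Rightarrow> 'a vfield) \<Rightarrow>
      (nat \<Rightarrow> 'a vfield \<Rightarrow> 'a \<Rightarrow> real) \<Rightarrow> ('a vfield \<Rightarrow> 'a vfield \<Rightarrow> 'a \<Rightarrow> real) \<Rightarrow> bool" where
  "three_quasi_sasakian A \<phi> \<xi> \<eta> g \<longleftrightarrow>
     almost_contact_metric_3 A \<phi> \<xi> \<eta> g \<and>
     (\<forall>\<alpha>\<in>{1,2,3}. quasi_sasakian A (\<phi> \<alpha>) (\<xi> \<alpha>) (\<eta> \<alpha>) g)"

text \<open>The rank of a 3-quasi-Sasakian manifold is the common Cartan class of its three 1-forms.\<close>

definition three_quasi_sasakian_of_rank ::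
    "('a::{t2_space,second_countable_topology}, 'e::euclidean_space) atlas \<Rightarrow>
      (nat \<Rightarrow> 'a vfield \<Rightarrow> 'a vfield) \<Rightarrow> (nat \<Rightarrow> 'a vfield) \<Rightarrow>
      (nat \<Rightarrow> 'a vfield \<Rightarrow> 'a \<Rightarrow> real) \<Rightarrow> ('a vfield \<Rightarrow> 'a vfield \<Rightarrow> 'a \<Rightarrow> real) \<Rightarrow> nat \<Rightarrow> bool" where
  "three_quasi_sasakian_of_rank A \<phi> \<xi> \<eta> g k \<longleftrightarrow>
     three_quasi_sasakian A \<phi> \<xi> \<eta> g \<and> (\<forall>\<alpha>\<in>{1,2,3}. cartan_class A (\<eta> \<alpha>) k)"


section \<open>Almost cosymplectic spheres\<close>

definition almost_cosymplectic ::
    "('a::{t2_space,second_countable_topology}, 'e::euclidean_space) atlas \<Rightarrow>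
      ('a vfield \<Rightarrow> 'a \<Rightarrow> real) \<Rightarrow> ('a vfield \<Rightarrow> 'a vfield \<Rightarrow> 'a \<Rightarrow> real) \<Rightarrow> bool" where
  "almost_cosymplectic A \<eta> \<Omega> \<longleftrightarrow> one_form A \<eta> \<and> two_form A \<Omega> \<and>
     (\<exists>m. DIM('e) = 2 * m + 1 \<and>
        nowhere_zero A (wedge 1 (2 * m) (of_one_form \<eta>) (wedge_power \<Omega> m)))"

text \<open>The unit sphere of dimension \<open>p\<close>, with coordinates numbered \<open>1, \<dots>, p + 1\<close>; the
  remaining values of \<open>s\<close> are unconstrained and never used.\<close>

definition unit_sphere :: "nat \<Rightarrow> (nat \<Rightarrow> real) set" where
  "unit_sphere p = {s. (\<Sum>i = 1..p + 1. (s i)\<^sup>2) = 1}"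

definition comb_vfield :: "nat \<Rightarrow> (nat \<Rightarrow> real) \<Rightarrow> (nat \<Rightarrow> 'a vfield) \<Rightarrow> 'a vfield" where
  "comb_vfield p s \<xi> = (\<Sum>i = 1..p + 1. (\<lambda>_. s i) \<odot> \<xi> i)"

definition comb_endo ::
    "nat \<Rightarrow> (nat \<Rightarrow> real) \<Rightarrow> (nat \<Rightarrow> 'a vfield \<Rightarrow> 'a vfield) \<Rightarrow> 'a vfield \<Rightarrow> 'a vfield" where
  "comb_endo p s \<phi> X = (\<Sum>i = 1..p + 1. (\<lambda>_. s i) \<odot> \<phi> i X)"

definition comb_form1 :: "nat \<Rightarrow> (nat \<Rightarrow> real) \<Rightarrow> (nat \<Rightarrow> 'a vfield \<Rightarrow> 'a \<Rightarrow> real) \<Rightarrow>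
    'a vfield \<Rightarrow> 'a \<Rightarrow> real" where
  "comb_form1 p s \<eta> X = (\<Sum>i = 1..p + 1. (\<lambda>_. s i) * \<eta> i X)"

definition comb_form2 :: "nat \<Rightarrow> (nat \<Rightarrow> real) \<Rightarrow> (nat \<Rightarrow> 'a vfield \<Rightarrow> 'a vfield \<Rightarrow> 'a \<Rightarrow> real) \<Rightarrow>
    'a vfield \<Rightarrow> 'a vfield \<Rightarrow> 'a \<Rightarrow> real" where
  "comb_form2 p s \<Omega> X Y = (\<Sum>i = 1..p + 1. (\<lambda>_. s i) * \<Omega> i X Y)"

definition almost_cosymplectic_sphere ::
    "('a::{t2_space,second_countable_topology}, 'e::euclidean_space) atlas \<Rightarrow> nat \<Rightarrow>
      (nat \<Rightarrow> 'a vfield \<Rightarrow> 'a \<Rightarrow> real) \<Rightarrow>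
      (nat \<Rightarrow> 'a vfield \<Rightarrow> 'a vfield \<Rightarrow> 'a \<Rightarrow> real) \<Rightarrow> bool" where
  "almost_cosymplectic_sphere A p \<eta> \<Omega> \<longleftrightarrow> p \<ge> 1 \<and>
     (\<forall>i\<in>{1..p + 1}. almost_cosymplectic A (\<eta> i) (\<Omega> i)) \<and>
     (\<forall>s\<in>unit_sphere p. almost_cosymplectic A (comb_form1 p s \<eta>) (comb_form2 p s \<Omega>))"

definition quasi_contact_sphere ::
    "('a::{t2_space,second_countable_topology}, 'e::euclidean_space) atlas \<Rightarrow> nat \<Rightarrow>
      (nat \<Rightarrow> 'a vfield \<Rightarrow> 'a \<Rightarrow> real) \<Rightarrow>
      (nat \<Rightarrow> 'a vfield \<Rightarrow> 'a vfield \<Rightarrow> 'a \<Rightarrow> real) \<Rightarrow> nat \<Rightarrow> bool" where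
  "quasi_contact_sphere A p \<eta> \<Omega> k \<longleftrightarrow> almost_cosymplectic_sphere A p \<eta> \<Omega> \<and> k > 0 \<and>
     (\<forall>s\<in>unit_sphere p.
        closed_two_form A (comb_form2 p s \<Omega>) \<and> cartan_class A (comb_form1 p s \<eta>) k)"

end

theory Submission
  imports Defs
begin

text \<open>
  Passing to the product with the line turns the three almost contact structures into an almost
  hypercomplex structure \<open>J\<^sub>1, J\<^sub>2, J\<^sub>3\<close> with vanishing Nijenhuis tensors; a purely algebraic identity
  then kills the mixed tensors, so \<open>\<Sum> \<lambda>\<^sub>i J\<^sub>i\<close> is integrable, which is the normality of
  \<open>\<phi>\<^sub>\<lambda>\<close>. Closedness is linear in \<open>\<lambda>\<close>.

  For the rank, the Reeb fields are Killing, so Cartan's formula gives \<open>L\<^bsub>\<xi>\<^sub>1\<^esub> \<Omega>\<^sub>2 = d\<eta>\<^sub>3\<close> and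
  \<open>L\<^bsub>\<xi>\<^sub>1\<^esub> \<Omega>\<^sub>3 = - d\<eta>\<^sub>2\<close>. Comparing both through \<open>\<phi>\<^sub>3 = \<phi>\<^sub>1 \<phi>\<^sub>2 - \<eta>\<^sub>2 \<otimes> \<xi>\<^sub>1\<close> yields
  \<open>d\<eta>\<^sub>2(X, Y) = d\<eta>\<^sub>3(\<phi>\<^sub>1 X, Y)\<close> for horizontal \<open>X\<close>. So on horizontal vectors
  \<open>d\<eta>\<^sub>\<alpha>(\<phi>\<^sub>\<alpha> X, Y)\<close> does not depend on \<open>\<alpha>\<close>, and on vertical ones \<open>d\<eta>\<^sub>\<alpha>\<close> is a multiple of the cross
  product. Hence for a unit vector \<open>\<nu>\<close> the automorphism that is \<open>\<phi>\<^sub>\<nu>\<close> on horizontal vectors and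
  the half turn about \<open>\<nu>\<close> on vertical ones carries \<open>(\<eta>\<^sub>\<lambda>, d\<eta>\<^sub>\<lambda>)\<close> to \<open>(\<eta>\<^sub>\<mu>, d\<eta>\<^sub>\<mu>)\<close> for the half
  turn \<open>\<mu>\<close> of \<open>\<lambda>\<close>. Some half turn takes \<open>\<lambda>\<close> to \<open>(1, 0, 0)\<close>, so \<open>\<eta>\<^sub>\<lambda>\<close> has the Cartan class of \<open>\<eta>\<^sub>1\<close>.

  That \<open>\<eta> \<and> \<Omega>\<^sup>m\<close> is a volume form needs the actual tangent spaces: vector fields, being
  derivations, admit local frames of \<open>DIM('e)\<close> elements by Hadamard's lemma, and \<open>\<Omega>\<close> is
  symplectic on the kernel of \<open>\<eta>\<close>.
\<close>

section \<open>Smooth functions on Euclidean space\<close>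

text \<open>Openness carries the induction: functions agreeing on an open set agree near each of its
  points, hence share their Frechet derivatives there.\<close>

lemma Ck_on_cong:
  assumes "open S" "\<And>x. x \<in> S \<Longrightarrow> f x = g x" "Ck_on k S f"
  shows "Ck_on k S g"
  using assms(2,3)
proof (induction k arbitrary: f g)
  case 0
  then show ?case using continuous_on_cong[of S S f g] by simp
next
  case (Suc k)
  have d: "g differentiable at x" "frechet_derivative f (at x) = frechet_derivative g (at x)"
    if "x \<in> S" for x
  proof -
    have f: "f differentiable at x" using Suc.prems that by simp
    show "frechet_derivative f (at x) = frechet_derivative g (at x)"
      by (rule frechet_derivative_transform_within_open[OF f assms(1) that Suc.prems(1)])
    show "g differentiable at x"
      using has_derivative_transform_within_open[OF f[unfolded frechet_derivative_works] assms(1) that Suc.prems(1)]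
      unfolding differentiable_def by blast
  qed
  have "Ck_on k S (\<lambda>x. frechet_derivative g (at x) v)" for v
    using Suc.IH[of "\<lambda>x. frechet_derivative f (at x) v" "\<lambda>x. frechet_derivative g (at x) v"] d Suc.prems(2)
    by simp
  then show ?case using d by simp
qed

lemma Ck_on_subset: "T \<subseteq> S \<Longrightarrow> Ck_on k S f \<Longrightarrow> Ck_on k T f"
  by (induction k arbitrary: f) (auto intro: continuous_on_subset)

lemma Ck_on_Suc_imp: "Ck_on (Suc k) S f \<Longrightarrow> Ck_on k S f"
proof (induction k arbitrary: f)
  case 0
  then have "\<forall>x\<in>S. isCont f x" using differentiable_imp_continuous_within by auto
  then show ?case using continuous_at_imp_continuous_on by simp
next
  case (Suc k)
  have d: "\<forall>x\<in>S. f differentiable at x"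
    and "Ck_on (Suc k) S (\<lambda>x. frechet_derivative f (at x) v)" for v
    using Suc.prems by auto
  then have "Ck_on k S (\<lambda>x. frechet_derivative f (at x) v)" for v
    using Suc.IH by blast
  then show ?case using d by simp
qed

text \<open>Derivatives in \<open>Ck_on\<close> are taken in the full space, not within the set, so
  only the continuity at level 0 has to be glued.\<close>

lemma Ck_on_open_Un:
  "open S \<Longrightarrow> open T \<Longrightarrow> Ck_on k S f \<Longrightarrow> Ck_on k T f \<Longrightarrow> Ck_on k (S \<union> T) f"
  by (induction k arbitrary: f) (auto intro: continuous_on_open_Un)

lemma Ck_on_const: "Ck_on k S (\<lambda>_. a)"
  by (induction k arbitrary: a) auto

text \<open>Lets the closure proofs use an explicit derivative from the derivative calculus in place
  of \<open>frechet_derivative\<close>.\<close>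

lemma Ck_on_SucI:
  assumes "open S" "\<And>x. x \<in> S \<Longrightarrow> (f has_derivative D x) (at x)" "\<And>v. Ck_on k S (\<lambda>x. D x v)"
  shows "Ck_on (Suc k) S f"
proof -
  have e: "frechet_derivative f (at x) = D x" if "x \<in> S" for x
    using assms(2)[OF that] frechet_derivative_at by metis
  have "Ck_on k S (\<lambda>x. frechet_derivative f (at x) v)" for v
    by (rule Ck_on_cong[OF assms(1) _ assms(3)[of v]]) (simp add: e)
  moreover have "f differentiable (at x)" if "x \<in> S" for x
    using assms(2)[OF that] unfolding differentiable_def by blast
  ultimately show ?thesis by simp
qed

lemma Ck_on_SucD:
  assumes "Ck_on (Suc k) S f" "x \<in> S"
  shows "(f has_derivative frechet_derivative f (at x)) (at x)"
  using assms frechet_derivative_works by auto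

lemma Ck_on_bounded_linear_comp:
  assumes "open S" "bounded_linear L" "Ck_on k S f"
  shows "Ck_on k S (\<lambda>x. L (f x))"
  using assms(3)
proof (induction k arbitrary: f)
  case 0
  then show ?case using assms(2) by (simp add: bounded_linear.continuous_on)
next
  case (Suc k)
  show ?case
    by (rule Ck_on_SucI[OF assms(1) bounded_linear.has_derivative[OF assms(2) Ck_on_SucD[OF Suc.prems]]])
       (use Suc in auto)
qed

lemma Ck_on_add:
  assumes "open S" "Ck_on k S f" "Ck_on k S g"
  shows "Ck_on k S (\<lambda>x. f x + g x)"
  using assms(2,3)
proof (induction k arbitrary: f g)
  case 0
  then show ?case by (simp add: continuous_on_add)
next
  case (Suc k)
  show ?case
    by (rule Ck_on_SucI[OF assms(1) has_derivative_add[OF Ck_on_SucD[OF Suc.prems(1)] Ck_on_SucD[OF Suc.prems(2)]]])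
       (use Suc in auto)
qed

lemma Ck_on_sum:
  assumes "open S" "\<And>i. i \<in> I \<Longrightarrow> Ck_on k S (f i)"
  shows "Ck_on k S (\<lambda>x. \<Sum>i\<in>I. f i x)"
  using assms(2)
  by (induction I rule: infinite_finite_induct) (auto intro: Ck_on_const Ck_on_add[OF assms(1)])

lemma Ck_on_mult:
  fixes f g :: "'e::euclidean_space \<Rightarrow> real"
  assumes "open S" "Ck_on k S f" "Ck_on k S g"
  shows "Ck_on k S (\<lambda>x. f x * g x)"
  using assms(2,3)
proof (induction k arbitrary: f g)
  case 0
  then show ?case by (simp add: continuous_on_mult)
next
  case (Suc k)
  have "Ck_on k S f" "Ck_on k S g" using Suc.prems Ck_on_Suc_imp by blast+
  then show ?case
    by (intro Ck_on_SucI[OF assms(1) has_derivative_mult[OF Ck_on_SucD[OF Suc.prems(1)] Ck_on_SucD[OF Suc.prems(2)]]])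
       (use Suc in \<open>auto intro!: Ck_on_add[OF assms(1)]\<close>)
qed

lemma Ck_on_linear:
  assumes "open S" "bounded_linear L"
  shows "Ck_on k S L"
proof (cases k)
  case 0
  then show ?thesis using assms(2) linear_continuous_on by auto
next
  case (Suc l)
  have "Ck_on (Suc l) S L"
    by (rule Ck_on_SucI[OF assms(1) bounded_linear_imp_has_derivative[OF assms(2)] Ck_on_const])
  then show ?thesis using Suc by simp
qed

lemma Ck_on_comp:
  fixes f :: "'e::euclidean_space \<Rightarrow> real" and g :: "'d::euclidean_space \<Rightarrow> 'e"
  assumes "open S" "open T" "g ` S \<subseteq> T" "Ck_on k S g" "Ck_on k T f"
  shows "Ck_on k S (\<lambda>x. f (g x))"
  using assms(4,5)
proof (induction k arbitrary: f)
  case 0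
  then show ?case using assms(3) continuous_on_compose2 by auto
next
  case (Suc k)
  have gk: "Ck_on k S g" using Suc.prems Ck_on_Suc_imp by blast
  have fd: "(f has_derivative frechet_derivative f (at (g x))) (at (g x))" if "x \<in> S" for x
    using Ck_on_SucD[OF Suc.prems(2)] assms(3) that by auto
  \<comment> \<open>The derivative of \<open>f\<close> at \<open>g x\<close> acts on a vector that
    varies with \<open>x\<close>, whereas the induction hypothesis speaks of fixed directions.
    Expanding that vector in the basis yields products covered by the earlier closure rules.\<close>
  define D where "D x v = (\<Sum>i\<in>Basis. (frechet_derivative g (at x) v \<bullet> i) * frechet_derivative f (at (g x)) i)"
    for x v
  have lin: "frechet_derivative f (at (g x)) w = (\<Sum>i\<in>Basis. (w \<bullet> i) * frechet_derivative f (at (g x)) i)"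
    if "x \<in> S" for x w
  proof -
    have l: "linear (frechet_derivative f (at (g x)))"
      using fd[OF that] has_derivative_linear by blast
    show ?thesis
      by (subst euclidean_representation[of w, symmetric])
         (simp add: linear_sum[OF l] linear_cmul[OF l])
  qed
  show ?case
  proof (rule Ck_on_SucI[OF assms(1), where D=D])
    fix x assume x: "x \<in> S"
    have "((\<lambda>x. f (g x)) has_derivative (\<lambda>v. frechet_derivative f (at (g x)) (frechet_derivative g (at x) v))) (at x)"
      by (rule has_derivative_compose[OF Ck_on_SucD[OF Suc.prems(1) x] fd[OF x]])
    then show "((\<lambda>x. f (g x)) has_derivative D x) (at x)"
      unfolding D_def lin[OF x, symmetric] .
  next
    fix v
    show "Ck_on k S (\<lambda>x. D x v)"
      unfolding D_def
    proof (intro Ck_on_sum[OF assms(1)] Ck_on_mult[OF assms(1)])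
      fix i :: 'e
      show "Ck_on k S (\<lambda>x. frechet_derivative g (at x) v \<bullet> i)"
        by (rule Ck_on_bounded_linear_comp[OF assms(1) bounded_linear_inner_left]) (use Suc.prems in simp)
      show "Ck_on k S (\<lambda>x. frechet_derivative f (at (g x)) i)"
        by (rule Suc.IH[OF gk]) (use Suc.prems in simp)
    qed
  qed
qed

lemma Ck_on_smooth: "smooth_on S f \<Longrightarrow> Ck_on k S f"
  by (simp add: smooth_on_def)

lemma smooth_onI: "(\<And>k. Ck_on k S f) \<Longrightarrow> smooth_on S f"
  by (simp add: smooth_on_def)

lemma smooth_on_frechet: "smooth_on S f \<Longrightarrow> smooth_on S (\<lambda>x. frechet_derivative f (at x) v)"
  using Ck_on.simps(2) unfolding smooth_on_def by blast

lemma smooth_on_has_derivative: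
  "smooth_on S f \<Longrightarrow> x \<in> S \<Longrightarrow> (f has_derivative frechet_derivative f (at x)) (at x)"
  using Ck_on_SucD unfolding smooth_on_def by blast

lemma smooth_on_cong:
  "open S \<Longrightarrow> (\<And>x. x \<in> S \<Longrightarrow> f x = g x) \<Longrightarrow> smooth_on S f \<Longrightarrow> smooth_on S g"
  using Ck_on_cong unfolding smooth_on_def by metis

lemma smooth_on_subset: "T \<subseteq> S \<Longrightarrow> smooth_on S f \<Longrightarrow> smooth_on T f"
  using Ck_on_subset unfolding smooth_on_def by blast

lemma smooth_on_const: "smooth_on S (\<lambda>_. a)"
  by (simp add: smooth_onI Ck_on_const)

lemma smooth_on_add:
  "open S \<Longrightarrow> smooth_on S f \<Longrightarrow> smooth_on S g \<Longrightarrow> smooth_on S (\<lambda>x. f x + g x)"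
  by (simp add: smooth_on_def Ck_on_add)

lemma smooth_on_sum:
  "open S \<Longrightarrow> (\<And>i. i \<in> I \<Longrightarrow> smooth_on S (f i)) \<Longrightarrow> smooth_on S (\<lambda>x. \<Sum>i\<in>I. f i x)"
  by (simp add: smooth_on_def Ck_on_sum)

lemma smooth_on_mult:
  fixes f g :: "'e::euclidean_space \<Rightarrow> real"
  shows "open S \<Longrightarrow> smooth_on S f \<Longrightarrow> smooth_on S g \<Longrightarrow> smooth_on S (\<lambda>x. f x * g x)"
  by (simp add: smooth_on_def Ck_on_mult)

lemma smooth_on_comp:
  fixes f :: "'e::euclidean_space \<Rightarrow> real" and g :: "'d::euclidean_space \<Rightarrow> 'e"
  assumes "open S" "open T" "g ` S \<subseteq> T" "smooth_on S g" "smooth_on T f"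
  shows "smooth_on S (\<lambda>x. f (g x))"
  using Ck_on_comp[OF assms(1-3)] assms(4,5) unfolding smooth_on_def by blast

lemma smooth_on_linear: "open S \<Longrightarrow> bounded_linear L \<Longrightarrow> smooth_on S L"
  by (simp add: smooth_onI Ck_on_linear)

section \<open>Bump functions and Hadamard's lemma\<close>

text \<open>The functions that vanish on the negative axis and equal \<open>p(1/x) exp(-1/x)\<close> on the positive
  one are closed under differentiation, so they are all smooth.\<close>

definition flat :: "real poly \<Rightarrow> real \<Rightarrow> real" where
  "flat p x = (if x > 0 then poly p (1 / x) * exp (- (1 / x)) else 0)"

text \<open>The substitution y = 1/x turns this into the decay of polynomials against the
  exponential at infinity.\<close>

lemma flat_tendsto_0:
  fixes p :: "real poly"
  shows "((\<lambda>x. poly p (1 / x) * exp (- (1 / x))) \<longlongrightarrow> 0) (at_right 0)"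
proof -
  have "((\<lambda>y. \<Sum>i\<le>degree p. coeff p i * (y ^ i / exp y)) \<longlongrightarrow> (\<Sum>i\<le>degree p. coeff p i * 0)) at_top"
    by (intro tendsto_sum tendsto_mult tendsto_const tendsto_power_div_exp_0)
  then have "((\<lambda>y. poly p y * exp (- y)) \<longlongrightarrow> 0) at_top"
    by (simp add: poly_altdef sum_distrib_right exp_minus divide_inverse mult.assoc)
  from filterlim_compose[OF this filterlim_inverse_at_top_right]
  show ?thesis by (simp add: divide_inverse)
qed

text \<open>The polynomial comes from the chain rule: differentiating p(1/x) exp(-1/x) gives (p -
  p')(1/x) exp(-1/x) / x^2. Gluing at the origin rests on \<open>flat_tendsto_0\<close>.\<close>

lemma flat_has_field_derivative:
  "(flat p has_field_derivative flat (monom 1 2 * (p - pderiv p)) x) (at x)"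
proof (cases x "0 :: real" rule: linorder_cases)
  case greater
  have "((\<lambda>x. poly p (1 / x) * exp (- (1 / x))) has_field_derivative
      flat (monom 1 2 * (p - pderiv p)) x) (at x)"
    using greater
    by (auto intro!: derivative_eq_intros simp: flat_def poly_monom field_simps power2_eq_square)
  then show ?thesis
    by (rule has_field_derivative_transform_within_open[where S="{0<..}"])
       (use greater in \<open>auto simp: flat_def\<close>)
next
  case less
  have "((\<lambda>x. 0) has_field_derivative flat (monom 1 2 * (p - pderiv p)) x) (at x)"
    using less by (simp add: flat_def)
  then show ?thesis
    by (rule has_field_derivative_transform_within_open[where S="{..<0}"])
       (use less in \<open>auto simp: flat_def\<close>)
next
  case equal
  \<comment> \<open>The difference quotient at 0 has the same shape, with the polynomial y
    p(y).\<close>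
  have "((\<lambda>x. flat p x / x) \<longlongrightarrow> 0) (at_right 0)"
    using flat_tendsto_0[of "pCons 0 p"]
    by (rule Lim_transform_eventually)
       (auto simp: eventually_at_filter flat_def)
  moreover have "((\<lambda>x. flat p x / x) \<longlongrightarrow> 0) (at_left 0)"
    by (rule tendsto_eventually) (auto simp: eventually_at_filter flat_def)
  ultimately have "((\<lambda>x. flat p x / x) \<longlongrightarrow> 0) (at 0)"
    using filterlim_split_at by blast
  then show ?thesis
    using equal by (simp add: has_field_derivative_iff flat_def)
qed

lemma Ck_on_flat: "Ck_on k UNIV (flat p)"
proof (induction k arbitrary: p)
  case 0
  then show ?case
    using DERIV_isCont[OF flat_has_field_derivative] by (simp add: continuous_at_imp_continuous_on)
next
  case (Suc k)
  show ?case
  proof (rule Ck_on_SucI[OF open_UNIV])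
    show "(flat p has_derivative (\<lambda>v. flat (monom 1 2 * (p - pderiv p)) x * v)) (at x)" for x
      using flat_has_field_derivative[of p x] unfolding has_field_derivative_def by simp
    show "Ck_on k UNIV (\<lambda>x. flat (monom 1 2 * (p - pderiv p)) x * v)" for v
      by (intro Ck_on_mult Suc Ck_on_const open_UNIV)
  qed
qed

lemma smooth_bump:
  fixes a :: "'e::euclidean_space"
  assumes "r > 0"
  obtains \<beta> :: "'e \<Rightarrow> real" where "smooth_on UNIV \<beta>" "\<And>x. \<beta> x > 0 \<longleftrightarrow> x \<in> ball a r"
    "\<And>x. x \<notin> ball a r \<Longrightarrow> \<beta> x = 0"
proof
  \<comment> \<open>This is r^2 - |x - a|^2, written with sums and products alone so that the
    smoothness rules apply; the bump is exp(-1/q) where q is positive.\<close>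
  define q where "q x = r\<^sup>2 + (-1) * (\<Sum>i\<in>Basis. (x \<bullet> i + (- a) \<bullet> i) * (x \<bullet> i + (- a) \<bullet> i))" for x :: 'e
  have q: "q x = r\<^sup>2 - (dist a x)\<^sup>2" for x
    unfolding q_def dist_norm power2_norm_eq_inner euclidean_inner[of "a - x" "a - x"]
    by (simp add: inner_diff_left algebra_simps)
  have "smooth_on UNIV q"
    unfolding q_def
    by (intro smooth_on_add smooth_on_mult smooth_on_const smooth_on_sum smooth_on_linear
        bounded_linear_inner_left open_UNIV)
  then show "smooth_on UNIV (\<lambda>x. flat 1 (q x))"
    using smooth_on_comp[of UNIV UNIV q "flat 1"] Ck_on_flat by (auto simp: smooth_on_def)
  have "q x > 0 \<longleftrightarrow> x \<in> ball a r" for x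
    unfolding q using assms abs_less_iff power2_less_imp_less[of "dist a x" r]
      power_strict_mono[of "dist a x" r 2] by auto
  then show "flat 1 (q x) > 0 \<longleftrightarrow> x \<in> ball a r" "x \<notin> ball a r \<Longrightarrow> flat 1 (q x) = 0" for x
    by (auto simp: flat_def)
qed

text \<open>Differentiation under the integral sign multiplies the integrand by t and replaces
  \<open>u\<close> by a partial derivative. The weight \<open>t ^ j\<close> is carried along so that
  the induction on \<open>k\<close> closes.\<close>

lemma Ck_on_ray_integral:
  fixes u :: "'e::euclidean_space \<Rightarrow> real"
  assumes S: "open S" "convex S" "q \<in> S" and "smooth_on S u"
  shows "Ck_on k S (\<lambda>x. integral (cbox 0 1) (\<lambda>t::real. t ^ j * u (q + t *\<^sub>R (x - q))))"
  using assms(4)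
proof (induction k arbitrary: u j)
  case (0 u j)
  have mem: "q + t *\<^sub>R (x - q) \<in> S" if "x \<in> S" "t \<in> {0..1}" for x t
    using convexD_alt[OF S(2,3) that(1), of t] that(2) by (simp add: algebra_simps)
  have "continuous_on S u" using Ck_on_smooth[OF 0, of 0] by simp
  then have "continuous_on (S \<times> cbox 0 1) (\<lambda>(x, t). t ^ j * u (q + t *\<^sub>R (x - q)))"
    unfolding split_beta
    by (intro continuous_intros continuous_on_compose2[where f="\<lambda>z. q + snd z *\<^sub>R (fst z - q)" and g=u])
       (use mem in auto)
  from integral_continuous_on_param[OF this] show ?case by simp
next
  case (Suc k u j)
  have mem: "q + t *\<^sub>R (x - q) \<in> S" if "x \<in> S" "t \<in> {0..1}" for x t
    using convexD_alt[OF S(2,3) that(1), of t] that(2) by (simp add: algebra_simps)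
  let ?D = "\<lambda>y. frechet_derivative u (at y)"
  have cD: "continuous_on S (\<lambda>y. ?D y v)" for v
    using Ck_on_smooth[OF smooth_on_frechet[OF Suc.prems], of 0] by simp
  have bl: "bounded_linear (?D y)" if "y \<in> S" for y
    using smooth_on_has_derivative[OF Suc.prems that] has_derivative_bounded_linear by blast
  \<comment> \<open>The derivative of the integrand in \<open>x\<close>, as a bounded linear map
    depending continuously on both variables, which is the format of
    \<open>leibniz_rule\<close>.\<close>
  define F where "F x t = t ^ Suc j *\<^sub>R Blinfun (?D (q + t *\<^sub>R (x - q)))" for x and t :: real
  have F: "blinfun_apply (F x t) v = t ^ Suc j * ?D (q + t *\<^sub>R (x - q)) v"
    if "x \<in> S" "t \<in> {0..1}" for x t v
    unfolding F_def using bl[OF mem[OF that]]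
    by (simp add: blinfun.scaleR_left bounded_linear_Blinfun_apply)
  have contF: "continuous_on (S \<times> cbox 0 1) (\<lambda>(x, t). F x t)"
  proof (rule continuous_on_blinfun_componentwise)
    fix i :: 'e
    have "continuous_on (S \<times> cbox 0 1) (\<lambda>(x, t). t ^ Suc j * ?D (q + t *\<^sub>R (x - q)) i)"
      unfolding split_beta
      by (intro continuous_intros continuous_on_compose2[where f="\<lambda>z. q + snd z *\<^sub>R (fst z - q)" and g="\<lambda>y. ?D y i", OF cD])
         (use mem in auto)
    then show "continuous_on (S \<times> cbox 0 1) (\<lambda>z. blinfun_apply (case z of (x, t) \<Rightarrow> F x t) i)"
      by (rule continuous_on_eq) (auto simp: F)
  qed
  show ?case
  proof (rule Ck_on_SucI[OF S(1)])
    fix x assume x: "x \<in> S"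
    have "((\<lambda>x. integral (cbox 0 1) (\<lambda>t. t ^ j * u (q + t *\<^sub>R (x - q)))) has_derivative
        blinfun_apply (integral (cbox 0 1) (F x))) (at x within S)"
    proof (rule leibniz_rule[OF _ _ contF x S(2)])
      fix x' and t :: real assume a: "x' \<in> S" "t \<in> cbox 0 1"
      then have m: "q + t *\<^sub>R (x' - q) \<in> S" using mem by simp
      have "((\<lambda>x. u (q + t *\<^sub>R (x - q))) has_derivative (\<lambda>v. ?D (q + t *\<^sub>R (x' - q)) (t *\<^sub>R v))) (at x' within S)"
        by (rule has_derivative_compose[where f="\<lambda>x. q + t *\<^sub>R (x - q)" and g=u,
              OF _ smooth_on_has_derivative[OF Suc.prems m]])
           (auto intro!: derivative_eq_intros)
      moreover have "?D (q + t *\<^sub>R (x' - q)) (t *\<^sub>R v) = t * ?D (q + t *\<^sub>R (x' - q)) v" for v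
        using linear_cmul[OF bounded_linear.linear[OF bl[OF m]], of t v] by simp
      ultimately have "((\<lambda>x. u (q + t *\<^sub>R (x - q))) has_derivative (\<lambda>v. t * ?D (q + t *\<^sub>R (x' - q)) v)) (at x' within S)"
        by simp
      from has_derivative_mult_right[OF this, of "t ^ j"]
      show "((\<lambda>x. t ^ j * u (q + t *\<^sub>R (x - q))) has_derivative blinfun_apply (F x' t)) (at x' within S)"
        by (rule has_derivative_eq_rhs) (use a in \<open>auto simp: F algebra_simps\<close>)
    next
      fix x' assume x': "x' \<in> S"
      have "continuous_on S u" using Ck_on_smooth[OF Suc.prems, of 0] by simp
      then have "continuous_on (cbox 0 1) (\<lambda>t. t ^ j * u (q + t *\<^sub>R (x' - q)))"
        by (intro continuous_intros continuous_on_compose2[where f="\<lambda>t. q + t *\<^sub>R (x' - q)" and g=u])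
           (use mem x' in auto)
      then show "(\<lambda>t. t ^ j * u (q + t *\<^sub>R (x' - q))) integrable_on cbox 0 1"
        by (rule integrable_continuous)
    qed
    then show "((\<lambda>x. integral (cbox 0 1) (\<lambda>t. t ^ j * u (q + t *\<^sub>R (x - q)))) has_derivative
        blinfun_apply (integral (cbox 0 1) (F x))) (at x)"
      using at_within_open[OF x S(1)] by simp
  next
    fix v
    have "blinfun_apply (integral (cbox 0 1) (F x)) v
        = integral (cbox 0 1) (\<lambda>t. t ^ Suc j * ?D (q + t *\<^sub>R (x - q)) v)" if x: "x \<in> S" for x
    proof -
      have "continuous_on (cbox 0 1) (\<lambda>t. case (x, t) of (x, t) \<Rightarrow> F x t)"
        by (rule continuous_on_compose2[OF contF continuous_on_Pair[OF continuous_on_const continuous_on_id]])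
           (use x in blast)
      then have "continuous_on (cbox 0 1) (F x)" by simp
      then have "F x integrable_on cbox 0 1" by (rule integrable_continuous)
      from blinfun_apply_integral[OF this] have "blinfun_apply (integral (cbox 0 1) (F x)) v
          = integral (cbox 0 1) (\<lambda>t. blinfun_apply (F x t) v)" .
      also have "\<dots> = integral (cbox 0 1) (\<lambda>t. t ^ Suc j * ?D (q + t *\<^sub>R (x - q)) v)"
        by (rule integral_cong) (use F x in simp)
      finally show ?thesis .
    qed
    moreover have "Ck_on k S (\<lambda>x. integral (cbox 0 1) (\<lambda>t. t ^ Suc j * ?D (q + t *\<^sub>R (x - q)) v))"
      by (rule Suc.IH[OF smooth_on_frechet[OF Suc.prems]])
    ultimately show "Ck_on k S (\<lambda>x. blinfun_apply (integral (cbox 0 1) (F x)) v)"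
      using Ck_on_cong[OF S(1)] by (metis (no_types, lifting))
  qed
qed

text \<open>Integrating the derivative of \<open>u\<close> along the segment from \<open>q\<close>
  to \<open>x\<close> gives the increment; the coefficients are averages of the partial derivatives
  over that segment, smooth by \<open>Ck_on_ray_integral\<close>.\<close>

lemma Hadamard_lemma:
  fixes u :: "'e::euclidean_space \<Rightarrow> real"
  assumes S: "open S" "convex S" "q \<in> S" and u: "smooth_on S u"
  obtains G where "\<And>i. smooth_on S (G i)" "\<And>i. G i q = frechet_derivative u (at q) i"
    "\<And>x. x \<in> S \<Longrightarrow> u x = u q + (\<Sum>i\<in>Basis. ((x - q) \<bullet> i) * G i x)"
proof
  let ?D = "\<lambda>y. frechet_derivative u (at y)"
  let ?G = "\<lambda>i x. integral (cbox 0 1) (\<lambda>t::real. t ^ 0 * ?D (q + t *\<^sub>R (x - q)) i)"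
  show "smooth_on S (?G i)" for i
    by (intro smooth_onI Ck_on_ray_integral S smooth_on_frechet u)
  show "?G i q = ?D q i" for i by simp
  fix x assume x: "x \<in> S"
  have mem: "q + t *\<^sub>R (x - q) \<in> S" if "t \<in> {0..1}" for t
    using convexD_alt[OF S(2,3) x, of t] that by (simp add: algebra_simps)
  have lin: "?D y w = (\<Sum>i\<in>Basis. (w \<bullet> i) * ?D y i)" if "y \<in> S" for y w
  proof -
    have l: "linear (?D y)"
      using smooth_on_has_derivative[OF u that] has_derivative_linear by blast
    have "?D y w = ?D y (\<Sum>i\<in>Basis. (w \<bullet> i) *\<^sub>R i)" by (simp add: euclidean_representation)
    also have "\<dots> = (\<Sum>i\<in>Basis. (w \<bullet> i) * ?D y i)" by (simp add: linear_sum[OF l] linear_cmul[OF l])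
    finally show ?thesis .
  qed
  have "((\<lambda>t. ?D (q + t *\<^sub>R (x - q)) (x - q)) has_integral u (q + 1 *\<^sub>R (x - q)) - u (q + 0 *\<^sub>R (x - q))) {0..1}"
  proof (rule fundamental_theorem_of_calculus)
    fix t :: real assume t: "t \<in> {0..1}"
    have "((\<lambda>t. u (q + t *\<^sub>R (x - q))) has_derivative (\<lambda>s. ?D (q + t *\<^sub>R (x - q)) (s *\<^sub>R (x - q)))) (at t within {0..1})"
      by (rule has_derivative_compose[where f="\<lambda>t. q + t *\<^sub>R (x - q)" and g=u,
            OF _ smooth_on_has_derivative[OF u mem[OF t]]])
         (auto intro!: derivative_eq_intros)
    moreover have "linear (?D (q + t *\<^sub>R (x - q)))"
      using smooth_on_has_derivative[OF u mem[OF t]] has_derivative_linear by blast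
    ultimately show "((\<lambda>t. u (q + t *\<^sub>R (x - q))) has_vector_derivative ?D (q + t *\<^sub>R (x - q)) (x - q)) (at t within {0..1})"
      unfolding has_vector_derivative_def by (simp add: linear_cmul)
  qed simp
  then have "u x - u q = integral {0..1} (\<lambda>t. ?D (q + t *\<^sub>R (x - q)) (x - q))"
    by (simp add: integral_unique)
  also have "\<dots> = integral {0..1} (\<lambda>t. \<Sum>i\<in>Basis. ((x - q) \<bullet> i) * ?D (q + t *\<^sub>R (x - q)) i)"
    by (rule integral_cong) (use lin mem in blast)
  also have "\<dots> = (\<Sum>i\<in>Basis. integral {0..1} (\<lambda>t. ((x - q) \<bullet> i) * ?D (q + t *\<^sub>R (x - q)) i))"
  proof (rule integral_sum)
    fix i :: 'e
    have "continuous_on S (\<lambda>y. ?D y i)"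
      using Ck_on_smooth[OF smooth_on_frechet[OF u], of 0] by simp
    then have "continuous_on {0..1} (\<lambda>t. ((x - q) \<bullet> i) * ?D (q + t *\<^sub>R (x - q)) i)"
      by (intro continuous_intros continuous_on_compose2[where f="\<lambda>t. q + t *\<^sub>R (x - q)" and g="\<lambda>y. ?D y i"])
         (use mem in auto)
    then show "(\<lambda>t. ((x - q) \<bullet> i) * ?D (q + t *\<^sub>R (x - q)) i) integrable_on {0..1}"
      by (rule integrable_continuous_real)
  qed simp
  finally show "u x = u q + (\<Sum>i\<in>Basis. ((x - q) \<bullet> i) * ?G i x)" by simp
qed

section \<open>Smooth functions and vector fields on a manifold\<close>

lemma sum_apply: "(\<Sum>i\<in>I. f i) x = (\<Sum>i\<in>I. f i x)"
  by (induction I rule: infinite_finite_induct) simp_all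

locale smooth_manifold =
  fixes A :: "('a::{t2_space,second_countable_topology}, 'e::euclidean_space) atlas"
  assumes atlas: "smooth_atlas A"
begin

abbreviation "F \<equiv> smooth_functions A"
abbreviation "VF \<equiv> vector_fields A"

lemma chart:
  assumes "(U, c) \<in> A"
  shows "open U" "open (c ` U)" "homeomorphism U (c ` U) c (inv_into U c)"
  using atlas assms unfolding smooth_atlas_def by blast+

lemma chart_inverse: "(U, c) \<in> A \<Longrightarrow> q \<in> U \<Longrightarrow> inv_into U c (c q) = q"
  using homeomorphism_apply1[OF chart(3)] .

lemma open_chart_image:
  assumes "(U, c) \<in> A" "open W" "W \<subseteq> U"
  shows "open (c ` W)"
proof -
  have "openin (top_of_set (c ` U)) (c ` W)"
    using homeomorphism_imp_open_map[OF chart(3)[OF assms(1)]] assms(2,3) chart(1)[OF assms(1)]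
    by (simp add: openin_open_eq)
  then show ?thesis using chart(2)[OF assms(1)] by (simp add: openin_open_eq)
qed

lemma smooth_functionsD: "f \<in> F \<Longrightarrow> (U, c) \<in> A \<Longrightarrow> smooth_on (c ` U) (f \<circ> inv_into U c)"
  unfolding smooth_functions_def by blast

lemma smooth_functionsI: "(\<And>U c. (U, c) \<in> A \<Longrightarrow> smooth_on (c ` U) (f \<circ> inv_into U c)) \<Longrightarrow> f \<in> F"
  unfolding smooth_functions_def by blast

lemma smooth_const [simp, intro]: "(\<lambda>_. a) \<in> F"
  by (rule smooth_functionsI) (simp add: o_def smooth_on_const)

lemma smooth_0 [simp, intro]: "0 \<in> F"
  using smooth_const[of 0] by (simp add: zero_fun_def)

lemma smooth_1 [simp, intro]: "1 \<in> F"
  using smooth_const[of 1] by (simp add: one_fun_def)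

lemma smooth_add [simp, intro]:
  assumes "f \<in> F" "h \<in> F" shows "f + h \<in> F"
proof (rule smooth_functionsI)
  fix U c assume c: "(U, c) \<in> A"
  from smooth_on_add[OF chart(2)[OF c] smooth_functionsD[OF assms(1) c] smooth_functionsD[OF assms(2) c]]
  show "smooth_on (c ` U) ((f + h) \<circ> inv_into U c)" by (simp add: o_def)
qed

lemma smooth_mult [simp, intro]:
  assumes "f \<in> F" "h \<in> F" shows "f * h \<in> F"
proof (rule smooth_functionsI)
  fix U c assume c: "(U, c) \<in> A"
  from smooth_on_mult[OF chart(2)[OF c] smooth_functionsD[OF assms(1) c] smooth_functionsD[OF assms(2) c]]
  show "smooth_on (c ` U) ((f * h) \<circ> inv_into U c)" by (simp add: o_def)
qed

lemma minus_one_times_fun: "(\<lambda>_. - 1) * f = - (f :: 'b \<Rightarrow> real)"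
  by (rule ext) simp

lemma smooth_uminus [simp, intro]: "f \<in> F \<Longrightarrow> - f \<in> F"
  using smooth_mult[OF smooth_const[of "- 1"]] by (simp add: minus_one_times_fun)

lemma smooth_diff [simp, intro]: "f \<in> F \<Longrightarrow> h \<in> F \<Longrightarrow> f - h \<in> F"
  using smooth_add[of f "- h"] by simp

lemma smooth_sum [intro]: "(\<And>i. i \<in> I \<Longrightarrow> f i \<in> F) \<Longrightarrow> sum f I \<in> F"
  by (induction I rule: infinite_finite_induct) auto

lemma VF_smooth: "X \<in> VF \<Longrightarrow> f \<in> F \<Longrightarrow> X f \<in> F"
  and VF_nonsmooth: "X \<in> VF \<Longrightarrow> f \<notin> F \<Longrightarrow> X f = 0"
  and VF_plus: "X \<in> VF \<Longrightarrow> f \<in> F \<Longrightarrow> h \<in> F \<Longrightarrow> X (f + h) = X f + X h"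
  and VF_cmult: "X \<in> VF \<Longrightarrow> f \<in> F \<Longrightarrow> X ((\<lambda>_. a) * f) = (\<lambda>_. a) * X f"
  and VF_times: "X \<in> VF \<Longrightarrow> f \<in> F \<Longrightarrow> h \<in> F \<Longrightarrow> X (f * h) = X f * h + f * X h"
  unfolding vector_fields_def by blast+

lemma VF_I:
  assumes "\<And>f. f \<in> F \<Longrightarrow> X f \<in> F" "\<And>f. f \<notin> F \<Longrightarrow> X f = 0"
    "\<And>f h. f \<in> F \<Longrightarrow> h \<in> F \<Longrightarrow> X (f + h) = X f + X h"
    "\<And>f a. f \<in> F \<Longrightarrow> X ((\<lambda>_. a) * f) = (\<lambda>_. a) * X f"
    "\<And>f h. f \<in> F \<Longrightarrow> h \<in> F \<Longrightarrow> X (f * h) = X f * h + f * X h"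
  shows "X \<in> VF"
  unfolding vector_fields_def
  by (intro CollectI conjI ballI allI impI; (rule assms; assumption))

declare VF_smooth [simp]

context
  fixes X assumes X: "X \<in> VF"
begin

lemma VF_uminus_arg: "f \<in> F \<Longrightarrow> X (- f) = - X f"
  using VF_cmult[OF X, of f "- 1"] by (simp add: minus_one_times_fun)

lemma VF_minus: "f \<in> F \<Longrightarrow> h \<in> F \<Longrightarrow> X (f - h) = X f - X h"
  using VF_plus[OF X, of f "- h"] by (simp add: VF_uminus_arg)

lemma VF_1_arg: "X 1 = 0"
  using VF_times[OF X, of 1 1] by simp

lemma VF_const: "X (\<lambda>_. a) = 0"
  using VF_cmult[OF X, of 1 a] VF_1_arg by (simp add: times_fun_def one_fun_def zero_fun_def)

lemma VF_0_arg: "X 0 = 0"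
  using VF_const[of 0] by (simp add: zero_fun_def)

lemma VF_sum_arg: "(\<And>i. i \<in> I \<Longrightarrow> f i \<in> F) \<Longrightarrow> X (sum f I) = (\<Sum>i\<in>I. X (f i))"
  by (induction I rule: infinite_finite_induct) (simp_all add: VF_0_arg VF_plus[OF X] smooth_sum)

lemmas VF_arith = VF_plus[OF X] VF_cmult[OF X] VF_times[OF X] VF_minus VF_uminus_arg
  VF_const VF_0_arg VF_1_arg VF_nonsmooth[OF X]

end

lemma VF_0 [simp, intro]: "0 \<in> VF"
  by (rule VF_I) auto

lemma VF_add [simp, intro]:
  assumes "X \<in> VF" "Y \<in> VF" shows "X + Y \<in> VF"
  by (rule VF_I)
     (simp_all add: assms VF_arith[OF assms(1)] VF_arith[OF assms(2)] algebra_simps)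

lemma VF_fscale [simp, intro]:
  assumes "h \<in> F" "X \<in> VF" shows "h \<odot> X \<in> VF"
  by (rule VF_I) (simp_all add: fscale_def assms VF_arith[OF assms(2)] algebra_simps)

lemma fscale_minus_one: "(\<lambda>_. - 1) \<odot> X = - X"
  by (simp add: fscale_def minus_one_times_fun fun_Compl_def)

lemma VF_uminus [simp, intro]: "X \<in> VF \<Longrightarrow> - X \<in> VF"
  using VF_fscale[of "\<lambda>_. - 1" X] by (simp add: fscale_minus_one)

lemma VF_diff [simp, intro]: "X \<in> VF \<Longrightarrow> Y \<in> VF \<Longrightarrow> X - Y \<in> VF"
  using VF_add[of X "- Y"] by simp

lemma VF_sum [intro]: "(\<And>i. i \<in> I \<Longrightarrow> X i \<in> VF) \<Longrightarrow> sum X I \<in> VF"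
  by (induction I rule: infinite_finite_induct) auto

lemma VF_lie [simp, intro]:
  assumes "X \<in> VF" "Y \<in> VF" shows "lie_bracket X Y \<in> VF"
  by (rule VF_I)
     (simp_all add: lie_bracket_def assms VF_arith[OF assms(1)] VF_arith[OF assms(2)] algebra_simps)

text \<open>The preimage L of K is closed, being compact in a Hausdorff space. In another chart
  domain V the function is \<open>h\<close> after a transition map on V \<inter> U and zero on V -
  L, and these two open sets cover V.\<close>

lemma smooth_extension:
  assumes c: "(U, c) \<in> A" and K: "compact K" "K \<subseteq> c ` U"
    and h: "smooth_on (c ` U) h" "\<And>x. x \<in> c ` U \<Longrightarrow> x \<notin> K \<Longrightarrow> h x = 0"
  shows "(\<lambda>q. if q \<in> U then h (c q) else 0) \<in> F"
proof (rule smooth_functionsI)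
  fix V d assume d: "(V, d) \<in> A"
  define L where "L = inv_into U c ` K"
  have "continuous_on K (inv_into U c)"
    using homeomorphism_cont2[OF chart(3)[OF c]] K(2) continuous_on_subset by blast
  then have "closed L"
    unfolding L_def using K(1) compact_continuous_image compact_imp_closed by blast
  have "L \<subseteq> U"
    unfolding L_def using K(2) chart_inverse[OF c] by auto
  have o1: "open (d ` (V \<inter> U))" and o2: "open (d ` (V - L))"
    using open_chart_image[OF d] chart(1)[OF c] chart(1)[OF d] \<open>closed L\<close> by auto
  let ?f = "(\<lambda>q. if q \<in> U then h (c q) else 0) \<circ> inv_into V d"
  have "smooth_on (d ` (V \<inter> U)) (\<lambda>x. h ((c \<circ> inv_into V d) x))"
  proof (rule smooth_on_comp[OF o1 chart(2)[OF c] _ _ h(1)])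
    show "smooth_on (d ` (V \<inter> U)) (c \<circ> inv_into V d)"
      using atlas c d unfolding smooth_atlas_def by blast
    show "(c \<circ> inv_into V d) ` d ` (V \<inter> U) \<subseteq> c ` U"
      using chart_inverse[OF d] by auto
  qed
  then have s1: "smooth_on (d ` (V \<inter> U)) ?f"
    by (rule smooth_on_cong[OF o1, rotated]) (use chart_inverse[OF d] in auto)
  have s2: "smooth_on (d ` (V - L)) ?f"
  proof (rule smooth_on_cong[OF o2 _ smooth_on_const[of _ 0]])
    fix x assume "x \<in> d ` (V - L)"
    then obtain q where q: "q \<in> V" "q \<notin> L" "x = d q" by blast
    have "h (c q) = 0" if "q \<in> U"
    proof (rule h(2))
      show "c q \<notin> K"
        using q(2) chart_inverse[OF c that] unfolding L_def by (metis imageI)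
    qed (use that in blast)
    then show "0 = ?f x" using q chart_inverse[OF d] by simp
  qed
  have "d ` V = d ` (V \<inter> U) \<union> d ` (V - L)" using \<open>L \<subseteq> U\<close> by auto
  then show "smooth_on (d ` V) ?f"
    using s1 s2 Ck_on_open_Un[OF o1 o2, of _ ?f] by (auto simp: smooth_on_def)
qed

end

section \<open>Local frames\<close>

context smooth_manifold
begin

text \<open>Vector fields act only on globally defined functions, so coordinate fields and
  coordinate functions are cut off by a bump. The frame relation therefore holds after
  multiplication by \<open>h\<close>, and \<open>h p\<close> can be divided out at
  \<open>p\<close>.\<close>

lemma local_frame:
  obtains E u h where "\<And>i. i \<in> Basis \<Longrightarrow> E i \<in> VF" "\<And>i. i \<in> (Basis :: 'e set) \<Longrightarrow> u i \<in> F"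
    "h \<in> F" "h p \<noteq> 0"
    "\<And>X. X \<in> VF \<Longrightarrow> \<exists>k. (\<forall>i\<in>Basis. k i \<in> F) \<and> h \<odot> X = (\<Sum>i\<in>Basis. k i \<odot> E i)"
    "\<And>i j. i \<in> Basis \<Longrightarrow> j \<in> Basis \<Longrightarrow> E i (u j) p = (if i = j then 1 else 0)"
proof -
  obtain U c where c: "(U, c) \<in> A" and p: "p \<in> U"
    using atlas unfolding smooth_atlas_def by blast
  note inv = chart_inverse[OF c]
  let ?e = "inv_into U c"
  obtain r' where r': "r' > 0" "ball (c p) r' \<subseteq> c ` U"
    using chart(2)[OF c] p by (meson open_contains_ball imageI)
  \<comment> \<open>With half the radius, the closed ball supporting the bump stays inside
    \<open>B\<close>.\<close>
  define r where "r = r' / 2"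
  have r: "r > 0" "r < r'" using r' by (auto simp: r_def)
  define B where "B = ball (c p) r'"
  have BU: "B \<subseteq> c ` U" and oB: "open B" and cB: "convex B" using r' by (auto simp: B_def)
  obtain \<beta> :: "'e \<Rightarrow> real" where \<beta>: "smooth_on UNIV \<beta>" "\<And>x. \<beta> x > 0 \<longleftrightarrow> x \<in> ball (c p) r"
    "\<And>x. x \<notin> ball (c p) r \<Longrightarrow> \<beta> x = 0"
    using smooth_bump[OF r(1)] by metis
  have \<beta>U: "smooth_on S \<beta>" for S using \<beta>(1) smooth_on_subset by blast
  define cut where "cut h = (\<lambda>q. if q \<in> U then \<beta> (c q) * h (c q) else 0)" for h :: "'e \<Rightarrow> real"
  have cut: "cut h \<in> F" if "smooth_on B h" for h
  proof -
    let ?h = "\<lambda>x. if x \<in> B then \<beta> x * h x else 0"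
    have o: "open (c ` U - cball (c p) r)" using chart(2)[OF c] by blast
    have "smooth_on B ?h"
      by (rule smooth_on_cong[OF oB _ smooth_on_mult[OF oB \<beta>U that]]) simp
    moreover have "smooth_on (c ` U - cball (c p) r) ?h"
      by (rule smooth_on_cong[OF o _ smooth_on_const[of _ 0]]) (use \<beta>(3) in auto)
    ultimately have "smooth_on (B \<union> (c ` U - cball (c p) r)) ?h"
      using Ck_on_open_Un[OF oB o, of _ ?h] by (auto simp: smooth_on_def)
    moreover have "B \<union> (c ` U - cball (c p) r) = c ` U" using BU r(2) by (auto simp: B_def)
    ultimately have "smooth_on (c ` U) ?h" by simp
    then have "(\<lambda>q. if q \<in> U then ?h (c q) else 0) \<in> F"
      by (rule smooth_extension[OF c compact_cball[of "c p" r], rotated])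
         (use \<beta>(3) r(2) BU in \<open>auto simp: B_def\<close>)
    moreover have "(\<lambda>q. if q \<in> U then ?h (c q) else 0) = cut h"
    proof (rule ext)
      fix q
      have "c q \<in> B" if "\<beta> (c q) \<noteq> 0"
        using that \<beta>(3)[of "c q"] r(2) by (cases "dist (c p) (c q) < r") (auto simp: B_def)
      then show "(if q \<in> U then ?h (c q) else 0) = cut h q"
        unfolding cut_def by auto
    qed
    ultimately show ?thesis by simp
  qed
  let ?D = "\<lambda>f x. frechet_derivative (f \<circ> ?e) (at x)"
  have sB: "smooth_on B (f \<circ> ?e)" if "f \<in> F" for f
    using smooth_on_subset[OF BU smooth_functionsD[OF that c]] .
  have hd: "((f \<circ> ?e) has_derivative ?D f (c q)) (at (c q))" if "f \<in> F" "q \<in> U" for f q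
    using smooth_on_has_derivative[OF smooth_functionsD[OF that(1) c]] that(2) by blast
  define E where "E i = (\<lambda>f. if f \<in> F then cut (\<lambda>x. ?D f x i) else 0)" for i
  have E: "E i \<in> VF" for i
  proof (rule VF_I)
    fix f assume f: "f \<in> F"
    show "E i f \<in> F"
      unfolding E_def using cut[OF smooth_on_frechet[OF sB[OF f]]] f by simp
  next
    fix f assume f: "f \<notin> F" then show "E i f = 0" by (simp add: E_def)
  next
    fix f h assume f: "f \<in> F" and h: "h \<in> F"
    have "?D (f + h) (c q) i = ?D f (c q) i + ?D h (c q) i" if "q \<in> U" for q
      using frechet_derivative_at[OF has_derivative_add[OF hd[OF f that] hd[OF h that]]]
      by (simp add: o_def fun_eq_iff)
    then show "E i (f + h) = E i f + E i h"
      using f h by (simp add: E_def cut_def fun_eq_iff algebra_simps)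
    have "?D (f * h) (c q) i = f q * ?D h (c q) i + ?D f (c q) i * h q" if "q \<in> U" for q
      using frechet_derivative_at[OF has_derivative_mult[OF hd[OF f that] hd[OF h that]]]
      by (simp add: o_def fun_eq_iff inv[OF that])
    then show "E i (f * h) = E i f * h + f * E i h"
      using f h by (simp add: E_def cut_def fun_eq_iff algebra_simps)
  next
    fix f a assume f: "f \<in> F"
    have "?D ((\<lambda>_. a) * f) (c q) i = a * ?D f (c q) i" if "q \<in> U" for q
      using frechet_derivative_at[OF has_derivative_mult_right[OF hd[OF f that], of a]]
      by (simp add: o_def fun_eq_iff)
    then show "E i ((\<lambda>_. a) * f) = (\<lambda>_. a) * E i f"
      using f by (simp add: E_def cut_def fun_eq_iff algebra_simps)
  qed
  define b where "b = cut (\<lambda>_. 1)"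
  define y where "y i = cut (\<lambda>x. x \<bullet> i)" for i
  have b: "b \<in> F" unfolding b_def by (rule cut[OF smooth_on_const])
  have y: "y i \<in> F" for i
    unfolding y_def by (rule cut[OF smooth_on_linear[OF oB bounded_linear_inner_left]])
  \<comment> \<open>The cutoff of the coordinate offset from \<open>z\<close>, built from
    \<open>y i\<close> and \<open>b\<close> so that \<open>X (w z i)\<close> is affine in
    \<open>z\<close>.\<close>
  define w where "w z i = y i - (\<lambda>_. z \<bullet> i) * b" for z i
  have w: "w z i \<in> F" for z i unfolding w_def using b y by simp
  have w_eq: "w z i = cut (\<lambda>x. (x - z) \<bullet> i)" for z i
    by (simp add: w_def y_def b_def cut_def fun_eq_iff inner_diff_left algebra_simps)
  have Xw: "X (w z i) q = X (y i) q - (z \<bullet> i) * X b q" if "X \<in> VF" for X z i q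
    unfolding w_def using b y by (simp add: VF_minus[OF that] VF_cmult[OF that])
  text \<open>With \<open>E\<^sub>i = \<beta> \<partial>\<^sub>i\<close>, the coefficients \<open>k\<close> of \<open>\<beta>\<^sup>3 X\<close> come from applying \<open>X\<close> at \<open>q\<close> to
    Hadamard's formula \<open>\<beta>\<^sup>2 (f - f q) = (\<Sum>i. \<beta> (x\<^sub>i - q\<^sub>i) \<cdot> \<beta> G\<^sub>i)\<close>, an identity between
    globally defined smooth functions.\<close>
  define h where "h = b * (b * b)"
  have frame: "\<exists>k. (\<forall>i\<in>Basis. k i \<in> F) \<and> h \<odot> X = (\<Sum>i\<in>Basis. k i \<odot> E i)" if X: "X \<in> VF" for X
  proof (intro exI conjI ballI)
    let ?k = "\<lambda>i. b * X (y i) - y i * X b"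
    show "?k i \<in> F" for i using b y X by auto
    show "h \<odot> X = (\<Sum>i\<in>Basis. ?k i \<odot> E i)"
    proof (rule ext, rule ext)
      fix f q
      show "(h \<odot> X) f q = (\<Sum>i\<in>Basis. ?k i \<odot> E i) f q"
      proof (cases "f \<in> F \<and> q \<in> U \<and> c q \<in> ball (c p) r")
        case False
        then have "f \<notin> F \<or> b q = 0 \<and> (\<forall>i. y i q = 0)"
          using \<beta>(3) by (auto simp: b_def y_def cut_def)
        then show ?thesis
          by (auto simp: fscale_def h_def sum_apply VF_nonsmooth[OF X] VF_nonsmooth[OF E])
      next
        case True
        then have f: "f \<in> F" and q: "q \<in> U" and cq: "c q \<in> B" using r(2) by (auto simp: B_def)
        obtain G where G: "\<And>i. smooth_on B (G i)" "\<And>i. G i (c q) = ?D f (c q) i"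
          "\<And>x. x \<in> B \<Longrightarrow> (f \<circ> ?e) x = (f \<circ> ?e) (c q) + (\<Sum>i\<in>Basis. ((x - c q) \<bullet> i) * G i x)"
          by (rule Hadamard_lemma[OF oB cB cq sB[OF f]]) (rule that; assumption)
        have eq: "(b * b) * (f - (\<lambda>_. f q)) = (\<Sum>i\<in>Basis. w (c q) i * cut (G i))"
        proof (rule ext)
          fix q'
          show "((b * b) * (f - (\<lambda>_. f q))) q' = (\<Sum>i\<in>Basis. w (c q) i * cut (G i)) q'"
          proof (cases "q' \<in> U \<and> c q' \<in> B")
            case True
            then have "f q' = f q + (\<Sum>i\<in>Basis. ((c q' - c q) \<bullet> i) * G i (c q'))"
              using G(3)[of "c q'"] by (simp add: inv q)
            with True show ?thesis
              by (simp add: w_eq b_def cut_def sum_apply sum_distrib_left algebra_simps)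
          next
            case False
            then have "q' \<notin> U \<or> \<beta> (c q') = 0" using \<beta>(3)[of "c q'"] r(2) by (auto simp: B_def)
            then show ?thesis by (auto simp: w_eq b_def cut_def sum_apply)
          qed
        qed
        have "X ((b * b) * (f - (\<lambda>_. f q))) q = b q * b q * X f q"
          using b f by (simp add: VF_arith[OF X])
        \<comment> \<open>Each \<open>w (c q) i\<close> vanishes at \<open>q\<close>, so the Leibniz
          rule leaves only the terms where \<open>X\<close> hits that factor.\<close>
        moreover have "X (\<Sum>i\<in>Basis. w (c q) i * cut (G i)) q
            = (\<Sum>i\<in>Basis. X (w (c q) i) q * (b q * ?D f (c q) i))"
          using X w cut[OF G(1)]
          by (simp add: VF_sum_arg[OF X] VF_times[OF X] sum_apply, intro sum.cong)
             (auto simp: w_eq[of "c q"] cut_def[of "\<lambda>x. (x - c q) \<bullet> _"] cut_def[of "G _"] b_def cut_def[of "\<lambda>_. 1"] q G(2))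
        ultimately have "b q * b q * X f q = (\<Sum>i\<in>Basis. X (w (c q) i) q * (b q * ?D f (c q) i))"
          using eq by simp
        \<comment> \<open>The extra factor \<open>b q\<close> turns
          \<open>b q * (c q \<bullet> i)\<close> into \<open>y i q\<close>, so the coefficients
          become values of the globally smooth \<open>?k i\<close>, in which the base point no
          longer occurs.\<close>
        then have "b q * (b q * b q * X f q) = b q * (\<Sum>i\<in>Basis. X (w (c q) i) q * (b q * ?D f (c q) i))"
          by simp
        also have "\<dots> = (\<Sum>i\<in>Basis. ?k i q * E i f q)"
          using f q
          by (simp add: sum_distrib_left Xw[OF X] E_def cut_def[of "\<lambda>x. ?D f x _"] b_def y_def cut_def[of "\<lambda>_. 1"] cut_def[of "\<lambda>x. x \<bullet> _"] algebra_simps)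
        finally show ?thesis
          by (simp add: fscale_def h_def sum_apply mult.assoc)
      qed
    qed
  qed
  have \<beta>p: "\<beta> (c p) > 0" using \<beta>(2) r(1) by simp
  have bp: "b p > 0" using \<beta>p p by (simp add: b_def cut_def)
  \<comment> \<open>For \<open>i = j\<close> the value of \<open>E i (w (c p) j)\<close> at
    \<open>p\<close> is \<open>b p * b p\<close>, one factor from \<open>E i\<close> and one from
    \<open>w\<close>; hence the normalisation.\<close>
  define u where "u j = (\<lambda>_. 1 / (b p * b p)) * w (c p) j" for j
  have "E i (u j) p = (if i = j then 1 else 0)" if ij: "i \<in> Basis" "j \<in> Basis" for i j
  proof -
    have "((\<lambda>x. \<beta> x * ((x - c p) \<bullet> j)) has_derivative (\<lambda>v. \<beta> (c p) * (v \<bullet> j))) (at (c p))"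
      using smooth_on_has_derivative[OF \<beta>(1), of "c p"]
      by (auto intro!: derivative_eq_intros)
    then have "((w (c p) j \<circ> ?e) has_derivative (\<lambda>v. \<beta> (c p) * (v \<bullet> j))) (at (c p))"
      by (rule has_derivative_transform_within_open[OF _ chart(2)[OF c]])
         (use p in \<open>auto simp: w_eq cut_def inv\<close>)
    from frechet_derivative_at[OF this, symmetric]
    have "E i (w (c p) j) p = \<beta> (c p) * (\<beta> (c p) * (i \<bullet> j))"
      using w p by (simp add: E_def cut_def)
    then show ?thesis
      using w ij bp p \<beta>p inner_Basis[OF ij]
      by (simp add: u_def VF_cmult[OF E] b_def cut_def)
  qed
  moreover have "h p \<noteq> 0" "h \<in> F" using bp b by (auto simp: h_def)
  moreover have "u j \<in> F" for j using w by (simp add: u_def)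
  ultimately show thesis using that[of E u h] E frame by blast
qed

section \<open>One-forms and coordinates on the tangent space at a point\<close>

lemma
  assumes "one_form A \<theta>"
  shows one_form_smooth: "X \<in> VF \<Longrightarrow> \<theta> X \<in> F"
    and one_form_add: "X \<in> VF \<Longrightarrow> Y \<in> VF \<Longrightarrow> \<theta> (X + Y) = \<theta> X + \<theta> Y"
    and one_form_fscale: "h \<in> F \<Longrightarrow> X \<in> VF \<Longrightarrow> \<theta> (h \<odot> X) = h * \<theta> X"
  using assms unfolding one_form_def by blast+

context
  fixes \<theta> assumes \<theta>: "one_form A \<theta>"
begin

lemma one_form_0: "\<theta> 0 = 0"
  using one_form_add[OF \<theta>, of 0 0] by simp

lemma one_form_uminus: "X \<in> VF \<Longrightarrow> \<theta> (- X) = - \<theta> X"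
  using one_form_fscale[OF \<theta>, of "\<lambda>_. - 1" X] by (simp add: fscale_minus_one minus_one_times_fun)

lemma one_form_diff: "X \<in> VF \<Longrightarrow> Y \<in> VF \<Longrightarrow> \<theta> (X - Y) = \<theta> X - \<theta> Y"
  using one_form_add[OF \<theta>, of X "- Y"] by (simp add: one_form_uminus)

lemma one_form_sum: "(\<And>i. i \<in> I \<Longrightarrow> X i \<in> VF) \<Longrightarrow> \<theta> (sum X I) = (\<Sum>i\<in>I. \<theta> (X i))"
  by (induction I rule: infinite_finite_induct) (simp_all add: one_form_0 one_form_add[OF \<theta>] VF_sum)

lemmas one_form_arith = one_form_add[OF \<theta>] one_form_fscale[OF \<theta>] one_form_diff one_form_uminus
  one_form_0 one_form_smooth[OF \<theta>]

end

text \<open>The tangent space at \<open>p\<close> is the quotient of the vector fields by those in the kernel of \<open>v\<close>;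
  \<open>v\<close> identifies it with \<open>'e\<close>.\<close>

lemma tangent_coordinates:
  obtains v :: "'a vfield \<Rightarrow> 'e" where
    "\<And>X Y. X \<in> VF \<Longrightarrow> Y \<in> VF \<Longrightarrow> v (X + Y) = v X + v Y"
    "\<And>h X. h \<in> F \<Longrightarrow> X \<in> VF \<Longrightarrow> v (h \<odot> X) = h p *\<^sub>R v X"
    "\<And>x. \<exists>X\<in>VF. v X = x"
    "\<And>\<theta>. one_form A \<theta> \<Longrightarrow> \<exists>a. \<forall>X\<in>VF. \<theta> X p = a \<bullet> v X"
    "\<And>X. v X \<noteq> 0 \<Longrightarrow> \<not> vanishes_at X p"
proof -
  obtain E u h where E: "\<And>i. i \<in> Basis \<Longrightarrow> E i \<in> VF" and u: "\<And>i. i \<in> (Basis :: 'e set) \<Longrightarrow> u i \<in> F"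
    and h: "h \<in> F" "h p \<noteq> 0"
    and frame: "\<And>X. X \<in> VF \<Longrightarrow> \<exists>k. (\<forall>i\<in>Basis. k i \<in> F) \<and> h \<odot> X = (\<Sum>i\<in>Basis. k i \<odot> E i)"
    and Eu: "\<And>i j. i \<in> Basis \<Longrightarrow> j \<in> Basis \<Longrightarrow> E i (u j) p = (if i = j then 1 else 0)"
    by (rule local_frame[where p=p]) (rule that; assumption)
  define v :: "'a vfield \<Rightarrow> 'e" where "v X = (\<Sum>j\<in>Basis. X (u j) p *\<^sub>R j)" for X
  have vj: "v X \<bullet> j = X (u j) p" if "j \<in> Basis" for X j
    unfolding v_def using that by (rule inner_sum_left_Basis)
  show thesis
  proof (rule that[of v])
    show "v (X + Y) = v X + v Y" for X Y
      by (simp add: v_def scaleR_add_left sum.distrib)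
    show "v (f \<odot> X) = f p *\<^sub>R v X" for f X
      by (simp add: v_def fscale_def scaleR_sum_right)
    show "\<exists>X\<in>VF. v X = x" for x
    proof
      let ?X = "\<Sum>i\<in>Basis. (\<lambda>_. x \<bullet> i) \<odot> E i"
      show "?X \<in> VF" using E by (intro VF_sum VF_fscale) auto
      show "v ?X = x"
      proof (rule euclidean_eqI)
        fix j :: 'e assume j: "j \<in> Basis"
        have "v ?X \<bullet> j = (\<Sum>i\<in>Basis. (x \<bullet> i) * E i (u j) p)"
          unfolding vj[OF j] by (simp add: sum_apply fscale_def)
        also have "\<dots> = (\<Sum>i\<in>Basis. if i = j then x \<bullet> i else 0)"
          by (rule sum.cong) (simp_all add: Eu j)
        finally show "v ?X \<bullet> j = x \<bullet> j" using j by simp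
      qed
    qed
    show "\<exists>a. \<forall>X\<in>VF. \<theta> X p = a \<bullet> v X" if \<theta>: "one_form A \<theta>" for \<theta>
    proof (intro exI ballI)
      fix X assume X: "X \<in> VF"
      obtain k where k: "\<And>i. i \<in> Basis \<Longrightarrow> k i \<in> F" and eq: "h \<odot> X = (\<Sum>i\<in>Basis. k i \<odot> E i)"
        using frame[OF X] by blast
      have kj: "h p * X (u j) p = k j p" if j: "j \<in> Basis" for j
      proof -
        have "h p * X (u j) p = (h \<odot> X) (u j) p" by (simp add: fscale_def)
        also have "\<dots> = (\<Sum>i\<in>Basis. k i p * E i (u j) p)"
          unfolding eq by (simp add: sum_apply fscale_def)
        also have "\<dots> = (\<Sum>i\<in>Basis. if i = j then k i p else 0)"
          by (rule sum.cong) (simp_all add: Eu j)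
        finally show ?thesis using j by simp
      qed
      have "h p * \<theta> X p = \<theta> (h \<odot> X) p" using h X by (simp add: one_form_arith[OF \<theta>])
      also have "\<dots> = (\<Sum>i\<in>Basis. k i p * \<theta> (E i) p)"
        unfolding eq using k E
        by (simp add: one_form_sum[OF \<theta>] one_form_arith[OF \<theta>] sum_apply)
      also have "\<dots> = h p * (\<Sum>i\<in>Basis. X (u i) p * \<theta> (E i) p)"
        unfolding sum_distrib_left by (rule sum.cong) (simp_all add: kj[symmetric])
      finally have "\<theta> X p = (\<Sum>i\<in>Basis. X (u i) p * \<theta> (E i) p)" using h(2) by simp
      then show "\<theta> X p = (\<Sum>i\<in>Basis. \<theta> (E i) p *\<^sub>R i) \<bullet> v X"
        by (simp add: inner_commute[of _ "v X"] inner_sum_right vj mult.commute)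
    qed
    show "\<not> vanishes_at X p" if "v X \<noteq> 0" for X
    proof
      assume "vanishes_at X p"
      then have "v X = 0" unfolding v_def vanishes_at_def by simp
      with that show False by simp
    qed
  qed
qed

end

section \<open>Powers of a 2-form on a symplectic basis\<close>

text \<open>Unfolding one step yields a permutation of all slots combined with one of the last 2r.
  Absorbing the second into the first counts every permutation (2r)! times, which cancels a
  factorial in \<open>wedge\<close>; each 2-form contributes a factor 1/2.\<close>

lemma wedge_power_eq_sum_permutations:
  "wedge_power \<Omega> r X p = (\<Sum>\<sigma> | \<sigma> permutes {..<2 * r}. of_int (sign \<sigma>) *
     (\<Prod>i<r. \<Omega> (X (\<sigma> (2 * i))) (X (\<sigma> (Suc (2 * i)))) p)) / 2 ^ r"
proof (induction r arbitrary: X)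
  case 0
  then show ?case by simp
next
  case (Suc r)
  let ?n = "2 * r"
  define t where "t Y \<sigma> = of_int (sign \<sigma>) * (\<Prod>i<Suc r. \<Omega> (Y (\<sigma> (2 * i))) (Y (\<sigma> (Suc (2 * i)))) p)"
    for Y :: "nat \<Rightarrow> 'a vfield" and \<sigma> :: "nat \<Rightarrow> nat"
  \<comment> \<open>\<open>sh \<tau>\<close> lets \<tau> act on the slots 2, ..., 2r + 1 and fixes
    the first two.\<close>
  define sh where "sh \<tau> = map_permutation {..<?n} ((+) 2) \<tau>" for \<tau> :: "nat \<Rightarrow> nat"
  have sh: "sh \<tau> permutes {..<2 + ?n}" "sign (sh \<tau>) = sign \<tau>" "sh \<tau> 0 = 0" "sh \<tau> (Suc 0) = Suc 0"
    "\<And>i. i < ?n \<Longrightarrow> sh \<tau> (Suc (Suc i)) = Suc (Suc (\<tau> i))"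
    if \<tau>: "\<tau> permutes {..<?n}" for \<tau>
  proof -
    have "bij_betw ((+) 2) {..<?n} ((+) 2 ` {..<?n})" by (auto simp: bij_betw_def)
    from map_permutation_permutes[OF this \<tau>]
    have "sh \<tau> permutes ((+) 2 ` {..<?n})" by (simp add: sh_def)
    then show "sh \<tau> permutes {..<2 + ?n}" by (rule permutes_subset) auto
    show "sign (sh \<tau>) = sign \<tau>" unfolding sh_def using \<tau> by (intro sign_map_permutation) auto
    show "sh \<tau> 0 = 0" "sh \<tau> (Suc 0) = Suc 0"
      by (auto simp: sh_def map_permutation_def restrict_id_def)
    show "sh \<tau> (Suc (Suc i)) = Suc (Suc (\<tau> i))" if "i < ?n" for i
    proof -
      have "inv_into {..<?n} ((+) 2) (2 + i) = i" using that by (intro inv_into_f_f) auto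
      then show ?thesis using that by (auto simp: sh_def map_permutation_def restrict_id_def)
    qed
  qed
  have step: "of_int (sign \<sigma>) * \<Omega> (X (\<sigma> 0)) (X (\<sigma> 1)) p *
      (of_int (sign \<tau>) * (\<Prod>i<r. \<Omega> (X (\<sigma> (2 + \<tau> (2 * i)))) (X (\<sigma> (2 + \<tau> (Suc (2 * i))))) p))
      = t X (\<sigma> \<circ> sh \<tau>)"
    if \<sigma>: "\<sigma> permutes {..<2 + ?n}" and \<tau>: "\<tau> permutes {..<?n}" for \<sigma> \<tau>
  proof -
    have "sign (\<sigma> \<circ> sh \<tau>) = sign \<sigma> * sign \<tau>"
      using sh(1,2)[OF \<tau>] \<sigma> by (metis finite_lessThan permutation_permutes sign_compose)
    then show ?thesis
      unfolding t_def prod.lessThan_Suc_shift using sh(3-5)[OF \<tau>] by simp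
  qed
  have "wedge_power \<Omega> (Suc r) X p = 1 / (2 * fact ?n) * (\<Sum>\<sigma> | \<sigma> permutes {..<2 + ?n}.
      of_int (sign \<sigma>) * \<Omega> (X (\<sigma> 0)) (X (\<sigma> 1)) p * ((\<Sum>\<tau> | \<tau> permutes {..<?n}. of_int (sign \<tau>) *
        (\<Prod>i<r. \<Omega> (X (\<sigma> (2 + \<tau> (2 * i)))) (X (\<sigma> (2 + \<tau> (Suc (2 * i))))) p)) / 2 ^ r))"
    by (simp add: wedge_def of_two_form_def Suc.IH)
  also have "\<dots> = 1 / (2 * fact ?n) * (\<Sum>\<sigma> | \<sigma> permutes {..<2 + ?n}.
      (\<Sum>\<tau> | \<tau> permutes {..<?n}. t X (\<sigma> \<circ> sh \<tau>)) / 2 ^ r)"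
    unfolding times_divide_eq_right sum_distrib_left
    by (intro arg_cong2[where f="(/)"] refl sum.cong) (simp_all only: mem_Collect_eq step)
  also have "\<dots> = 1 / (2 * fact ?n) * (\<Sum>\<sigma> | \<sigma> permutes {..<2 + ?n}.
      \<Sum>\<tau> | \<tau> permutes {..<?n}. t X (\<sigma> \<circ> sh \<tau>)) / 2 ^ r"
    by (simp add: sum_divide_distrib[symmetric])
  also have "(\<Sum>\<sigma> | \<sigma> permutes {..<2 + ?n}. \<Sum>\<tau> | \<tau> permutes {..<?n}. t X (\<sigma> \<circ> sh \<tau>))
      = (\<Sum>\<tau> | \<tau> permutes {..<?n}. \<Sum>\<sigma> | \<sigma> permutes {..<2 + ?n}. t X (\<sigma> \<circ> sh \<tau>))"
    by (rule sum.swap)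
  also have "\<dots> = (\<Sum>\<tau> | \<tau> permutes {..<?n}. \<Sum>\<sigma> | \<sigma> permutes {..<2 + ?n}. t X \<sigma>)"
    by (rule sum.cong[OF refl], rule sum_permutations_compose_right[symmetric]) (use sh(1) in simp)
  also have "\<dots> = fact ?n * (\<Sum>\<sigma> | \<sigma> permutes {..<2 + ?n}. t X \<sigma>)"
    by (simp add: card_permutations[of "{..<?n}" ?n])
  finally show ?case by (simp add: t_def)
qed

text \<open>The matrix of the standard symplectic form in a basis listed as e0, f0, e1, f1, and so
  on: indices 2k and 2k + 1 are paired.\<close>

definition symplectic_unit :: "nat \<Rightarrow> nat \<Rightarrow> real" where
  "symplectic_unit a b = (if a div 2 = b div 2 \<and> a \<noteq> b then (if even a then 1 else - 1) else 0)"

text \<open>In a nonzero term \<sigma> maps index pairs to index pairs. Permuting pairs as blocks is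
  even, and a flip inside a pair changes the signs of \<sigma> and of one factor together, so no
  term is negative. The induction moves the last block back to the top.\<close>

lemma symplectic_unit_permutation_nonneg:
  assumes "\<sigma> permutes {..<2 * r}"
  shows "0 \<le> of_int (sign \<sigma>) * (\<Prod>i<r. symplectic_unit (\<sigma> (2 * i)) (\<sigma> (Suc (2 * i))))"
  using assms
proof (induction r arbitrary: \<sigma>)
  case 0
  then show ?case by simp
next
  case (Suc r)
  let ?J = symplectic_unit
  let ?P = "\<lambda>\<sigma>. of_int (sign \<sigma>) * (\<Prod>i<Suc r. ?J (\<sigma> (2 * i)) (\<sigma> (Suc (2 * i))))"
  have ordered: "0 \<le> ?P \<sigma>" if \<sigma>: "\<sigma> permutes {..<2 * Suc r}"
    and k: "\<sigma> (2 * r) = 2 * k" "\<sigma> (Suc (2 * r)) = Suc (2 * k)" for \<sigma> k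
  proof -
    \<comment> \<open>\<rho> exchanges the blocks k and r entry by entry; it has sign 1 and
      preserves \<open>symplectic_unit\<close>, and after it the top block is fixed.\<close>
    define \<rho> where "\<rho> = Transposition.transpose (2 * k) (2 * r) \<circ> Transposition.transpose (Suc (2 * k)) (Suc (2 * r))"
    have k_le: "k \<le> r"
      using permutes_in_image[OF \<sigma>, of "2 * r"] k by auto
    have \<rho>p: "\<rho> permutes {..<2 * Suc r}"
      unfolding \<rho>_def using k_le by (intro permutes_compose permutes_swap_id) auto
    have "sign \<rho> = 1"
      unfolding \<rho>_def by (subst sign_compose) (auto simp: permutation_swap_id sign_swap_id)
    then have sign: "sign (\<rho> \<circ> \<sigma>) = sign \<sigma>"
      using \<rho>p \<sigma> by (metis finite_lessThan permutation_permutes sign_compose mult_1)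
    have J: "?J (\<rho> x) (\<rho> y) = ?J x y" for x y
    proof -
      have ev: "even (\<rho> x) = even x" for x
        by (auto simp: \<rho>_def Transposition.transpose_def)
      have dv: "\<rho> x div 2 = Transposition.transpose k r (x div 2)" for x
        by (auto simp: \<rho>_def Transposition.transpose_def elim!: oddE evenE)
      have "\<rho> x = \<rho> y \<longleftrightarrow> x = y" using permutes_inj[OF \<rho>p] by (simp add: inj_eq)
      then show ?thesis unfolding symplectic_unit_def ev dv
        by (simp add: inj_eq[OF inj_transpose])
    qed
    have k_ne: "2 * k \<noteq> Suc (2 * r)" "Suc (2 * k) \<noteq> 2 * r" by presburger+
    have fix_top: "(\<rho> \<circ> \<sigma>) (2 * r) = 2 * r" "(\<rho> \<circ> \<sigma>) (Suc (2 * r)) = Suc (2 * r)"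
      using k k_ne by (auto simp: \<rho>_def Transposition.transpose_def)
    have "(\<rho> \<circ> \<sigma>) permutes {..<2 * r}"
    proof (rule permutes_superset[OF permutes_compose[OF \<sigma> \<rho>p]])
      fix x assume "x \<in> {..<2 * Suc r} - {..<2 * r}"
      then have "x = 2 * r \<or> x = Suc (2 * r)" by auto
      then show "(\<rho> \<circ> \<sigma>) x = x" using fix_top by metis
    qed
    from Suc.IH[OF this] have "0 \<le> of_int (sign \<sigma>) * (\<Prod>i<r. ?J (\<sigma> (2 * i)) (\<sigma> (Suc (2 * i))))"
      unfolding sign by (simp add: J)
    moreover have "?J (2 * k) (Suc (2 * k)) = 1" by (simp add: symplectic_unit_def)
    ultimately show ?thesis using k by (simp add: mult.assoc)
  qed
  let ?a = "\<sigma> (2 * r)" and ?b = "\<sigma> (Suc (2 * r))"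
  show ?case
  proof (cases "?J ?a ?b = 0")
    case True
    then show ?thesis by simp
  next
    case False
    then have ab: "?a div 2 = ?b div 2" "?a \<noteq> ?b" by (auto simp: symplectic_unit_def split: if_splits)
    show ?thesis
    proof (cases "even ?a")
      case True
      then obtain k where k: "?a = 2 * k" by blast
      moreover have "?b = Suc (2 * k)" using ab k by presburger
      ultimately show ?thesis using ordered[OF Suc.prems] by blast
    next
      case odd: False
      then obtain k where k: "?a = Suc (2 * k)" by (metis oddE Suc_eq_plus1)
      then have b: "?b = 2 * k" using ab by presburger
      \<comment> \<open>If the last pair arrives flipped, precomposing with \<tau> restores its
        order at the cost of two cancelling signs.\<close>
      define \<tau> where "\<tau> = Transposition.transpose (2 * r) (Suc (2 * r))"
      have \<tau>: "\<tau> permutes {..<2 * Suc r}" unfolding \<tau>_def by (rule permutes_swap_id) auto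
      have "0 \<le> ?P (\<sigma> \<circ> \<tau>)"
        by (rule ordered[OF permutes_compose[OF \<tau> Suc.prems], of k]) (auto simp: \<tau>_def k b)
      moreover have "sign (\<sigma> \<circ> \<tau>) = - sign \<sigma>"
        using Suc.prems \<tau> sign_compose[of \<sigma> \<tau>] permutation_permutes[of \<sigma>] permutation_permutes[of \<tau>]
        by (auto simp: \<tau>_def sign_swap_id)
      moreover have "?J ((\<sigma> \<circ> \<tau>) (2 * i)) ((\<sigma> \<circ> \<tau>) (Suc (2 * i))) = ?J (\<sigma> (2 * i)) (\<sigma> (Suc (2 * i)))"
        if "i < r" for i
      proof -
        have "\<tau> (2 * i) = 2 * i" "\<tau> (Suc (2 * i)) = Suc (2 * i)" using that by (auto simp: \<tau>_def)
        then show ?thesis by simp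
      qed
      moreover have "?J ((\<sigma> \<circ> \<tau>) (2 * r)) ((\<sigma> \<circ> \<tau>) (Suc (2 * r))) = - ?J ?a ?b"
        by (simp add: \<tau>_def k b symplectic_unit_def)
      ultimately show ?thesis by simp
    qed
  qed
qed

text \<open>By \<open>symplectic_unit_permutation_nonneg\<close> the terms of the permutation sum
  cannot cancel, and the identity contributes a positive one. The claim for reordered vectors serves
  \<open>wedge_one_form_power_pos\<close>.\<close>

lemma wedge_power_symplectic_basis:
  assumes X: "\<And>i j. i < 2 * m \<Longrightarrow> j < 2 * m \<Longrightarrow> \<Omega> (X i) (X j) p = symplectic_unit i j"
    and \<tau>: "\<tau> permutes {..<2 * m}"
  shows "0 \<le> of_int (sign \<tau>) * wedge_power \<Omega> m (\<lambda>i. X (\<tau> i)) p"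
    and "wedge_power \<Omega> m X p > 0"
proof -
  let ?J = symplectic_unit
  have lt: "\<sigma> (2 * i) < 2 * m" "\<sigma> (Suc (2 * i)) < 2 * m"
    if "\<sigma> permutes {..<2 * m}" "i < m" for \<sigma> i
    using permutes_in_image[OF that(1), of "2 * i"] permutes_in_image[OF that(1), of "Suc (2 * i)"] that(2)
    by auto
  have eq: "of_int (sign \<tau>) * wedge_power \<Omega> m (\<lambda>i. X (\<tau> i)) p
      = (\<Sum>\<sigma> | \<sigma> permutes {..<2 * m}. of_int (sign (\<tau> \<circ> \<sigma>)) *
          (\<Prod>i<m. ?J ((\<tau> \<circ> \<sigma>) (2 * i)) ((\<tau> \<circ> \<sigma>) (Suc (2 * i))))) / 2 ^ m"
    if \<tau>: "\<tau> permutes {..<2 * m}" for \<tau>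
    unfolding wedge_power_eq_sum_permutations times_divide_eq_right sum_distrib_left
  proof (intro arg_cong2[where f="(/)"] refl sum.cong)
    fix \<sigma> assume "\<sigma> \<in> {\<sigma>. \<sigma> permutes {..<2 * m}}"
    then have \<sigma>: "\<sigma> permutes {..<2 * m}" by simp
    have "sign (\<tau> \<circ> \<sigma>) = sign \<tau> * sign \<sigma>"
      using \<tau> \<sigma> by (metis finite_lessThan permutation_permutes sign_compose)
    then show "of_int (sign \<tau>) * (of_int (sign \<sigma>) *
        (\<Prod>i<m. \<Omega> (X (\<tau> (\<sigma> (2 * i)))) (X (\<tau> (\<sigma> (Suc (2 * i))))) p))
      = of_int (sign (\<tau> \<circ> \<sigma>)) * (\<Prod>i<m. ?J ((\<tau> \<circ> \<sigma>) (2 * i)) ((\<tau> \<circ> \<sigma>) (Suc (2 * i))))"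
      using lt[OF permutes_compose[OF \<sigma> \<tau>]] by (simp add: X)
  qed
  show "0 \<le> of_int (sign \<tau>) * wedge_power \<Omega> m (\<lambda>i. X (\<tau> i)) p"
    unfolding eq[OF \<tau>]
    by (intro divide_nonneg_nonneg sum_nonneg symplectic_unit_permutation_nonneg)
       (auto intro: permutes_compose[OF _ \<tau>])
  have "0 < (\<Sum>\<sigma> | \<sigma> permutes {..<2 * m}. of_int (sign \<sigma>) * (\<Prod>i<m. ?J (\<sigma> (2 * i)) (\<sigma> (Suc (2 * i)))))"
    by (rule sum_pos2[of _ id])
       (auto simp: finite_permutations symplectic_unit_def[of "2 * _"] intro: symplectic_unit_permutation_nonneg)
  then show "wedge_power \<Omega> m X p > 0"
    using eq[OF permutes_id] by simp
qed

text \<open>Since \<open>\<eta>\<close> vanishes on all vectors but the first, only permutations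
  fixing 0 contribute; these permute the remaining vectors and are covered by
  \<open>wedge_power_symplectic_basis\<close>.\<close>

lemma wedge_one_form_power_pos:
  assumes \<eta>: "\<eta> (X 0) p = 1" "\<And>i. i < 2 * m \<Longrightarrow> \<eta> (X (Suc i)) p = 0"
    and X: "\<And>i j. i < 2 * m \<Longrightarrow> j < 2 * m \<Longrightarrow> \<Omega> (X (Suc i)) (X (Suc j)) p = symplectic_unit i j"
  shows "wedge 1 (2 * m) (of_one_form \<eta>) (wedge_power \<Omega> m) X p > 0"
proof -
  let ?S = "{\<sigma>. \<sigma> permutes {..<1 + 2 * m}}"
  let ?t = "\<lambda>\<sigma>. of_int (sign \<sigma>) * \<eta> (X (\<sigma> 0)) p * wedge_power \<Omega> m (\<lambda>i. X (\<sigma> (Suc i))) p"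
  have nonneg: "0 \<le> ?t \<sigma>" if \<sigma>: "\<sigma> permutes {..<1 + 2 * m}" for \<sigma>
  proof (cases "\<sigma> 0")
    case (Suc i)
    then have "i < 2 * m" using permutes_in_image[OF \<sigma>, of 0] by simp
    then show ?thesis using \<eta>(2) Suc by simp
  next
    case 0
    \<comment> \<open>\<sigma> on the indices 1, ..., 2m, renumbered from 0.\<close>
    define \<tau> where "\<tau> = map_permutation (Suc ` {..<2 * m}) (\<lambda>i. i - 1) \<sigma>"
    have \<sigma>': "\<sigma> permutes Suc ` {..<2 * m}"
    proof (rule permutes_superset[OF \<sigma>])
      fix x assume "x \<in> {..<1 + 2 * m} - Suc ` {..<2 * m}"
      then have "x = 0" by (cases x) auto
      then show "\<sigma> x = x" using 0 by simp
    qed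
    have bij: "bij_betw (\<lambda>i. i - 1) (Suc ` {..<2 * m}) {..<2 * m}"
      by (auto simp: bij_betw_def inj_on_def image_image)
    have \<tau>: "\<tau> permutes {..<2 * m}"
      unfolding \<tau>_def by (rule map_permutation_permutes[OF bij \<sigma>'])
    have sign: "sign \<tau> = sign \<sigma>"
      unfolding \<tau>_def using bij by (intro sign_map_permutation \<sigma>') (auto simp: bij_betw_def)
    have val: "\<sigma> (Suc i) = Suc (\<tau> i)" if "i < 2 * m" for i
    proof -
      have "inv_into (Suc ` {..<2 * m}) (\<lambda>i. i - 1) i = Suc i"
        using inv_into_f_f[OF bij_betw_imp_inj_on[OF bij], of "Suc i"] that by simp
      moreover have "i \<in> (\<lambda>i. i - 1) ` Suc ` {..<2 * m}" using bij that by (simp add: bij_betw_def)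
      moreover have "\<sigma> (Suc i) \<in> Suc ` {..<2 * m}" using permutes_in_image[OF \<sigma>', of "Suc i"] that by simp
      ultimately show ?thesis by (auto simp: \<tau>_def map_permutation_def restrict_id_def)
    qed
    have "wedge_power \<Omega> m (\<lambda>i. X (\<sigma> (Suc i))) p = wedge_power \<Omega> m (\<lambda>i. X (Suc (\<tau> i))) p"
      unfolding wedge_power_eq_sum_permutations
    proof (intro arg_cong2[where f="(/)"] arg_cong2[where f=times] refl sum.cong prod.cong)
      fix \<rho> i assume "\<rho> \<in> {\<rho>. \<rho> permutes {..<2 * m}}" "i \<in> {..<m}"
      then have "\<rho> (2 * i) < 2 * m" "\<rho> (Suc (2 * i)) < 2 * m"
        using permutes_in_image[of \<rho> "{..<2 * m}" "2 * i"] permutes_in_image[of \<rho> "{..<2 * m}" "Suc (2 * i)"]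
        by auto
      then show "\<Omega> (X (\<sigma> (Suc (\<rho> (2 * i))))) (X (\<sigma> (Suc (\<rho> (Suc (2 * i)))))) p
          = \<Omega> (X (Suc (\<tau> (\<rho> (2 * i))))) (X (Suc (\<tau> (\<rho> (Suc (2 * i)))))) p"
        by (simp add: val)
    qed
    moreover have "0 \<le> of_int (sign \<tau>) * wedge_power \<Omega> m (\<lambda>i. X (Suc (\<tau> i))) p"
      by (rule wedge_power_symplectic_basis(1)[where X="\<lambda>i. X (Suc i)", OF _ \<tau>]) (rule X)
    ultimately show ?thesis using 0 \<eta>(1) sign by simp
  qed
  have "wedge_power \<Omega> m (\<lambda>i. X (Suc i)) p > 0"
    by (rule wedge_power_symplectic_basis(2)[where X="\<lambda>i. X (Suc i)", OF _ permutes_id]) (rule X)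
  then have "0 < (\<Sum>\<sigma>\<in>?S. ?t \<sigma>)"
    using nonneg \<eta>(1) by (intro sum_pos2[of _ id]) (auto simp: finite_permutations)
  then show ?thesis
    by (simp add: wedge_def of_one_form_def)
qed

text \<open>Symplectic Gram-Schmidt: a pair a, b with \<open>\<omega> a b = 1\<close> spans a plane
  that splits off from S, and its complement with respect to \<omega> is again nondegenerate, with
  dimension smaller by two.\<close>

lemma symplectic_basis:
  fixes \<omega> :: "'e::euclidean_space \<Rightarrow> 'e \<Rightarrow> real"
  assumes bil: "bilinear \<omega>" and alt: "\<And>x. \<omega> x x = 0"
    and "subspace S" "\<And>x. x \<in> S \<Longrightarrow> x \<noteq> 0 \<Longrightarrow> \<exists>y\<in>S. \<omega> x y \<noteq> 0"
  shows "\<exists>m x. dim S = 2 * m \<and> (\<forall>i<2 * m. x i \<in> S) \<and>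
    (\<forall>i<2 * m. \<forall>j<2 * m. \<omega> (x i) (x j) = symplectic_unit i j)"
  using assms(3,4)
proof (induction "dim S" arbitrary: S rule: less_induct)
  case less
  note add = bilinear_ladd[OF bil] bilinear_radd[OF bil] and mul = bilinear_lmul[OF bil] bilinear_rmul[OF bil]
  note zero = bilinear_lzero[OF bil] bilinear_rzero[OF bil]
  have skew: "\<omega> y x = - \<omega> x y" for x y
    using alt[of "x + y"] alt[of x] alt[of y] by (simp add: add)
  show ?case
  proof (cases "S \<subseteq> {0}")
    case True
    then have "dim S = 2 * 0" by simp
    then show ?thesis by (intro exI[of _ 0]) simp
  next
    case False
    then obtain a where a: "a \<in> S" "a \<noteq> 0" by blast
    obtain b0 where b0: "b0 \<in> S" "\<omega> a b0 \<noteq> 0" using less.prems(2)[OF a] by blast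
    define b where "b = (1 / \<omega> a b0) *\<^sub>R b0"
    have b: "b \<in> S" "\<omega> a b = 1" using b0 less.prems(1) by (auto simp: b_def mul subspace_scale)
    have ba: "\<omega> b a = - 1" using skew[of a b] b by simp
    define S' where "S' = {x \<in> S. \<omega> a x = 0 \<and> \<omega> b x = 0}"
    have sub: "subspace S'"
      using less.prems(1) unfolding S'_def subspace_def by (auto simp: add mul zero)
    let ?T = "span {a, b}"
    have T: "?T = {s *\<^sub>R a + t *\<^sub>R b | s t. True}"
      by (simp add: set_eq_iff span_breakdown_eq span_singleton image_iff diff_eq_eq add.commute)
    have int: "?T \<inter> S' = {0}"
    proof -
      have "x = 0" if "x \<in> ?T" "x \<in> S'" for x
      proof -
        from that(1) obtain s t where x: "x = s *\<^sub>R a + t *\<^sub>R b" unfolding T by blast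
        have "\<omega> a x = t" "\<omega> b x = - s" unfolding x by (simp_all add: add mul alt b ba)
        with that(2) show ?thesis by (simp add: S'_def x)
      qed
      then show ?thesis using span_zero subspace_0[OF sub] by blast
    qed
    have sum: "{x + y |x y. x \<in> ?T \<and> y \<in> S'} = S"
    proof (intro equalityI subsetI)
      fix z assume "z \<in> {x + y |x y. x \<in> ?T \<and> y \<in> S'}"
      then show "z \<in> S"
        using a b less.prems(1) span_minimal[of "{a, b}" S] by (auto simp: S'_def intro!: subspace_add)
    next
      fix z assume z: "z \<in> S"
      \<comment> \<open>The projection of z to the plane along \<open>S'\<close>; its coefficients
        are forced by pairing with a and b.\<close>
      define x where "x = (- \<omega> b z) *\<^sub>R a + \<omega> a z *\<^sub>R b"
      have "x \<in> ?T" unfolding T x_def by blast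
      moreover have "z - x \<in> S'"
      proof -
        have "x \<in> S" unfolding x_def using a b less.prems(1) by (intro subspace_add subspace_scale)
        moreover have "\<omega> a x = \<omega> a z" "\<omega> b x = \<omega> b z" by (simp_all add: x_def bilinear_rsub[OF bil] add mul alt b ba)
        ultimately show ?thesis
          using z less.prems(1) by (simp add: S'_def subspace_diff bilinear_rsub[OF bil])
      qed
      ultimately show "z \<in> {x + y |x y. x \<in> ?T \<and> y \<in> S'}"
        by (intro CollectI exI[of _ x] exI[of _ "z - x"]) simp
    qed
    have "a \<notin> span {b}"
      using b alt by (auto simp: span_singleton mul)
    moreover have "b \<noteq> 0" using b zero by auto
    moreover have "a \<noteq> b" using b alt by auto
    ultimately have "dim ?T = 2"
      by (subst dim_span_eq_card_independent) (auto simp: independent_insert)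
    then have dimS: "dim S = dim S' + 2"
      using dim_sums_Int[OF subspace_span sub, of "{a, b}"] unfolding sum int by simp
    have nondeg: "\<exists>y\<in>S'. \<omega> x y \<noteq> 0" if x: "x \<in> S'" "x \<noteq> 0" for x
    proof -
      obtain y where y: "y \<in> S" "\<omega> x y \<noteq> 0" using less.prems(2)[of x] x by (auto simp: S'_def)
      from y(1) obtain u w where uw: "y = u + w" "u \<in> ?T" "w \<in> S'" unfolding sum[symmetric] by blast
      from uw(2) obtain s t where u: "u = s *\<^sub>R a + t *\<^sub>R b" unfolding T by blast
      have "\<omega> x u = 0" using x skew[of a x] skew[of b x] by (simp add: u add mul S'_def)
      then show ?thesis using uw y by (auto simp: add)
    qed
    obtain m x where m: "dim S' = 2 * m" and xS: "\<And>i. i < 2 * m \<Longrightarrow> x i \<in> S'"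
      and x: "\<And>i j. i < 2 * m \<Longrightarrow> j < 2 * m \<Longrightarrow> \<omega> (x i) (x j) = symplectic_unit i j"
      using less.hyps[OF _ sub nondeg] dimS by (metis less_add_same_cancel1 zero_less_numeral)
    define x' where "x' = x(2 * m := a, Suc (2 * m) := b)"
    have cross: "\<omega> a (x i) = 0" "\<omega> b (x i) = 0" "\<omega> (x i) a = 0" "\<omega> (x i) b = 0" if "i < 2 * m" for i
      using xS[OF that] skew[of a "x i"] skew[of b "x i"] by (auto simp: S'_def)
    have "\<omega> (x' i) (x' j) = symplectic_unit i j" if ij: "i < 2 * Suc m" "j < 2 * Suc m" for i j
    proof -
      have "i < 2 * m \<or> i = 2 * m \<or> i = Suc (2 * m)" "j < 2 * m \<or> j = 2 * m \<or> j = Suc (2 * m)"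
        using ij by auto
      then show ?thesis
        by (elim disjE) (auto simp: x'_def x cross alt b ba symplectic_unit_def)
    qed
    moreover have "x' i \<in> S" if "i < 2 * Suc m" for i
      using that a b xS[of i] by (auto simp: x'_def S'_def)
    moreover have "dim S = 2 * Suc m" using dimS m by simp
    ultimately show ?thesis by blast
  qed
qed

section \<open>Almost contact metric structures\<close>

lemma vfield_eqI: "(\<And>f p. X f p = Y f p) \<Longrightarrow> X = (Y :: 'a vfield)"
  by (intro ext)

lemma fscale_apply [simp]: "(h \<odot> X) f = h * X f"
  by (simp add: fscale_def)

lemma fscale_simps:
  "h \<odot> (X + Y) = h \<odot> X + h \<odot> Y" "h \<odot> (X - Y) = h \<odot> X - h \<odot> Y" "h \<odot> (- X) = - (h \<odot> X)"
  "h \<odot> k \<odot> X = (h * k) \<odot> X" "1 \<odot> X = X" "0 \<odot> X = 0" "h \<odot> 0 = 0"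
  "(h + k) \<odot> X = h \<odot> X + k \<odot> X" "(h - k) \<odot> X = h \<odot> X - k \<odot> X" "(- h) \<odot> X = - (h \<odot> X)"
  by (rule vfield_eqI; simp add: algebra_simps)+

context smooth_manifold
begin

lemma
  assumes "endomorphism_field A \<phi>"
  shows endo_VF: "X \<in> VF \<Longrightarrow> \<phi> X \<in> VF"
    and endo_add: "X \<in> VF \<Longrightarrow> Y \<in> VF \<Longrightarrow> \<phi> (X + Y) = \<phi> X + \<phi> Y"
    and endo_fscale: "h \<in> F \<Longrightarrow> X \<in> VF \<Longrightarrow> \<phi> (h \<odot> X) = h \<odot> \<phi> X"
  using assms unfolding endomorphism_field_def by blast+

context
  fixes \<phi> assumes \<phi>: "endomorphism_field A \<phi>"
begin

lemma endo_0: "\<phi> 0 = 0"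
  using endo_add[OF \<phi>, of 0 0] by simp

lemma endo_uminus: "X \<in> VF \<Longrightarrow> \<phi> (- X) = - \<phi> X"
  using endo_fscale[OF \<phi>, of "\<lambda>_. - 1" X] by (simp add: fscale_minus_one)

lemma endo_diff: "X \<in> VF \<Longrightarrow> Y \<in> VF \<Longrightarrow> \<phi> (X - Y) = \<phi> X - \<phi> Y"
  using endo_add[OF \<phi>, of X "- Y"] by (simp add: endo_uminus)

lemmas endo_arith = endo_VF[OF \<phi>] endo_add[OF \<phi>] endo_fscale[OF \<phi>] endo_diff endo_uminus endo_0

end

lemma bilinear_fieldD:
  assumes "bilinear_field A b"
  shows "X \<in> VF \<Longrightarrow> one_form A (b X)" "X \<in> VF \<Longrightarrow> one_form A (\<lambda>Y. b Y X)"
  using assms unfolding bilinear_field_def by blast+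

lemma one_formI:
  assumes "\<And>X. X \<in> VF \<Longrightarrow> \<theta> X \<in> F" "\<And>X Y. X \<in> VF \<Longrightarrow> Y \<in> VF \<Longrightarrow> \<theta> (X + Y) = \<theta> X + \<theta> Y"
    "\<And>h X. h \<in> F \<Longrightarrow> X \<in> VF \<Longrightarrow> \<theta> (h \<odot> X) = h * \<theta> X"
  shows "one_form A \<theta>"
  unfolding one_form_def by (intro conjI ballI; rule assms; assumption)

end

locale metric_manifold = smooth_manifold A
  for A :: "('a::{t2_space,second_countable_topology}, 'e::euclidean_space) atlas" +
  fixes g :: "'a vfield \<Rightarrow> 'a vfield \<Rightarrow> 'a \<Rightarrow> real"
  assumes metric: "riemannian_metric A g"
begin

lemma g_left: "X \<in> VF \<Longrightarrow> one_form A (g X)" and g_right: "X \<in> VF \<Longrightarrow> one_form A (\<lambda>Y. g Y X)"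
  using metric bilinear_fieldD unfolding riemannian_metric_def by blast+

lemma g_sym: "X \<in> VF \<Longrightarrow> Y \<in> VF \<Longrightarrow> g X Y = g Y X"
  and g_pos: "X \<in> VF \<Longrightarrow> \<not> vanishes_at X p \<Longrightarrow> g X X p > 0"
  using metric unfolding riemannian_metric_def by blast+

lemmas g_arith = one_form_arith[OF g_left] one_form_arith[OF g_right]

end

lemma fun_double_zero: "f = - f \<Longrightarrow> f = (0 :: 'b \<Rightarrow> real)"
proof (rule ext)
  fix x assume "f = - f"
  then have "f x = - f x" by (metis uminus_apply)
  then show "f x = 0 x" by simp
qed

locale almost_contact_metric_manifold = metric_manifold A g
  for A :: "('a::{t2_space,second_countable_topology}, 'e::euclidean_space) atlas" and g +
  fixes \<phi> \<xi> \<eta>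
  assumes acm: "almost_contact_metric A \<phi> \<xi> \<eta> g"
begin

lemma endo: "endomorphism_field A \<phi>" and xi [simp]: "\<xi> \<in> VF" and eta: "one_form A \<eta>"
  and phi_sq: "X \<in> VF \<Longrightarrow> \<phi> (\<phi> X) = - X + \<eta> X \<odot> \<xi>" and eta_xi: "\<eta> \<xi> = 1"
  and compat: "X \<in> VF \<Longrightarrow> Y \<in> VF \<Longrightarrow> g (\<phi> X) (\<phi> Y) = g X Y - \<eta> X * \<eta> Y"
  using acm unfolding almost_contact_metric_def almost_contact_def compatible_metric_def by blast+

lemmas phi_arith = endo_arith[OF endo]
lemmas eta_arith = one_form_arith[OF eta]

text \<open>Since \<open>\<phi> (\<phi> \<xi>) = 0\<close>, applying \<open>phi_sq\<close> to
  \<open>\<phi> \<xi>\<close> makes it a multiple of \<open>\<xi>\<close>. One more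
  \<open>\<phi>\<close> and then \<open>\<eta>\<close> show that the coefficient squares to
  zero.\<close>

lemma phi_xi: "\<phi> \<xi> = 0"
proof -
  have 1: "\<phi> (\<phi> \<xi>) = 0" using phi_sq[OF xi] by (simp add: eta_xi fscale_simps)
  then have 2: "\<phi> \<xi> = \<eta> (\<phi> \<xi>) \<odot> \<xi>"
    using phi_sq[of "\<phi> \<xi>"] by (simp add: phi_arith)
  have "0 = \<eta> (\<phi> \<xi>) \<odot> \<phi> \<xi>"
    using 1 2 endo_fscale[OF endo, of "\<eta> (\<phi> \<xi>)" \<xi>] by (simp add: eta_arith phi_arith)
  then have "\<eta> (\<eta> (\<phi> \<xi>) \<odot> \<phi> \<xi>) = 0" using eta_arith(5) by simp
  then have "\<eta> (\<phi> \<xi>) * \<eta> (\<phi> \<xi>) = 0" by (simp add: eta_arith phi_arith)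
  then have "\<eta> (\<phi> \<xi>) = 0" by (simp add: fun_eq_iff)
  with 2 show ?thesis by (simp add: fscale_simps)
qed

text \<open>Evaluating the third power of \<open>\<phi>\<close> in two ways, resolving the inner or
  the outer square, isolates this coefficient.\<close>

lemma eta_phi: "X \<in> VF \<Longrightarrow> \<eta> (\<phi> X) = 0"
proof -
  assume X: "X \<in> VF"
  have "\<phi> (\<phi> (\<phi> X)) = - \<phi> X"
    using phi_sq[OF X] X by (simp add: phi_arith eta_arith phi_xi fscale_simps)
  moreover have "\<phi> (\<phi> (\<phi> X)) = - \<phi> X + \<eta> (\<phi> X) \<odot> \<xi>"
    using phi_sq[of "\<phi> X"] X by (simp add: phi_arith)
  ultimately have "\<eta> (\<phi> X) \<odot> \<xi> = 0" by simp
  then have "\<eta> (\<eta> (\<phi> X) \<odot> \<xi>) = 0" using eta_arith(5) by simp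
  then show ?thesis using X by (simp add: eta_arith phi_arith eta_xi)
qed

lemma g_xi: "X \<in> VF \<Longrightarrow> g X \<xi> = \<eta> X" "X \<in> VF \<Longrightarrow> g \<xi> X = \<eta> X"
proof -
  assume X: "X \<in> VF"
  show "g X \<xi> = \<eta> X"
    using compat[OF X xi] X by (simp add: phi_xi eta_xi g_arith phi_arith)
  then show "g \<xi> X = \<eta> X" using g_sym[OF X xi] by simp
qed

lemma g_phi_skew: "X \<in> VF \<Longrightarrow> Y \<in> VF \<Longrightarrow> g (\<phi> X) Y = - g X (\<phi> Y)"
proof -
  assume X: "X \<in> VF" and Y: "Y \<in> VF"
  have "g (\<phi> (\<phi> X)) (\<phi> Y) = g (\<phi> X) Y"
    using compat[of "\<phi> X" Y] X Y by (simp add: phi_arith eta_phi)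
  moreover have "g (\<phi> (\<phi> X)) (\<phi> Y) = - g X (\<phi> Y)"
    using X Y by (simp add: phi_sq g_arith phi_arith eta_arith g_xi eta_phi)
  ultimately show ?thesis by simp
qed

abbreviation "\<Omega> \<equiv> fundamental_form g \<phi>"

lemma two_form_fundamental: "two_form A \<Omega>"
  unfolding two_form_def bilinear_field_def
proof (intro conjI ballI)
  fix X assume X: "X \<in> VF"
  show "one_form A (\<Omega> X)" "one_form A (\<lambda>Y. \<Omega> Y X)"
    unfolding fundamental_form_def
    by (rule one_formI; use X in \<open>simp add: phi_arith g_arith\<close>)+
  have "g X (\<phi> X) = - g X (\<phi> X)"
    using g_phi_skew[OF X X] g_sym[of X "\<phi> X"] X by (simp add: phi_arith)
  then show "\<Omega> X X = 0" unfolding fundamental_form_def by (rule fun_double_zero)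
qed

text \<open>For X in the kernel of \<open>\<eta>\<close> at p, pairing X with
  \<open>\<phi> X\<close> gives - g(X, X), so the form is nondegenerate on that kernel. On a
  symplectic basis of it preceded by \<open>\<xi>\<close> the top form is positive.\<close>

lemma almost_cosymplectic_fundamental: "almost_cosymplectic A \<eta> \<Omega>"
proof -
  have *: "\<exists>m. DIM('e) = 2 * m + 1 \<and>
      (\<exists>X. (\<forall>i. X i \<in> VF) \<and> wedge 1 (2 * m) (of_one_form \<eta>) (wedge_power \<Omega> m) X p \<noteq> 0)" for p
  proof -
    obtain v :: "'a vfield \<Rightarrow> 'e" where v: "\<And>x. \<exists>X\<in>VF. v X = x"
      and form: "\<And>\<theta>. one_form A \<theta> \<Longrightarrow> \<exists>a. \<forall>X\<in>VF. \<theta> X p = a \<bullet> v X"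
      and vanish: "\<And>X. v X \<noteq> 0 \<Longrightarrow> \<not> vanishes_at X p"
      by (rule tangent_coordinates[where p=p]) (rule that; assumption)
    \<comment> \<open>\<open>s\<close> picks a field with each prescribed tangent vector; through it
      the 2-form at p becomes a bilinear form on the model space.\<close>
    obtain s where s: "\<And>x. s x \<in> VF" "\<And>x. v (s x) = x" using v by metis
    define \<omega> where "\<omega> x y = \<Omega> (s x) (s y) p" for x y
    have \<Omega>: "one_form A (\<Omega> X)" "one_form A (\<lambda>Y. \<Omega> Y X)" if "X \<in> VF" for X
      using two_form_fundamental that bilinear_fieldD unfolding two_form_def by blast+
    have cong: "\<theta> X p = \<theta> Y p" if "one_form A \<theta>" "X \<in> VF" "Y \<in> VF" "v X = v Y" for \<theta> X Y
      using form[OF that(1)] that(2-4) by metis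
    have \<omega>: "\<Omega> X Y p = \<omega> (v X) (v Y)" if "X \<in> VF" "Y \<in> VF" for X Y
      unfolding \<omega>_def
      using cong[OF \<Omega>(1)[OF that(1)], of Y "s (v Y)"] cong[OF \<Omega>(2)[OF s(1)], of X "s (v X)"] s that by simp
    have "linear (\<omega> x)" "linear (\<lambda>x. \<omega> x y)" for x y
    proof -
      obtain a b where ab: "\<And>Y. Y \<in> VF \<Longrightarrow> \<Omega> (s x) Y p = a \<bullet> v Y" "\<And>X. X \<in> VF \<Longrightarrow> \<Omega> X (s y) p = b \<bullet> v X"
        using form[OF \<Omega>(1)[OF s(1)]] form[OF \<Omega>(2)[OF s(1)]] by metis
      show "linear (\<omega> x)" "linear (\<lambda>x. \<omega> x y)"
        unfolding \<omega>_def using ab s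
        by (simp_all add: linearI inner_add_right)
    qed
    then have bil: "bilinear \<omega>" by (simp add: bilinear_def)
    have alt: "\<omega> x x = 0" for x
      using two_form_fundamental s by (simp add: two_form_def \<omega>_def)
    obtain a where a: "\<And>X. X \<in> VF \<Longrightarrow> \<eta> X p = a \<bullet> v X" using form[OF eta] by blast
    have "a \<bullet> v \<xi> = 1" using a[OF xi] eta_xi by simp
    then have a0: "a \<noteq> 0" by auto
    let ?K = "{x. a \<bullet> x = 0}"
    have nondeg: "\<exists>y\<in>?K. \<omega> x y \<noteq> 0" if x: "x \<in> ?K" "x \<noteq> 0" for x
    proof
      let ?X = "s x"
      have X: "?X \<in> VF" "v ?X = x" using s by auto
      show "v (\<phi> ?X) \<in> ?K" using a[of "\<phi> ?X"] X by (simp add: phi_arith eta_phi)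
      have "\<omega> x (v (\<phi> ?X)) = \<Omega> ?X (\<phi> ?X) p" using \<omega>[of ?X "\<phi> ?X"] X by (simp add: phi_arith)
      also have "\<dots> = - g ?X ?X p + \<eta> ?X p * \<eta> ?X p"
        using X by (simp add: fundamental_form_def phi_sq g_arith eta_arith g_xi)
      also have "\<dots> = - g ?X ?X p" using a X x by simp
      finally show "\<omega> x (v (\<phi> ?X)) \<noteq> 0"
        using g_pos[OF X(1) vanish] X x by simp
    qed
    obtain m x where m: "dim ?K = 2 * m" and xK: "\<And>i. i < 2 * m \<Longrightarrow> x i \<in> ?K"
      and x: "\<And>i j. i < 2 * m \<Longrightarrow> j < 2 * m \<Longrightarrow> \<omega> (x i) (x j) = symplectic_unit i j"
      using symplectic_basis[OF bil alt subspace_hyperplane nondeg] by metis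
    define X where "X i = (case i of 0 \<Rightarrow> \<xi> | Suc i \<Rightarrow> s (x i))" for i
    have "DIM('e) = 2 * m + 1" using dim_hyperplane[OF a0] m DIM_positive[where 'a='e] by simp
    moreover have "X i \<in> VF" for i by (simp add: X_def s split: nat.split)
    moreover have "wedge 1 (2 * m) (of_one_form \<eta>) (wedge_power \<Omega> m) X p > 0"
    proof (rule wedge_one_form_power_pos)
      show "\<eta> (X 0) p = 1" by (simp add: X_def eta_xi)
      show "\<eta> (X (Suc i)) p = 0" if "i < 2 * m" for i using xK[OF that] a s by (simp add: X_def)
      show "\<Omega> (X (Suc i)) (X (Suc j)) p = symplectic_unit i j" if "i < 2 * m" "j < 2 * m" for i j
        using x[OF that] by (simp add: X_def \<omega> s)
    qed
    ultimately show ?thesis by (metis less_irrefl)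
  qed
  \<comment> \<open>The dimension equation determines \<open>m\<close>, so the value found at an
    arbitrary point serves everywhere.\<close>
  from *[of undefined] obtain m where m: "DIM('e) = 2 * m + 1" by blast
  then have "\<exists>X. (\<forall>i. X i \<in> VF) \<and> wedge 1 (2 * m) (of_one_form \<eta>) (wedge_power \<Omega> m) X p \<noteq> 0" for p
    using *[of p] by auto
  then show ?thesis
    unfolding almost_cosymplectic_def nowhere_zero_def using eta two_form_fundamental m by blast
qed

end

section \<open>Nijenhuis tensors and quasi-Sasakian structures\<close>

text \<open>A carrier set is kept because vector fields form only part of their type and the bracket
  laws are stated for them; the instance is \<open>VF \<times> F\<close> with
  \<open>pair_bracket\<close>.\<close>

locale bracket_module =
  fixes V :: "'v::ab_group_add set" and b :: "'v \<Rightarrow> 'v \<Rightarrow> 'v"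
  assumes add_closed [simp]: "x \<in> V \<Longrightarrow> y \<in> V \<Longrightarrow> x + y \<in> V"
    and uminus_closed [simp]: "x \<in> V \<Longrightarrow> - x \<in> V"
    and bracket_closed [simp]: "x \<in> V \<Longrightarrow> y \<in> V \<Longrightarrow> b x y \<in> V"
    and bracket_add_left: "x \<in> V \<Longrightarrow> y \<in> V \<Longrightarrow> z \<in> V \<Longrightarrow> b (x + y) z = b x z + b y z"
    and bracket_add_right: "x \<in> V \<Longrightarrow> y \<in> V \<Longrightarrow> z \<in> V \<Longrightarrow> b x (y + z) = b x y + b x z"
begin

definition additive_map :: "('v \<Rightarrow> 'v) \<Rightarrow> bool" where
  "additive_map J \<longleftrightarrow> (\<forall>x\<in>V. J x \<in> V) \<and> (\<forall>x\<in>V. \<forall>y\<in>V. J (x + y) = J x + J y)"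

definition nijenhuis :: "('v \<Rightarrow> 'v) \<Rightarrow> 'v \<Rightarrow> 'v \<Rightarrow> 'v" where
  "nijenhuis J x y = b (J x) (J y) - b x y - J (b (J x) y) - J (b x (J y))"

lemma diff_closed [simp]: "x \<in> V \<Longrightarrow> y \<in> V \<Longrightarrow> x - y \<in> V"
  using add_closed[of x "- y"] by simp

lemma bracket_uminus: 
  assumes "x \<in> V" "y \<in> V"
  shows "b (- x) y = - b x y" "b x (- y) = - b x y"
proof -
  have 0: "0 \<in> V" using diff_closed[OF assms(1,1)] by simp
  have "b 0 y = 0" "b x 0 = 0"
    using bracket_add_left[OF 0 0 assms(2)] bracket_add_right[OF assms(1) 0 0] by simp_all
  then show "b (- x) y = - b x y" "b x (- y) = - b x y"
    using bracket_add_left[of x "- x" y] bracket_add_right[of x y "- y"] assms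
    by (simp_all add: eq_neg_iff_add_eq_0 add.commute)
qed

lemma additive_mapD:
  assumes "additive_map J"
  shows "x \<in> V \<Longrightarrow> J x \<in> V" "x \<in> V \<Longrightarrow> y \<in> V \<Longrightarrow> J (x + y) = J x + J y"
    "x \<in> V \<Longrightarrow> J (- x) = - J x" "x \<in> V \<Longrightarrow> y \<in> V \<Longrightarrow> J (x - y) = J x - J y"
proof -
  show 1: "x \<in> V \<Longrightarrow> J x \<in> V" and 2: "x \<in> V \<Longrightarrow> y \<in> V \<Longrightarrow> J (x + y) = J x + J y" for x y
    using assms unfolding additive_map_def by blast+
  show 3: "J (- x) = - J x" if "x \<in> V" for x
  proof -
    have 0: "0 \<in> V" using diff_closed[OF that that] by simp
    have "J 0 = 0" using 2[OF 0 0] by simp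
    then show ?thesis using 2[of x "- x"] that by (simp add: eq_neg_iff_add_eq_0 add.commute)
  qed
  show "x \<in> V \<Longrightarrow> y \<in> V \<Longrightarrow> J (x - y) = J x - J y" using 2[of x "- y"] 3[of y] by simp
qed

lemma nijenhuis_antilinear:
  assumes J: "additive_map J" "\<And>x. x \<in> V \<Longrightarrow> J (J x) = - x" and x: "x \<in> V" "y \<in> V"
  shows "nijenhuis J (J x) y = - J (nijenhuis J x y)" "nijenhuis J x (J y) = - J (nijenhuis J x y)"
  using x by (simp_all add: nijenhuis_def J(2) additive_mapD[OF J(1)] bracket_uminus)

lemma nijenhuis_add:
  assumes J: "additive_map J" and x: "x \<in> V" "y \<in> V" "z \<in> V"
  shows "nijenhuis J (x + y) z = nijenhuis J x z + nijenhuis J y z"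
    "nijenhuis J x (y + z) = nijenhuis J x y + nijenhuis J x z"
  using x by (simp_all add: nijenhuis_def additive_mapD[OF J] bracket_add_left bracket_add_right)

text \<open>Biadditivity and antilinearity spread the vanishing from W to sums of elements of W and
  J W. For the cone this leaves only fields without a d/dt component to be checked.\<close>

lemma nijenhuis_zeroI:
  assumes J: "additive_map J" "\<And>x. x \<in> V \<Longrightarrow> J (J x) = - x"
    and W: "W \<subseteq> V" "\<And>x. x \<in> V \<Longrightarrow> \<exists>y\<in>W. \<exists>z\<in>W. x = y + J z"
    and N: "\<And>x y. x \<in> W \<Longrightarrow> y \<in> W \<Longrightarrow> nijenhuis J x y = 0"
    and xy: "x \<in> V" "y \<in> V"
  shows "nijenhuis J x y = 0"
proof -
  obtain a a' c c' where w: "a \<in> W" "a' \<in> W" "c \<in> W" "c' \<in> W" and eq: "x = a + J a'" "y = c + J c'"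
    using W(2)[OF xy(1)] W(2)[OF xy(2)] by metis
  then have v: "a \<in> V" "a' \<in> V" "c \<in> V" "c' \<in> V" using W(1) by blast+
  have 0: "0 \<in> V" using diff_closed[OF xy(1) xy(1)] by simp
  have "J 0 = 0" using additive_mapD(4)[OF J(1) 0 0] by simp
  then show ?thesis
    unfolding eq using v w
    by (simp add: nijenhuis_add[OF J(1)] nijenhuis_antilinear[OF J] additive_mapD[OF J(1)] N)
qed

text \<open>As a function of the unit quaternion \<open>J\<close>, the Nijenhuis tensor is of the spin \<open>3/2\<close> type
  and vanishes at \<open>J\<close> iff a binary cubic vanishes at two points of the projective line; hence
  integrability of \<open>J1\<close>, \<open>J2\<close>, \<open>J3\<close> kills it. Explicitly, the mixed tensor of \<open>J1\<close> and \<open>J2\<close> is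
  \<open>J1 N3(x, J2 y) - N1(J2 x, J1 y) - N2(J1 x, J2 y)\<close>.\<close>

lemma mixed_nijenhuis_zero:
  assumes J: "additive_map J1" "additive_map J2" "additive_map J3"
    and rel: "\<And>x. x \<in> V \<Longrightarrow> J1 (J2 x) = J3 x" "\<And>x. x \<in> V \<Longrightarrow> J2 (J1 x) = - J3 x"
      "\<And>x. x \<in> V \<Longrightarrow> J3 (J2 x) = - J1 x" "\<And>x. x \<in> V \<Longrightarrow> J1 (J3 x) = - J2 x"
      "\<And>x. x \<in> V \<Longrightarrow> J1 (J1 x) = - x" "\<And>x. x \<in> V \<Longrightarrow> J2 (J2 x) = - x"
    and N: "\<And>x y. x \<in> V \<Longrightarrow> y \<in> V \<Longrightarrow> nijenhuis J1 x y = 0"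
      "\<And>x y. x \<in> V \<Longrightarrow> y \<in> V \<Longrightarrow> nijenhuis J2 x y = 0"
      "\<And>x y. x \<in> V \<Longrightarrow> y \<in> V \<Longrightarrow> nijenhuis J3 x y = 0"
    and x: "x \<in> V" and y: "y \<in> V"
  shows "b (J1 x) (J2 y) + b (J2 x) (J1 y) - J1 (b (J2 x) y) - J1 (b x (J2 y))
    - J2 (b (J1 x) y) - J2 (b x (J1 y)) = 0" (is "?M = 0")
proof -
  note maps = additive_mapD[OF J(1)] additive_mapD[OF J(2)] additive_mapD[OF J(3)]
  have 0: "0 \<in> V" using diff_closed[OF x x] by simp
  have "?M = J1 (nijenhuis J3 x (J2 y)) - nijenhuis J1 (J2 x) (J1 y) - nijenhuis J2 (J1 x) (J2 y)"
    using x y by (simp add: nijenhuis_def maps rel bracket_uminus algebra_simps)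
  also have "\<dots> = 0"
    using x y additive_mapD(4)[OF J(1) 0 0] by (simp add: N maps)
  finally show ?thesis .
qed

end

section \<open>Lie brackets and the exterior derivative of one-forms\<close>

context smooth_manifold
begin

lemma lie_sym: "lie_bracket Y X = - lie_bracket X Y"
  by (rule vfield_eqI) (simp add: lie_bracket_def)

lemma lie_add:
  assumes "X \<in> VF" "Y \<in> VF" "Z \<in> VF"
  shows "lie_bracket (X + Y) Z = lie_bracket X Z + lie_bracket Y Z"
    "lie_bracket Z (X + Y) = lie_bracket Z X + lie_bracket Z Y"
proof -
  show "lie_bracket Z (X + Y) = lie_bracket Z X + lie_bracket Z Y"
  proof (rule vfield_eqI)
    fix f p
    show "lie_bracket Z (X + Y) f p = (lie_bracket Z X + lie_bracket Z Y) f p"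
      by (cases "f \<in> F") (simp_all add: lie_bracket_def VF_arith[OF assms(3)] VF_arith[OF assms(1)]
          VF_arith[OF assms(2)] assms)
  qed
  from arg_cong[OF this, of uminus]
  show "lie_bracket (X + Y) Z = lie_bracket X Z + lie_bracket Y Z"
    by (simp add: lie_sym[of _ Z])
qed

lemma lie_fscale:
  assumes "X \<in> VF" "Y \<in> VF" "h \<in> F"
  shows "lie_bracket X (h \<odot> Y) = X h \<odot> Y + h \<odot> lie_bracket X Y"
    "lie_bracket (h \<odot> Y) X = - (X h \<odot> Y) + h \<odot> lie_bracket Y X"
proof -
  show "lie_bracket X (h \<odot> Y) = X h \<odot> Y + h \<odot> lie_bracket X Y"
  proof (rule vfield_eqI)
    fix f p
    show "lie_bracket X (h \<odot> Y) f p = (X h \<odot> Y + h \<odot> lie_bracket X Y) f p"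
      by (cases "f \<in> F") (simp_all add: lie_bracket_def VF_arith[OF assms(1)] VF_arith[OF assms(2)]
          assms algebra_simps)
  qed
  from arg_cong[OF this, of uminus]
  show "lie_bracket (h \<odot> Y) X = - (X h \<odot> Y) + h \<odot> lie_bracket Y X"
    by (simp add: lie_sym[of _ X] fscale_simps)
qed

lemma lie_uminus:
  assumes "X \<in> VF" "Y \<in> VF"
  shows "lie_bracket (- X) Y = - lie_bracket X Y" "lie_bracket Y (- X) = - lie_bracket Y X"
  using lie_fscale[OF assms(2,1), of "\<lambda>_. - 1"] VF_const[OF assms(2), of "- 1"]
  by (simp_all add: fscale_minus_one fscale_simps)

lemma lie_diff:
  assumes "X \<in> VF" "Y \<in> VF" "Z \<in> VF"
  shows "lie_bracket (X - Y) Z = lie_bracket X Z - lie_bracket Y Z"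
    "lie_bracket Z (X - Y) = lie_bracket Z X - lie_bracket Z Y"
  using lie_add[of X "- Y" Z] assms by (simp_all add: lie_uminus)

lemma lie_0: "X \<in> VF \<Longrightarrow> lie_bracket X 0 = 0" "X \<in> VF \<Longrightarrow> lie_bracket 0 X = 0"
  using lie_add[of 0 0 X] by simp_all

lemma d1_skew: "d1 \<theta> Y X = - d1 \<theta> X Y" if "one_form A \<theta>" "X \<in> VF" "Y \<in> VF"
  using that unfolding d1_def by (simp add: lie_sym[of X Y] one_form_arith[OF that(1)])

text \<open>Tensoriality: the derivatives of the coefficient \<open>h\<close> produced by the outer
  field and by the bracket cancel.\<close>

lemma d1_one_form:
  assumes \<theta>: "one_form A \<theta>" and Z: "Z \<in> VF"
  shows "one_form A (d1 \<theta> Z)" "one_form A (\<lambda>X. d1 \<theta> X Z)"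
proof -
  show 1: "one_form A (d1 \<theta> Z)"
  proof (rule one_formI)
    fix X Y assume XY: "X \<in> VF" "Y \<in> VF"
    show "d1 \<theta> Z (X + Y) = d1 \<theta> Z X + d1 \<theta> Z Y"
      using XY Z by (simp add: d1_def one_form_arith[OF \<theta>] lie_add VF_arith[OF Z])
  next
    fix X h assume h: "h \<in> F" and X: "X \<in> VF"
    show "d1 \<theta> Z (h \<odot> X) = h * d1 \<theta> Z X"
      using h X Z by (simp add: d1_def one_form_arith[OF \<theta>] lie_fscale VF_arith[OF Z] algebra_simps)
  qed (use Z in \<open>simp add: d1_def one_form_arith[OF \<theta>]\<close>)
  show "one_form A (\<lambda>X. d1 \<theta> X Z)"
    by (rule one_formI)
       (use Z in \<open>simp_all add: d1_skew[OF \<theta> Z] one_form_arith[OF 1] algebra_simps\<close>)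
qed

end

section \<open>Consequences of normality and closedness for one structure\<close>

locale quasi_sasakian_manifold = almost_contact_metric_manifold A g \<phi> \<xi> \<eta>
  for A :: "('a::{t2_space,second_countable_topology}, 'e::euclidean_space) atlas" and g \<phi> \<xi> \<eta> +
  assumes normal: "normal_structure A \<phi> \<xi> \<eta>" and closed: "closed_two_form A (fundamental_form g \<phi>)"
begin

lemmas deta_arith = one_form_arith[OF d1_one_form(1)[OF eta]] one_form_arith[OF d1_one_form(2)[OF eta]]

lemma normal_eq:
  "X \<in> VF \<Longrightarrow> Y \<in> VF \<Longrightarrow> \<phi> (\<phi> (lie_bracket X Y)) + lie_bracket (\<phi> X) (\<phi> Y)
        - \<phi> (lie_bracket (\<phi> X) Y) - \<phi> (lie_bracket X (\<phi> Y)) + d1 \<eta> X Y \<odot> \<xi> = 0"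
  using normal unfolding normal_structure_def d1_def by blast

text \<open>\<open>\<eta>\<close> annihilates every term of the normality identity lying in the
  image of \<open>\<phi>\<close>, and equals 1 on \<open>\<xi>\<close>.\<close>

lemma eta_normal_eq:
  assumes "X \<in> VF" "Y \<in> VF"
  shows "\<eta> (lie_bracket (\<phi> X) (\<phi> Y)) + d1 \<eta> X Y = 0"
proof -
  have "\<eta> (\<phi> (\<phi> (lie_bracket X Y)) + lie_bracket (\<phi> X) (\<phi> Y)
        - \<phi> (lie_bracket (\<phi> X) Y) - \<phi> (lie_bracket X (\<phi> Y)) + d1 \<eta> X Y \<odot> \<xi>) = 0"
    using normal_eq[OF assms] eta_arith(5) by simp
  then show ?thesis
    using assms by (simp add: eta_arith phi_arith deta_arith eta_phi eta_xi)
qed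

lemma deta_xi: "X \<in> VF \<Longrightarrow> d1 \<eta> X \<xi> = 0" "X \<in> VF \<Longrightarrow> d1 \<eta> \<xi> X = 0"
proof -
  assume X: "X \<in> VF"
  show "d1 \<eta> X \<xi> = 0"
    using eta_normal_eq[OF X xi] X by (simp add: phi_xi lie_0 phi_arith eta_arith)
  then show "d1 \<eta> \<xi> X = 0" using d1_skew[OF eta X xi] by simp
qed

lemma eta_lie_xi: "X \<in> VF \<Longrightarrow> \<eta> (lie_bracket \<xi> X) = \<xi> (\<eta> X)"
  using deta_xi(2)[of X] VF_1_arg[of X] by (simp add: d1_def eta_xi)

text \<open>The defect \<open>Z\<close> is killed by \<open>\<phi>\<close>, by normality with first
  argument \<open>\<xi>\<close>, and by \<open>\<eta>\<close>; hence it is zero by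
  \<open>phi_sq\<close>.\<close>

lemma lie_xi_phi:
  assumes X: "X \<in> VF" shows "lie_bracket \<xi> (\<phi> X) = \<phi> (lie_bracket \<xi> X)"
proof -
  define Z where "Z = \<phi> (lie_bracket \<xi> X) - lie_bracket \<xi> (\<phi> X)"
  have Z: "Z \<in> VF" using X by (simp add: Z_def phi_arith)
  have "\<phi> Z = 0"
    using normal_eq[OF xi X] X by (simp add: Z_def phi_xi lie_0 phi_arith deta_xi fscale_simps)
  then have "Z = \<eta> Z \<odot> \<xi>"
    using phi_sq[OF Z] by (simp add: phi_arith)
  moreover have "\<eta> Z = 0"
    using X VF_0_arg[OF xi] by (simp add: Z_def eta_arith phi_arith eta_phi eta_lie_xi)
  ultimately have "Z = 0" by (simp add: fscale_simps)
  then show ?thesis by (simp add: Z_def)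
qed

text \<open>Comes from \<open>eta_normal_eq\<close> at \<open>\<phi> X\<close>, where
  \<open>\<phi> (\<phi> X)\<close> resolves to - X plus a multiple of \<open>\<xi>\<close> whose
  bracket is controlled by \<open>eta_lie_xi\<close>.\<close>

lemma deta_phi:
  assumes X: "X \<in> VF" and Y: "Y \<in> VF"
  shows "d1 \<eta> (\<phi> X) Y = - d1 \<eta> X (\<phi> Y)"
proof -
  have "\<eta> (lie_bracket (- X + \<eta> X \<odot> \<xi>) (\<phi> Y)) + d1 \<eta> (\<phi> X) Y = 0"
    using eta_normal_eq[of "\<phi> X" Y] X Y by (simp add: phi_arith phi_sq)
  moreover have "\<eta> (lie_bracket (- X + \<eta> X \<odot> \<xi>) (\<phi> Y)) = - \<eta> (lie_bracket X (\<phi> Y)) - (\<phi> Y) (\<eta> X)"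
    using X Y VF_0_arg[OF xi]
    by (simp add: lie_add lie_diff lie_uminus lie_fscale phi_arith eta_arith eta_lie_xi eta_phi eta_xi)
  moreover have "d1 \<eta> X (\<phi> Y) = - \<eta> (lie_bracket X (\<phi> Y)) - (\<phi> Y) (\<eta> X)"
    using X Y VF_0_arg[OF X] by (simp add: d1_def eta_phi)
  ultimately have "d1 \<eta> X (\<phi> Y) + d1 \<eta> (\<phi> X) Y = 0" by (simp only:)
  then show ?thesis by (simp only: eq_neg_iff_add_eq_0 add.commute)
qed

text \<open>In the closedness equation with first argument \<open>\<xi>\<close> the terms pairing
  \<open>\<xi>\<close> with another field vanish; what remains says that the Lie derivative of the
  fundamental form along \<open>\<xi>\<close> is zero.\<close>

lemma xi_fundamental:
  assumes X: "X \<in> VF" and Y: "Y \<in> VF"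
  shows "\<xi> (g X (\<phi> Y)) = g (lie_bracket \<xi> X) (\<phi> Y) + g X (\<phi> (lie_bracket \<xi> Y))"
proof -
  have "d2 \<Omega> \<xi> X Y = 0" using closed X Y unfolding closed_two_form_def by simp
  from this[unfolded d2_def fundamental_form_def] show ?thesis
    using X Y VF_0_arg[OF X] VF_0_arg[OF Y] g_phi_skew[of "lie_bracket \<xi> Y" X] g_sym[of "\<phi> (lie_bracket \<xi> Y)" X]
    by (simp add: phi_xi g_arith g_xi eta_phi phi_arith lie_sym[of Y \<xi>] algebra_simps)
qed

text \<open>The Lie derivatives along \<open>\<xi>\<close> of the fundamental form, of
  \<open>\<phi>\<close> and of \<open>\<eta>\<close> vanish, and the metric is recovered from these
  through Y = - \<phi>(\<phi> Y) + \<eta>(Y) \<xi>.\<close>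

lemma killing:
  assumes X: "X \<in> VF" and Y: "Y \<in> VF"
  shows "\<xi> (g X Y) = g (lie_bracket \<xi> X) Y + g X (lie_bracket \<xi> Y)"
proof -
  have Y_eq: "Y = - \<phi> (\<phi> Y) + \<eta> Y \<odot> \<xi>" using phi_sq[OF Y] by simp
  have V: "\<phi> (\<phi> Y) \<in> VF" "\<eta> Y \<in> F" using Y by (simp_all add: phi_arith eta_arith)
  have 1: "\<xi> (g X (\<phi> (\<phi> Y))) = g (lie_bracket \<xi> X) (\<phi> (\<phi> Y)) + g X (lie_bracket \<xi> (\<phi> (\<phi> Y)))"
    using xi_fundamental[OF X, of "\<phi> Y"] Y by (simp add: phi_arith lie_xi_phi)
  have "g X Y = - g X (\<phi> (\<phi> Y)) + \<eta> Y * \<eta> X"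
    using X V g_xi(1)[OF X] by (subst Y_eq) (simp add: g_arith)
  then have "\<xi> (g X Y) = - \<xi> (g X (\<phi> (\<phi> Y))) + \<xi> (\<eta> Y) * \<eta> X + \<eta> Y * \<xi> (\<eta> X)"
    using X V by (simp add: VF_arith[OF xi] g_arith eta_arith)
  moreover have "g (lie_bracket \<xi> X) Y = - g (lie_bracket \<xi> X) (\<phi> (\<phi> Y)) + \<eta> Y * \<xi> (\<eta> X)"
    using X V g_xi(1)[of "lie_bracket \<xi> X"] by (subst Y_eq) (simp add: g_arith eta_lie_xi)
  moreover have "g X (lie_bracket \<xi> Y) = - g X (lie_bracket \<xi> (\<phi> (\<phi> Y))) + \<xi> (\<eta> Y) * \<eta> X"
  proof -
    have "lie_bracket \<xi> \<xi> = 0" by (rule vfield_eqI) (simp add: lie_bracket_def)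
    then have "lie_bracket \<xi> Y = - lie_bracket \<xi> (\<phi> (\<phi> Y)) + \<xi> (\<eta> Y) \<odot> \<xi>"
      using V by (subst Y_eq) (simp add: lie_add lie_diff lie_uminus lie_fscale fscale_simps)
    then show ?thesis using X V g_xi(1)[OF X] by (simp add: g_arith)
  qed
  ultimately show ?thesis by (simp only: 1) (simp add: algebra_simps)
qed

end

section \<open>3-quasi-Sasakian structures\<close>

context quasi_sasakian_manifold
begin

text \<open>Cartan's formula for the Lie derivative of the closed form \<open>\<Omega>\<close> along a Killing field.\<close>

lemma killing_lie_phi:
  assumes Z: "Z \<in> VF"
    and kill: "\<And>X Y. X \<in> VF \<Longrightarrow> Y \<in> VF \<Longrightarrow> Z (g X Y) = g (lie_bracket Z X) Y + g X (lie_bracket Z Y)"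
    and X: "X \<in> VF" and Y: "Y \<in> VF"
  shows "d1 (\<lambda>Y. g Z (\<phi> Y)) X Y = g X (lie_bracket Z (\<phi> Y) - \<phi> (lie_bracket Z Y))"
proof -
  have skew: "g W (\<phi> V) = - g V (\<phi> W)" if "V \<in> VF" "W \<in> VF" for V W
    using g_phi_skew[OF that(2,1)] g_sym[of "\<phi> W" V] that by (simp add: phi_arith)
  have "d2 \<Omega> Z X Y = 0" using closed X Y Z unfolding closed_two_form_def by simp
  from this[unfolded d2_def fundamental_form_def]
  have e1: "Z (g X (\<phi> Y)) - X (g Z (\<phi> Y)) + Y (g Z (\<phi> X)) - g (lie_bracket Z X) (\<phi> Y)
      + g Z (\<phi> (lie_bracket X Y)) - g X (\<phi> (lie_bracket Z Y)) = 0"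
    using X Y Z skew[of Z Y] skew[of Z "lie_bracket X Y"] skew[of X "lie_bracket Z Y"]
    by (simp add: lie_sym[of Y Z] g_arith phi_arith VF_uminus_arg[OF X])
  have e2: "g X (lie_bracket Z (\<phi> Y) - \<phi> (lie_bracket Z Y))
      = Z (g X (\<phi> Y)) - g (lie_bracket Z X) (\<phi> Y) - g X (\<phi> (lie_bracket Z Y))"
    using X Y Z by (simp add: kill g_arith phi_arith)
  show ?thesis unfolding d1_def e2 using e1 by (simp add: algebra_simps)
qed

end

text \<open>The even permutations: facts proved for a generic triple are reused for its
  rotations.\<close>

definition cyc :: "(nat \<times> nat \<times> nat) set" where
  "cyc = {(1,2,3), (2,3,1), (3,1,2)}"

lemma cyc_rotate: "(a, b, c) \<in> cyc \<Longrightarrow> (b, c, a) \<in> cyc"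
  by (auto simp: cyc_def)

lemma cyc_index: "(a, b, c) \<in> cyc \<Longrightarrow> a \<in> {1,2,3}"
  by (auto simp: cyc_def)

locale three_quasi_sasakian_manifold = metric_manifold A g
  for A :: "('a::{t2_space,second_countable_topology}, 'e::euclidean_space) atlas" and g +
  fixes \<phi> :: "nat \<Rightarrow> 'a vfield \<Rightarrow> 'a vfield" and \<xi> :: "nat \<Rightarrow> 'a vfield"
    and \<eta> :: "nat \<Rightarrow> 'a vfield \<Rightarrow> 'a \<Rightarrow> real"
  assumes qs: "a \<in> {1,2,3} \<Longrightarrow> quasi_sasakian_manifold A g (\<phi> a) (\<xi> a) (\<eta> a)"
    and phi_cyc: "(a, b, c) \<in> cyc \<Longrightarrow> X \<in> VF \<Longrightarrow> \<phi> c X = \<phi> a (\<phi> b X) - \<eta> b X \<odot> \<xi> a"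
    and phi_cyc': "(a, b, c) \<in> cyc \<Longrightarrow> X \<in> VF \<Longrightarrow> \<phi> c X = - \<phi> b (\<phi> a X) + \<eta> a X \<odot> \<xi> b"
    and xi_cyc: "(a, b, c) \<in> cyc \<Longrightarrow> \<xi> c = \<phi> a (\<xi> b)"
    and xi_cyc': "(a, b, c) \<in> cyc \<Longrightarrow> \<xi> c = - \<phi> b (\<xi> a)"
    and eta_cyc: "(a, b, c) \<in> cyc \<Longrightarrow> X \<in> VF \<Longrightarrow> \<eta> c X = \<eta> a (\<phi> b X)"
    and eta_cyc': "(a, b, c) \<in> cyc \<Longrightarrow> X \<in> VF \<Longrightarrow> \<eta> c X = - \<eta> b (\<phi> a X)"
begin

section \<open>The multiplication table of the three structures\<close>

context
  fixes a b c assumes abc: "(a, b, c) \<in> cyc"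
begin

lemma bca: "(b, c, a) \<in> cyc" and cab: "(c, a, b) \<in> cyc"
  using abc cyc_rotate by blast+

interpretation qa: quasi_sasakian_manifold A g "\<phi> a" "\<xi> a" "\<eta> a"
  by (rule qs[OF cyc_index[OF abc]])
interpretation qb: quasi_sasakian_manifold A g "\<phi> b" "\<xi> b" "\<eta> b"
  by (rule qs[OF cyc_index[OF bca]])
interpretation qc: quasi_sasakian_manifold A g "\<phi> c" "\<xi> c" "\<eta> c"
  by (rule qs[OF cyc_index[OF cab]])

lemma phi_a_phi: "X \<in> VF \<Longrightarrow> \<phi> a (\<phi> b X) = \<phi> c X + \<eta> b X \<odot> \<xi> a"
  "X \<in> VF \<Longrightarrow> \<phi> a (\<phi> c X) = - \<phi> b X + \<eta> c X \<odot> \<xi> a"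
  by (simp add: phi_cyc[OF abc], simp add: phi_cyc'[OF cab])

lemma phi_a_xi: "\<phi> a (\<xi> b) = \<xi> c" "\<phi> a (\<xi> c) = - \<xi> b"
  by (simp add: xi_cyc[OF abc], simp add: xi_cyc'[OF cab])

lemma eta_a_phi: "X \<in> VF \<Longrightarrow> \<eta> a (\<phi> b X) = \<eta> c X" "X \<in> VF \<Longrightarrow> \<eta> a (\<phi> c X) = - \<eta> b X"
  by (simp add: eta_cyc[OF abc], simp add: eta_cyc'[OF cab])

lemma eta_a_xi: "\<eta> a (\<xi> b) = 0" "\<eta> a (\<xi> c) = 0"
  using qa.eta_phi[OF qc.xi] qa.eta_phi[OF qb.xi] by (simp_all add: phi_a_xi qa.eta_arith)

end

lemmas cyc_table = phi_a_phi phi_a_xi eta_a_phi eta_a_xi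

context
  fixes a b c assumes abc: "(a, b, c) \<in> cyc"
begin

interpretation qa: quasi_sasakian_manifold A g "\<phi> a" "\<xi> a" "\<eta> a"
  by (rule qs[OF cyc_index[OF abc]])
interpretation qb: quasi_sasakian_manifold A g "\<phi> b" "\<xi> b" "\<eta> b"
  by (rule qs[OF cyc_index[OF bca[OF abc]]])
interpretation qc: quasi_sasakian_manifold A g "\<phi> c" "\<xi> c" "\<eta> c"
  by (rule qs[OF cyc_index[OF cab[OF abc]]])

lemmas cyc_relations = cyc_table[OF abc] cyc_table[OF bca[OF abc]] cyc_table[OF cab[OF abc]]
  qa.phi_sq qb.phi_sq qc.phi_sq qa.phi_xi qb.phi_xi qc.phi_xi qa.eta_phi qb.eta_phi qc.eta_phi
  qa.eta_xi qb.eta_xi qc.eta_xi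

lemmas cyc_linear = qa.phi_arith qb.phi_arith qc.phi_arith qa.eta_arith qb.eta_arith qc.eta_arith

text \<open>Contracting the fundamental forms of \<open>\<phi> b\<close> and \<open>\<phi> c\<close>
  with \<open>\<xi> a\<close> gives \<open>\<eta> c\<close> and minus \<open>\<eta> b\<close>, so
  \<open>killing_lie_phi\<close> expresses both sides through Lie derivatives along
  \<open>\<xi> a\<close>. Differentiating \<open>phi_cyc\<close> along \<open>\<xi> a\<close>, which
  commutes with \<open>\<phi> a\<close>, relates the two; the leftover multiple of
  \<open>\<xi> a\<close> is orthogonal to X.\<close>

lemma deta_cyc:
  assumes X: "X \<in> VF" "\<eta> a X = 0" and Y: "Y \<in> VF"
  shows "d1 (\<eta> b) X Y = d1 (\<eta> c) (\<phi> a X) Y"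
proof -
  have "g (\<xi> a) (\<phi> b V) = \<eta> c V" "g (\<xi> a) (\<phi> c V) = - \<eta> b V" if "V \<in> VF" for V
    using that by (simp_all add: qa.g_xi cyc_linear cyc_relations)
  then have d: "d1 (\<lambda>V. g (\<xi> a) (\<phi> b V)) W Y = d1 (\<eta> c) W Y"
    "d1 (\<lambda>V. g (\<xi> a) (\<phi> c V)) W Y = - d1 (\<eta> b) W Y" if "W \<in> VF" for W
    using that Y by (simp_all add: d1_def cyc_linear VF_uminus_arg[OF Y] VF_uminus_arg[OF that] algebra_simps)
  have phiX: "\<phi> a X \<in> VF" using X by (simp add: cyc_linear)
  let ?D = "\<lambda>i. lie_bracket (\<xi> a) (\<phi> i Y) - \<phi> i (lie_bracket (\<xi> a) Y)"
  have A: "d1 (\<eta> c) (\<phi> a X) Y = g (\<phi> a X) (?D b)"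
    unfolding d(1)[OF phiX, symmetric]
    by (rule qb.killing_lie_phi[OF qa.xi qa.killing phiX Y])
  have B: "- d1 (\<eta> b) X Y = g X (?D c)"
    unfolding d(2)[OF X(1), symmetric]
    by (rule qc.killing_lie_phi[OF qa.xi qa.killing X(1) Y])
  have V: "\<phi> a (\<phi> b Y) \<in> VF" "\<eta> b Y \<odot> \<xi> a \<in> VF" using Y by (simp_all add: cyc_linear)
  have 0: "lie_bracket (\<xi> a) (\<xi> a) = 0" by (rule vfield_eqI) (simp add: lie_bracket_def)
  have "lie_bracket (\<xi> a) (\<phi> c Y) = \<phi> a (lie_bracket (\<xi> a) (\<phi> b Y)) - (\<xi> a) (\<eta> b Y) \<odot> \<xi> a"
    using Y V by (simp add: phi_cyc[OF abc Y] lie_diff lie_fscale qa.lie_xi_phi 0 cyc_linear fscale_simps)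
  moreover have "\<phi> c (lie_bracket (\<xi> a) Y) = \<phi> a (\<phi> b (lie_bracket (\<xi> a) Y)) - \<eta> b (lie_bracket (\<xi> a) Y) \<odot> \<xi> a"
    using Y by (simp add: phi_cyc[OF abc])
  ultimately have "g X (?D c) = g X (\<phi> a (?D b))"
    using X Y qa.g_xi(1)[OF X(1)] by (simp add: g_arith cyc_linear)
  also have "\<dots> = - g (\<phi> a X) (?D b)"
    using X Y qa.g_phi_skew[OF X(1), of "?D b"] by (simp add: cyc_linear)
  finally show ?thesis using A B by simp
qed

end

context
  fixes a b c assumes abc: "(a, b, c) \<in> cyc"
begin

interpretation qa: quasi_sasakian_manifold A g "\<phi> a" "\<xi> a" "\<eta> a"
  by (rule qs[OF cyc_index[OF abc]])
interpretation qb: quasi_sasakian_manifold A g "\<phi> b" "\<xi> b" "\<eta> b"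
  by (rule qs[OF cyc_index[OF bca[OF abc]]])
interpretation qc: quasi_sasakian_manifold A g "\<phi> c" "\<xi> c" "\<eta> c"
  by (rule qs[OF cyc_index[OF cab[OF abc]]])

lemmas cyc_simps = cyc_relations[OF abc] cyc_linear[OF abc] fscale_simps qa.deta_arith qb.deta_arith qc.deta_arith

text \<open>\<open>deta_cyc\<close> rewrites d\<eta>_a as d\<eta>_b or d\<eta>_c, whose own Reeb
  field lies in its kernel by \<open>deta_xi\<close>.\<close>

lemma deta_horizontal_xi:
  assumes "X \<in> VF" "\<eta> a X = 0" "\<eta> b X = 0" "\<eta> c X = 0"
  shows "d1 (\<eta> a) X (\<xi> b) = 0" "d1 (\<eta> a) X (\<xi> c) = 0"
    "d1 (\<eta> a) (\<xi> b) X = 0" "d1 (\<eta> a) (\<xi> c) X = 0"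
proof -
  show 1: "d1 (\<eta> a) X (\<xi> b) = 0"
    using deta_cyc[OF cab[OF abc], of X "\<xi> b"] assms by (simp add: qb.deta_xi cyc_simps)
  show 2: "d1 (\<eta> a) X (\<xi> c) = 0"
    using deta_cyc[OF bca[OF abc], of "\<phi> b X" "\<xi> c"] assms by (simp add: qc.deta_xi cyc_simps)
  show "d1 (\<eta> a) (\<xi> b) X = 0" "d1 (\<eta> a) (\<xi> c) X = 0"
    using d1_skew[OF qa.eta assms(1)] 1 2 by simp_all
qed

text \<open>The Killing property of \<open>\<xi> c\<close>, applied to the orthogonal fields
  \<open>\<xi> b\<close> and \<open>\<xi> a\<close>, equates two bracket components. The coefficient
  is thus common to all three indices, which gives the cross product on vertical fields.\<close>

lemma deta_vertical: "d1 (\<eta> a) (\<xi> b) (\<xi> c) = d1 (\<eta> b) (\<xi> c) (\<xi> a)"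
proof -
  have "\<eta> b (lie_bracket (\<xi> c) (\<xi> a)) = \<eta> a (lie_bracket (\<xi> b) (\<xi> c))"
    using qc.killing[of "\<xi> b" "\<xi> a"] VF_0_arg[OF qc.xi]
    by (simp add: qa.g_xi qb.g_xi cyc_simps lie_sym[of "\<xi> b" "\<xi> c"])
       (simp add: lie_sym[of "\<xi> c" "\<xi> b"] cyc_simps)
  then show ?thesis
    using VF_0_arg[OF qa.xi] VF_0_arg[OF qb.xi] VF_0_arg[OF qc.xi] by (simp add: d1_def cyc_simps)
qed

lemma deta_aa:
  assumes U: "U \<in> VF" "\<eta> a U = 0" and W: "W \<in> VF" "\<eta> a W = 0"
  shows "d1 (\<eta> a) (\<phi> a U) (\<phi> a W) = d1 (\<eta> a) U W"
  using qa.deta_phi[of U "\<phi> a W"] U W by (simp add: cyc_simps)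

text \<open>For horizontal U the relation \<open>\<phi> c (\<phi> a U) = \<phi> b U\<close> turns
  \<open>deta_cyc\<close> into independence of the index.\<close>

lemma deta_phi_cyc:
  assumes U: "U \<in> VF" "\<eta> a U = 0" "\<eta> b U = 0" "\<eta> c U = 0" and Y: "Y \<in> VF"
  shows "d1 (\<eta> a) (\<phi> a U) Y = d1 (\<eta> b) (\<phi> b U) Y"
  using deta_cyc[OF cab[OF abc], of "\<phi> a U" Y] U Y by (simp add: cyc_simps)

end

end

section \<open>Half turns\<close>

text \<open>The half turn x -> 2 <n, x> n - x about a unit vector n is a rotation and so commutes
  with the cross product; this is one component of that fact.\<close>

lemma reflection_det:
  fixes na nb nc :: real
  assumes "na\<^sup>2 + nb\<^sup>2 + nc\<^sup>2 = 1"
  defines "S \<equiv> \<lambda>x y z. na * x + nb * y + nc * z"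
  shows "(2 * nb * S xa xb xc - xb) * (2 * nc * S ya yb yc - yc) - (2 * nc * S xa xb xc - xc) * (2 * nb * S ya yb yc - yb)
    = 2 * na * S (xb * yc - xc * yb) (xc * ya - xa * yc) (xa * yb - xb * ya) - (xb * yc - xc * yb)"
  using assms(1) unfolding S_def by algebra

lemma cyc_sum: "(a, b, c) \<in> cyc \<Longrightarrow> (\<Sum>i\<in>{1,2,3}. f i) = f a + f b + (f c :: 'b :: ab_group_add)"
  by (auto simp: cyc_def algebra_simps)

context three_quasi_sasakian_manifold
begin

section \<open>Values of the exterior derivatives on rotated horizontal fields\<close>

context
  fixes a b c assumes abc: "(a, b, c) \<in> cyc"
begin

interpretation qa: quasi_sasakian_manifold A g "\<phi> a" "\<xi> a" "\<eta> a"
  by (rule qs[OF cyc_index[OF abc]])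
interpretation qb: quasi_sasakian_manifold A g "\<phi> b" "\<xi> b" "\<eta> b"
  by (rule qs[OF cyc_index[OF bca[OF abc]]])
interpretation qc: quasi_sasakian_manifold A g "\<phi> c" "\<xi> c" "\<eta> c"
  by (rule qs[OF cyc_index[OF cab[OF abc]]])

context
  fixes U W assumes U: "U \<in> VF" "\<eta> a U = 0" "\<eta> b U = 0" "\<eta> c U = 0"
    and W: "W \<in> VF" "\<eta> a W = 0" "\<eta> b W = 0" "\<eta> c W = 0"
begin

lemma phi_horizontal_VF: "\<phi> a U \<in> VF" "\<phi> b U \<in> VF" "\<phi> c U \<in> VF" "\<phi> a W \<in> VF" "\<phi> b W \<in> VF" "\<phi> c W \<in> VF"
  using U W by (simp_all add: cyc_linear[OF abc])

text \<open>\<open>deta_cyc\<close> trades \<eta>_a for \<eta>_b against one \<phi>,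
  \<open>deta_phi\<close> moves the other \<phi> across, and the quaternion relations collapse the
  product. The cases below combine the same moves.\<close>

lemma deta_bb: "d1 (\<eta> a) (\<phi> b U) (\<phi> b W) = - d1 (\<eta> a) U W"
proof -
  have "d1 (\<eta> a) (\<phi> b U) (\<phi> b W) = - d1 (\<eta> b) (\<phi> a U) (\<phi> b W)"
    using deta_cyc[OF cab[OF abc], of "\<phi> b U" "\<phi> b W"] U phi_horizontal_VF by (simp add: cyc_simps[OF abc])
  also have "\<dots> = - d1 (\<eta> b) (\<phi> c U) W"
    using qb.deta_phi[of "\<phi> a U" W] U W phi_horizontal_VF by (simp add: cyc_simps[OF abc])
  also have "d1 (\<eta> b) (\<phi> c U) W = d1 (\<eta> a) U W"
    using deta_cyc[OF cab[OF abc], of U W] U W by simp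
  finally show ?thesis .
qed

lemma deta_cc: "d1 (\<eta> a) (\<phi> c U) (\<phi> c W) = - d1 (\<eta> a) U W"
proof -
  have "d1 (\<eta> a) (\<phi> c U) (\<phi> c W) = - d1 (\<eta> c) (\<phi> a U) (\<phi> c W)"
    using deta_cyc[OF bca[OF abc], of "\<phi> a U" "\<phi> c W"] U phi_horizontal_VF by (simp add: cyc_simps[OF abc])
  also have "\<dots> = d1 (\<eta> c) (\<phi> b U) W"
    using qc.deta_phi[of "\<phi> a U" W] U W phi_horizontal_VF by (simp add: cyc_simps[OF abc])
  also have "\<dots> = - d1 (\<eta> a) U W"
    using deta_cyc[OF bca[OF abc], of "\<phi> b U" W] U W phi_horizontal_VF by (simp add: cyc_simps[OF abc])
  finally show ?thesis .
qed

end

context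
  fixes U W assumes U: "U \<in> VF" "\<eta> a U = 0" "\<eta> b U = 0" "\<eta> c U = 0"
    and W: "W \<in> VF" "\<eta> a W = 0" "\<eta> b W = 0" "\<eta> c W = 0"
begin

lemmas phi_UW_VF = phi_horizontal_VF[OF U W]

lemma deta_ab: "d1 (\<eta> a) (\<phi> a U) (\<phi> b W) = d1 (\<eta> b) U W"
  using deta_phi_cyc[OF abc U phi_UW_VF(5)] deta_aa[OF bca[OF abc] U(1,3) W(1,3)] by simp

lemma deta_ba: "d1 (\<eta> a) (\<phi> b U) (\<phi> a W) = d1 (\<eta> b) U W"
proof -
  have "d1 (\<eta> a) (\<phi> b U) (\<phi> a W) = - d1 (\<eta> a) (\<phi> c U) W"
    using qa.deta_phi[of "\<phi> b U" W] U W phi_UW_VF by (simp add: cyc_simps[OF abc])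
  also have "\<dots> = d1 (\<eta> b) U W"
    using deta_cyc[OF cab[OF abc], of "\<phi> c U" W] U W phi_UW_VF by (simp add: cyc_simps[OF abc])
  finally show ?thesis .
qed

lemma deta_ac: "d1 (\<eta> a) (\<phi> a U) (\<phi> c W) = d1 (\<eta> c) U W"
  using deta_phi_cyc[OF cab[OF abc] U(1,4,2,3) phi_UW_VF(6)] deta_aa[OF cab[OF abc] U(1,4) W(1,4)] by simp

lemma deta_ca: "d1 (\<eta> a) (\<phi> c U) (\<phi> a W) = d1 (\<eta> c) U W"
proof -
  have "d1 (\<eta> a) (\<phi> c U) (\<phi> a W) = d1 (\<eta> a) (\<phi> b U) W"
    using qa.deta_phi[of "\<phi> c U" W] U W phi_UW_VF by (simp add: cyc_simps[OF abc])
  also have "\<dots> = d1 (\<eta> c) U W"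
    using deta_cyc[OF bca[OF abc], of U W] U W phi_UW_VF by simp
  finally show ?thesis .
qed

lemma deta_bc: "d1 (\<eta> a) (\<phi> b U) (\<phi> c W) = - d1 (\<eta> c) (\<phi> c U) W"
proof -
  have "d1 (\<eta> a) (\<phi> b U) (\<phi> c W) = - d1 (\<eta> b) (\<phi> a U) (\<phi> c W)"
    using deta_cyc[OF cab[OF abc], of "\<phi> b U" "\<phi> c W"] U phi_UW_VF by (simp add: cyc_simps[OF abc])
  also have "d1 (\<eta> b) (\<phi> a U) (\<phi> c W) = - d1 (\<eta> c) U (\<phi> c W)"
    using deta_phi_cyc[OF bca[OF abc], of "\<phi> c U" "\<phi> c W"] U phi_UW_VF by (simp add: cyc_simps[OF abc])
  finally show ?thesis using qc.deta_phi[of U W] U W by simp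
qed

lemma deta_cb: "d1 (\<eta> a) (\<phi> c U) (\<phi> b W) = d1 (\<eta> c) (\<phi> c U) W"
proof -
  have "d1 (\<eta> a) (\<phi> c U) (\<phi> b W) = - d1 (\<eta> c) (\<phi> a U) (\<phi> b W)"
    using deta_cyc[OF bca[OF abc], of "\<phi> a U" "\<phi> b W"] U phi_UW_VF by (simp add: cyc_simps[OF abc])
  also have "d1 (\<eta> c) (\<phi> a U) (\<phi> b W) = d1 (\<eta> b) U (\<phi> b W)"
    using deta_phi_cyc[OF bca[OF abc], of "\<phi> b U" "\<phi> b W"] U phi_UW_VF by (simp add: cyc_simps[OF abc])
  also have "- d1 (\<eta> b) U (\<phi> b W) = d1 (\<eta> b) (\<phi> b U) W"
    using qb.deta_phi[of U W] U W by simp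
  also have "\<dots> = d1 (\<eta> c) (\<phi> c U) W"
    using deta_phi_cyc[OF bca[OF abc], of U W] U W by simp
  finally show ?thesis .
qed

text \<open>Of the nine terms, those mixing b and c cancel, those mixing a with b or c double up,
  and the three squares give d\<eta>_a with signs +, -, -. For unit \<nu> this is a row of the
  half-turn matrix about \<nu>.\<close>

lemma deta_horizontal_rotation:
  fixes \<nu> :: "nat \<Rightarrow> real"
  defines "R \<equiv> \<lambda>V. (\<lambda>_. \<nu> a) \<odot> \<phi> a V + (\<lambda>_. \<nu> b) \<odot> \<phi> b V + (\<lambda>_. \<nu> c) \<odot> \<phi> c V"
  shows "d1 (\<eta> a) (R U) (R W) p = 2 * \<nu> a * (\<nu> a * d1 (\<eta> a) U W p + \<nu> b * d1 (\<eta> b) U W p + \<nu> c * d1 (\<eta> c) U W p)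
    - ((\<nu> a)\<^sup>2 + (\<nu> b)\<^sup>2 + (\<nu> c)\<^sup>2) * d1 (\<eta> a) U W p"
  unfolding R_def using U W phi_UW_VF
  by (simp add: qa.deta_arith deta_aa[OF abc U(1,2) W(1,2)] deta_bb[OF U W] deta_cc[OF U W] deta_ab deta_ba deta_ac deta_ca
      deta_bc deta_cb algebra_simps power2_eq_square)

end

end

definition ver :: "'a vfield \<Rightarrow> 'a vfield" where
  "ver X = (\<Sum>i\<in>{1,2,3}. \<eta> i X \<odot> \<xi> i)"

definition hor :: "'a vfield \<Rightarrow> 'a vfield" where
  "hor X = X - ver X"

text \<open>On the vertical distribution \<open>rot \<nu>\<close> is the half turn about the axis \<open>\<nu>\<close>; on the horizontal
  one it is \<open>\<phi>\<^sub>\<nu>\<close>, a unit quaternion lifting that half turn.\<close>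

definition rot :: "(nat \<Rightarrow> real) \<Rightarrow> 'a vfield \<Rightarrow> 'a vfield" where
  "rot \<nu> X = (\<Sum>i\<in>{1,2,3}. (\<lambda>_. \<nu> i) \<odot> \<phi> i (hor X)) +
    ((\<lambda>_. 2) * (\<Sum>i\<in>{1,2,3}. (\<lambda>_. \<nu> i) * \<eta> i X)) \<odot> (\<Sum>i\<in>{1,2,3}. (\<lambda>_. \<nu> i) \<odot> \<xi> i) - ver X"

context
  fixes a b c assumes abc: "(a, b, c) \<in> cyc"
begin

interpretation qa: quasi_sasakian_manifold A g "\<phi> a" "\<xi> a" "\<eta> a"
  by (rule qs[OF cyc_index[OF abc]])
interpretation qb: quasi_sasakian_manifold A g "\<phi> b" "\<xi> b" "\<eta> b"
  by (rule qs[OF cyc_index[OF bca[OF abc]]])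
interpretation qc: quasi_sasakian_manifold A g "\<phi> c" "\<xi> c" "\<eta> c"
  by (rule qs[OF cyc_index[OF cab[OF abc]]])

lemma eta_VF: "X \<in> VF \<Longrightarrow> \<eta> a X \<in> F" "X \<in> VF \<Longrightarrow> \<eta> b X \<in> F" "X \<in> VF \<Longrightarrow> \<eta> c X \<in> F"
  by (simp_all add: cyc_linear[OF abc])

lemma ver_cyc: "ver X = \<eta> a X \<odot> \<xi> a + \<eta> b X \<odot> \<xi> b + \<eta> c X \<odot> \<xi> c"
  unfolding ver_def by (rule cyc_sum[OF abc])

lemma hor_VF: "X \<in> VF \<Longrightarrow> hor X \<in> VF" and ver_VF: "X \<in> VF \<Longrightarrow> ver X \<in> VF"
  by (simp_all add: hor_def ver_cyc eta_VF)

lemma eta_hor: "X \<in> VF \<Longrightarrow> \<eta> a (hor X) = 0" "X \<in> VF \<Longrightarrow> \<eta> b (hor X) = 0" "X \<in> VF \<Longrightarrow> \<eta> c (hor X) = 0"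
  by (simp_all add: hor_def ver_cyc cyc_simps[OF abc])

text \<open>Mixed terms vanish by \<open>deta_horizontal_xi\<close>, and \<open>\<xi> a\<close> is
  in the kernel of d\<eta>_a, so the vertical part has a single coefficient.\<close>

lemma deta_split:
  assumes X: "X \<in> VF" and Y: "Y \<in> VF"
  shows "d1 (\<eta> a) X Y = d1 (\<eta> a) (hor X) (hor Y)
    + d1 (\<eta> a) (\<xi> b) (\<xi> c) * (\<eta> b X * \<eta> c Y - \<eta> c X * \<eta> b Y)"
proof -
  have eq: "X = hor X + ver X" "Y = hor Y + ver Y" by (simp_all add: hor_def)
  have alt: "d1 (\<eta> a) (\<xi> b) (\<xi> b) = 0" "d1 (\<eta> a) (\<xi> c) (\<xi> c) = 0"
    "d1 (\<eta> a) (\<xi> c) (\<xi> b) = - d1 (\<eta> a) (\<xi> b) (\<xi> c)"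
    using fun_double_zero d1_skew[OF qa.eta] qb.xi qc.xi by metis+
  have vv: "d1 (\<eta> a) (ver X) (ver Y) = d1 (\<eta> a) (\<xi> b) (\<xi> c) * (\<eta> b X * \<eta> c Y - \<eta> c X * \<eta> b Y)"
    using X Y by (simp add: ver_cyc qa.deta_arith eta_VF qa.deta_xi alt algebra_simps)
  have hv: "d1 (\<eta> a) (hor Z) (ver Z') = 0" "d1 (\<eta> a) (ver Z') (hor Z) = 0" if "Z \<in> VF" "Z' \<in> VF" for Z Z'
    using that deta_horizontal_xi[OF abc hor_VF eta_hor, of Z]
    by (simp_all add: ver_cyc qa.deta_arith eta_VF qa.deta_xi hor_VF)
  have "d1 (\<eta> a) X Y = d1 (\<eta> a) (hor X + ver X) (hor Y + ver Y)" by (simp only: eq[symmetric])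
  also have "\<dots> = d1 (\<eta> a) (hor X) (hor Y) + d1 (\<eta> a) (ver X) (ver Y)"
    using X Y by (simp add: qa.deta_arith hor_VF ver_VF hv)
  finally show ?thesis by (simp only: vv)
qed

end

context
  fixes a b c assumes abc: "(a, b, c) \<in> cyc"
begin

interpretation qa: quasi_sasakian_manifold A g "\<phi> a" "\<xi> a" "\<eta> a"
  by (rule qs[OF cyc_index[OF abc]])
interpretation qb: quasi_sasakian_manifold A g "\<phi> b" "\<xi> b" "\<eta> b"
  by (rule qs[OF cyc_index[OF bca[OF abc]]])
interpretation qc: quasi_sasakian_manifold A g "\<phi> c" "\<xi> c" "\<eta> c"
  by (rule qs[OF cyc_index[OF cab[OF abc]]])

context
  fixes \<nu> :: "nat \<Rightarrow> real" assumes \<nu>: "(\<nu> a)\<^sup>2 + (\<nu> b)\<^sup>2 + (\<nu> c)\<^sup>2 = 1"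
begin

abbreviation "R V \<equiv> (\<lambda>_. \<nu> a) \<odot> \<phi> a V + (\<lambda>_. \<nu> b) \<odot> \<phi> b V + (\<lambda>_. \<nu> c) \<odot> \<phi> c V"

lemma rot_cyc: "rot \<nu> X = R (hor X) + ((\<lambda>_. 2) * ((\<lambda>_. \<nu> a) * \<eta> a X + (\<lambda>_. \<nu> b) * \<eta> b X + (\<lambda>_. \<nu> c) * \<eta> c X)) \<odot>
    ((\<lambda>_. \<nu> a) \<odot> \<xi> a + (\<lambda>_. \<nu> b) \<odot> \<xi> b + (\<lambda>_. \<nu> c) \<odot> \<xi> c) - ver X"
  unfolding rot_def cyc_sum[OF abc] ..

lemma rot_VF: "X \<in> VF \<Longrightarrow> rot \<nu> X \<in> VF"
  by (simp add: rot_cyc hor_VF[OF abc] ver_VF[OF abc] eta_VF[OF abc] cyc_linear[OF abc])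

lemma eta_rot:
  assumes X: "X \<in> VF"
  shows "\<eta> a (rot \<nu> X) p = 2 * \<nu> a * (\<nu> a * \<eta> a X p + \<nu> b * \<eta> b X p + \<nu> c * \<eta> c X p) - \<eta> a X p"
    "\<eta> b (rot \<nu> X) p = 2 * \<nu> b * (\<nu> a * \<eta> a X p + \<nu> b * \<eta> b X p + \<nu> c * \<eta> c X p) - \<eta> b X p"
    "\<eta> c (rot \<nu> X) p = 2 * \<nu> c * (\<nu> a * \<eta> a X p + \<nu> b * \<eta> b X p + \<nu> c * \<eta> c X p) - \<eta> c X p"
  using X by (simp_all add: rot_cyc ver_cyc[OF abc] hor_VF[OF abc] eta_hor[OF abc] cyc_simps[OF abc] algebra_simps)

lemma hor_rot:
  assumes X: "X \<in> VF" shows "hor (rot \<nu> X) = R (hor X)"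
proof (rule vfield_eqI)
    fix f p
    have "ver (rot \<nu> X) f p = \<eta> a (rot \<nu> X) p * \<xi> a f p + \<eta> b (rot \<nu> X) p * \<xi> b f p + \<eta> c (rot \<nu> X) p * \<xi> c f p"
      by (simp add: ver_cyc[OF abc])
    also have "\<dots> = rot \<nu> X f p - R (hor X) f p"
      unfolding eta_rot[OF X] by (simp add: rot_cyc ver_cyc[OF abc] algebra_simps)
    finally have "ver (rot \<nu> X) f p = rot \<nu> X f p - R (hor X) f p" .
    then show "hor (rot \<nu> X) f p = R (hor X) f p" by (simp add: hor_def)
qed

text \<open>Horizontally the half-turn matrix comes from \<open>deta_horizontal_rotation\<close>,
  vertically from \<open>reflection_det\<close>; the common coefficient \<open>k\<close> makes both
  parts transform by the same matrix.\<close>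

lemma deta_rot:
  assumes X: "X \<in> VF" and Y: "Y \<in> VF"
  shows "d1 (\<eta> a) (rot \<nu> X) (rot \<nu> Y) p
    = 2 * \<nu> a * (\<nu> a * d1 (\<eta> a) X Y p + \<nu> b * d1 (\<eta> b) X Y p + \<nu> c * d1 (\<eta> c) X Y p) - d1 (\<eta> a) X Y p"
proof -
  define k where "k = d1 (\<eta> a) (\<xi> b) (\<xi> c) p"
  have kb: "d1 (\<eta> b) (\<xi> c) (\<xi> a) p = k" and kc: "d1 (\<eta> c) (\<xi> a) (\<xi> b) p = k"
    using deta_vertical[OF abc] deta_vertical[OF cab[OF abc]] by (simp_all add: k_def)
  have split: "d1 (\<eta> a) X Y p = d1 (\<eta> a) (hor X) (hor Y) p + k * (\<eta> b X p * \<eta> c Y p - \<eta> c X p * \<eta> b Y p)"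
    if "X \<in> VF" "Y \<in> VF" for X Y
    using deta_split[OF abc that] by (simp add: k_def)
  have split_b: "d1 (\<eta> b) X Y p = d1 (\<eta> b) (hor X) (hor Y) p + k * (\<eta> c X p * \<eta> a Y p - \<eta> a X p * \<eta> c Y p)"
    and split_c: "d1 (\<eta> c) X Y p = d1 (\<eta> c) (hor X) (hor Y) p + k * (\<eta> a X p * \<eta> b Y p - \<eta> b X p * \<eta> a Y p)"
    using deta_split[OF bca[OF abc] X Y] deta_split[OF cab[OF abc] X Y] kb kc by simp_all
  have vertical: "k * (\<eta> b (rot \<nu> X) p * \<eta> c (rot \<nu> Y) p - \<eta> c (rot \<nu> X) p * \<eta> b (rot \<nu> Y) p)
    = k * (2 * \<nu> a * (\<nu> a * (\<eta> b X p * \<eta> c Y p - \<eta> c X p * \<eta> b Y p) + \<nu> b * (\<eta> c X p * \<eta> a Y p - \<eta> a X p * \<eta> c Y p)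
        + \<nu> c * (\<eta> a X p * \<eta> b Y p - \<eta> b X p * \<eta> a Y p)) - (\<eta> b X p * \<eta> c Y p - \<eta> c X p * \<eta> b Y p))"
    unfolding eta_rot[OF X] eta_rot[OF Y] by (simp only: reflection_det[OF \<nu>])
  have "d1 (\<eta> a) (rot \<nu> X) (rot \<nu> Y) p = d1 (\<eta> a) (R (hor X)) (R (hor Y)) p
      + k * (\<eta> b (rot \<nu> X) p * \<eta> c (rot \<nu> Y) p - \<eta> c (rot \<nu> X) p * \<eta> b (rot \<nu> Y) p)"
    using split[OF rot_VF[OF X] rot_VF[OF Y]] by (simp only: hor_rot[OF X] hor_rot[OF Y])
  then show ?thesis
    unfolding vertical split[OF X Y] split_b split_c
      deta_horizontal_rotation[OF abc hor_VF[OF abc X] eta_hor[OF abc X] hor_VF[OF abc Y] eta_hor[OF abc Y]] \<nu>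
    by (simp add: algebra_simps)
qed

end

end

end

section \<open>The cone structure and the transfer of Cartan class\<close>

text \<open>The invariant vector fields \<open>X + f d/dt\<close> on the product of the manifold with the line form the
  bracket module \<open>pairs\<close>; \<open>cone_map\<close> is the almost complex structure on the product that is
  integrable iff the almost contact structure is normal.\<close>

definition cone_map :: "('a vfield \<Rightarrow> 'a vfield) \<Rightarrow> 'a vfield \<Rightarrow> ('a vfield \<Rightarrow> 'a \<Rightarrow> real) \<Rightarrow>
    'a vfield \<times> ('a \<Rightarrow> real) \<Rightarrow> 'a vfield \<times> ('a \<Rightarrow> real)" where
  "cone_map \<phi> \<xi> \<eta> x = (\<phi> (fst x) - snd x \<odot> \<xi>, \<eta> (fst x))"

definition pair_bracket :: "'a vfield \<times> ('a \<Rightarrow> real) \<Rightarrow> 'a vfield \<times> ('a \<Rightarrow> real) \<Rightarrow> 'a vfield \<times> ('a \<Rightarrow> real)" where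
  "pair_bracket x y = (lie_bracket (fst x) (fst y), fst x (snd y) - fst y (snd x))"

context smooth_manifold
begin

lemma bracket_module_pairs: "bracket_module (VF \<times> F) pair_bracket"
  by standard
     (auto simp: pair_bracket_def lie_add VF_plus)

end

context quasi_sasakian_manifold
begin

interpretation cone: bracket_module "VF \<times> F" pair_bracket
  by (rule bracket_module_pairs)

abbreviation "J \<equiv> cone_map \<phi> \<xi> \<eta>"

lemma additive_cone_map: "cone.additive_map J"
  unfolding cone.additive_map_def
  by (auto simp: cone_map_def phi_arith eta_arith fscale_simps)

lemma cone_map_sq: "x \<in> VF \<times> F \<Longrightarrow> J (J x) = - x"
  by (auto simp: cone_map_def phi_arith eta_arith phi_sq phi_xi eta_phi eta_xi fscale_simps)

text \<open>On fields without d/dt component, to which \<open>nijenhuis_zeroI\<close> reduces, the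
  first component of the tensor is the normality identity and the second is
  \<open>deta_phi\<close>.\<close>

lemma nijenhuis_cone_map:
  assumes "x \<in> VF \<times> F" "y \<in> VF \<times> F"
  shows "cone.nijenhuis J x y = 0"
proof (rule cone.nijenhuis_zeroI[OF additive_cone_map cone_map_sq, where W="VF \<times> {0}"])
  show "\<exists>y\<in>VF \<times> {0}. \<exists>z\<in>VF \<times> {0}. x = y + J z" if "x \<in> VF \<times> F" for x
  proof -
    from that obtain X f where x: "x = (X, f)" "X \<in> VF" "f \<in> F" by blast
    \<comment> \<open>A pure d/dt component is reached because J sends
      \<open>(f \<odot> \<xi>, 0)\<close> to \<open>(0, f)\<close>.\<close>
    then have eq: "x = (X, 0) + J (f \<odot> \<xi>, 0)"
      by (simp add: cone_map_def phi_arith eta_arith phi_xi eta_xi fscale_simps)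
    show ?thesis by (rule bexI[of _ "(X, 0)"], rule bexI[of _ "(f \<odot> \<xi>, 0)"], rule eq) (use x in auto)
  qed
next
  fix x y :: "'a vfield \<times> ('a \<Rightarrow> real)" assume "x \<in> VF \<times> {0}" "y \<in> VF \<times> {0}"
  then obtain X Y where x: "x = (X, 0)" "y = (Y, 0)" and X: "X \<in> VF" and Y: "Y \<in> VF" by blast
  have phiV: "\<phi> X \<in> VF" "\<phi> Y \<in> VF" using X Y by (simp_all add: phi_arith)
  note 0 = VF_0_arg[OF X] VF_0_arg[OF Y] VF_0_arg[OF phiV(1)] VF_0_arg[OF phiV(2)]
  have 1: "lie_bracket (\<phi> X) (\<phi> Y) - lie_bracket X Y - (\<phi> (lie_bracket (\<phi> X) Y) + Y (\<eta> X) \<odot> \<xi>)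
      - (\<phi> (lie_bracket X (\<phi> Y)) - X (\<eta> Y) \<odot> \<xi>) = 0"
    using normal_eq[OF X Y] X Y by (simp add: phi_sq d1_def fscale_simps algebra_simps)
  have 2: "(\<phi> X) (\<eta> Y) - (\<phi> Y) (\<eta> X) - \<eta> (lie_bracket (\<phi> X) Y) - \<eta> (lie_bracket X (\<phi> Y)) = 0"
    using deta_phi[OF X Y] X Y 0 by (simp add: d1_def eta_phi algebra_simps)
  show "cone.nijenhuis J x y = 0"
    unfolding cone.nijenhuis_def x
    using 1 2 by (simp add: cone_map_def pair_bracket_def 0 fscale_simps zero_prod_def)
qed (use assms in auto)

end

context smooth_manifold
begin

lemma wedge_power_pullback:
  assumes T: "\<And>X Y. X \<in> VF \<Longrightarrow> Y \<in> VF \<Longrightarrow> \<Omega> (T X) (T Y) = \<Omega>' X Y"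
    and X: "\<And>i. X i \<in> VF"
  shows "wedge_power \<Omega> r (\<lambda>i. T (X i)) = wedge_power \<Omega>' r X"
proof (rule ext)
  fix p
  show "wedge_power \<Omega> r (\<lambda>i. T (X i)) p = wedge_power \<Omega>' r X p"
    by (simp add: wedge_power_eq_sum_permutations T X)
qed

lemma wedge_one_form_pullback:
  assumes "\<And>X Y. X \<in> VF \<Longrightarrow> Y \<in> VF \<Longrightarrow> \<Omega> (T X) (T Y) = \<Omega>' X Y" "\<And>X. X \<in> VF \<Longrightarrow> \<theta> (T X) = \<theta>' X"
    and X: "\<And>i. X i \<in> VF"
  shows "wedge 1 k (of_one_form \<theta>) (wedge_power \<Omega> r) (\<lambda>i. T (X i))
    = wedge 1 k (of_one_form \<theta>') (wedge_power \<Omega>' r) X"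
proof -
  have 1: "wedge_power \<Omega> r (\<lambda>i. T (X (h i))) = wedge_power \<Omega>' r (\<lambda>i. X (h i))" for h :: "nat \<Rightarrow> nat"
    by (rule wedge_power_pullback[where T=T and \<Omega>=\<Omega> and \<Omega>'=\<Omega>' and X="\<lambda>i. X (h i)", OF assms(1) X])
  have 2: "\<theta> (T (X i)) = \<theta>' (X i)" for i
    by (rule assms(2)[OF X])
  show ?thesis by (simp only: wedge_def of_one_form_def 1 2)
qed

text \<open>Nonvanishing is carried over by \<open>T\<close> and identical vanishing by
  \<open>S\<close>, because the forms in the Cartan class are evaluated from the values of the
  one-form and of its \<open>d1\<close> alone.\<close>

lemma cartan_class_transfer:
  assumes T: "\<And>X. X \<in> VF \<Longrightarrow> T X \<in> VF" "\<And>X. X \<in> VF \<Longrightarrow> \<mu> (T X) = \<theta> X"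
      "\<And>X Y. X \<in> VF \<Longrightarrow> Y \<in> VF \<Longrightarrow> d1 \<mu> (T X) (T Y) = d1 \<theta> X Y"
    and S: "\<And>X. X \<in> VF \<Longrightarrow> S X \<in> VF" "\<And>X. X \<in> VF \<Longrightarrow> \<theta> (S X) = \<mu> X"
      "\<And>X Y. X \<in> VF \<Longrightarrow> Y \<in> VF \<Longrightarrow> d1 \<theta> (S X) (S Y) = d1 \<mu> X Y"
    and "cartan_class A \<theta> k"
  shows "cartan_class A \<mu> k"
proof -
  have nz: "nowhere_zero A w'" if nw: "nowhere_zero A w"
    and pull: "\<And>X. (\<And>i. X i \<in> VF) \<Longrightarrow> w' (\<lambda>i. T (X i)) = w X" for w w'
    unfolding nowhere_zero_def
  proof
    fix p
    from nw obtain X where X: "\<forall>i. X i \<in> VF" and p: "w X p \<noteq> 0"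
      unfolding nowhere_zero_def by blast
    have "w' (\<lambda>i. T (X i)) p \<noteq> 0" using pull[of X] X p by simp
    moreover have "\<forall>i. T (X i) \<in> VF" using X T(1) by simp
    ultimately show "\<exists>X. (\<forall>i. X i \<in> VF) \<and> w' X p \<noteq> 0"
      by (intro exI[of _ "\<lambda>i. T (X i)"] conjI)
  qed
  have iz: "identically_zero A w'" if id: "identically_zero A w"
    and pull: "\<And>X. (\<And>i. X i \<in> VF) \<Longrightarrow> w (\<lambda>i. S (X i)) = w' X" for w w'
    unfolding identically_zero_def
  proof (intro allI impI)
    fix X :: "nat \<Rightarrow> 'a vfield" assume X: "\<forall>i. X i \<in> VF"
    then have "\<forall>i. S (X i) \<in> VF" using S(1) by simp
    then have "w (\<lambda>i. S (X i)) = 0"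
      using id[unfolded identically_zero_def, rule_format, of "\<lambda>i. S (X i)"] by simp
    then show "w' X = 0" using pull[of X] X by simp
  qed
  have pb: "wedge_power (d1 \<mu>) r (\<lambda>i. T (X i)) = wedge_power (d1 \<theta>) r X"
      "wedge 1 (2 * r) (of_one_form \<mu>) (wedge_power (d1 \<mu>) r) (\<lambda>i. T (X i))
        = wedge 1 (2 * r) (of_one_form \<theta>) (wedge_power (d1 \<theta>) r) X"
    if X: "\<And>i. X i \<in> VF" for X r
  proof -
    show "wedge_power (d1 \<mu>) r (\<lambda>i. T (X i)) = wedge_power (d1 \<theta>) r X"
      by (rule wedge_power_pullback[where T=T and \<Omega>="d1 \<mu>" and \<Omega>'="d1 \<theta>" and X=X, OF T(3) X])
    show "wedge 1 (2 * r) (of_one_form \<mu>) (wedge_power (d1 \<mu>) r) (\<lambda>i. T (X i))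
        = wedge 1 (2 * r) (of_one_form \<theta>) (wedge_power (d1 \<theta>) r) X"
      by (rule wedge_one_form_pullback[where T=T and \<theta>=\<mu> and \<theta>'=\<theta> and \<Omega>="d1 \<mu>" and \<Omega>'="d1 \<theta>" and X=X, OF T(3,2) X])
  qed
  have pb': "wedge_power (d1 \<theta>) r (\<lambda>i. S (X i)) = wedge_power (d1 \<mu>) r X"
      "wedge 1 (2 * r) (of_one_form \<theta>) (wedge_power (d1 \<theta>) r) (\<lambda>i. S (X i))
        = wedge 1 (2 * r) (of_one_form \<mu>) (wedge_power (d1 \<mu>) r) X"
    if X: "\<And>i. X i \<in> VF" for X r
  proof -
    show "wedge_power (d1 \<theta>) r (\<lambda>i. S (X i)) = wedge_power (d1 \<mu>) r X"
      by (rule wedge_power_pullback[where T=S and \<Omega>="d1 \<theta>" and \<Omega>'="d1 \<mu>" and X=X, OF S(3) X])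
    show "wedge 1 (2 * r) (of_one_form \<theta>) (wedge_power (d1 \<theta>) r) (\<lambda>i. S (X i))
        = wedge 1 (2 * r) (of_one_form \<mu>) (wedge_power (d1 \<mu>) r) X"
      by (rule wedge_one_form_pullback[where T=S and \<theta>=\<theta> and \<theta>'=\<mu> and \<Omega>="d1 \<theta>" and \<Omega>'="d1 \<mu>" and X=X, OF S(3,2) X])
  qed
  from assms(7) show ?thesis
    unfolding cartan_class_def
  proof (elim disjE exE conjE)
    fix r
    assume "k = 2 * r + 1" and 1: "nowhere_zero A (wedge 1 (2 * r) (of_one_form \<theta>) (wedge_power (d1 \<theta>) r))"
      and 2: "identically_zero A (wedge_power (d1 \<theta>) (r + 1))"
    then show "(\<exists>r. k = 2 * r + 1 \<and>
        nowhere_zero A (wedge 1 (2 * r) (of_one_form \<mu>) (wedge_power (d1 \<mu>) r)) \<and>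
        identically_zero A (wedge_power (d1 \<mu>) (r + 1))) \<or>
     (\<exists>r. k = 2 * r \<and> nowhere_zero A (wedge_power (d1 \<mu>) r) \<and>
        identically_zero A (wedge 1 (2 * r) (of_one_form \<mu>) (wedge_power (d1 \<mu>) r)))"
      using nz[OF 1 pb(2)] iz[OF 2 pb'(1)] by blast
  next
    fix r
    assume "k = 2 * r" and 1: "nowhere_zero A (wedge_power (d1 \<theta>) r)"
      and 2: "identically_zero A (wedge 1 (2 * r) (of_one_form \<theta>) (wedge_power (d1 \<theta>) r))"
    then show "(\<exists>r. k = 2 * r + 1 \<and>
        nowhere_zero A (wedge 1 (2 * r) (of_one_form \<mu>) (wedge_power (d1 \<mu>) r)) \<and>
        identically_zero A (wedge_power (d1 \<mu>) (r + 1))) \<or>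
     (\<exists>r. k = 2 * r \<and> nowhere_zero A (wedge_power (d1 \<mu>) r) \<and>
        identically_zero A (wedge 1 (2 * r) (of_one_form \<mu>) (wedge_power (d1 \<mu>) r)))"
      using nz[OF 1 pb(1)] iz[OF 2 pb'(2)] by blast
  qed
qed

lemma one_form_cong:
  assumes "\<And>X. X \<in> VF \<Longrightarrow> \<theta> X = \<theta>' X" "one_form A \<theta>"
  shows "one_form A \<theta>'"
  by (rule one_formI) (simp_all add: assms(1)[symmetric] one_form_arith[OF assms(2)])

text \<open>The fundamental form of a combination and the combination of fundamental forms are
  compared only on vector fields, so a congruence takes the place of an equation between
  functions.\<close>

lemma almost_cosymplectic_cong:
  assumes eq: "\<And>X Y. X \<in> VF \<Longrightarrow> Y \<in> VF \<Longrightarrow> \<Omega> X Y = \<Omega>' X Y" and ac: "almost_cosymplectic A \<theta> \<Omega>"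
  shows "almost_cosymplectic A \<theta> \<Omega>'"
proof -
  have \<theta>: "one_form A \<theta>" and \<Omega>: "two_form A \<Omega>" using ac unfolding almost_cosymplectic_def by blast+
  obtain m where m: "DIM('e) = 2 * m + 1"
    and nz: "nowhere_zero A (wedge 1 (2 * m) (of_one_form \<theta>) (wedge_power \<Omega> m))"
    using ac unfolding almost_cosymplectic_def by blast
  have "two_form A \<Omega>'"
    unfolding two_form_def bilinear_field_def
  proof (intro conjI ballI)
    fix X assume X: "X \<in> VF"
    have "bilinear_field A \<Omega>" "\<Omega> X X = 0" using \<Omega> X unfolding two_form_def by blast+
    then show "one_form A (\<Omega>' X)" "one_form A (\<lambda>Y. \<Omega>' Y X)" "\<Omega>' X X = 0"
      using one_form_cong[OF eq[OF X]] one_form_cong[where \<theta>="\<lambda>Y. \<Omega> Y X" and \<theta>'="\<lambda>Y. \<Omega>' Y X", OF eq[OF _ X]]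
        eq[OF X X] bilinear_fieldD[of \<Omega> X] X by simp_all
  qed
  moreover have "nowhere_zero A (wedge 1 (2 * m) (of_one_form \<theta>) (wedge_power \<Omega>' m))"
    unfolding nowhere_zero_def
  proof
    fix p
    from nz obtain X where X: "\<forall>i. X i \<in> VF" and p: "wedge 1 (2 * m) (of_one_form \<theta>) (wedge_power \<Omega> m) X p \<noteq> 0"
      unfolding nowhere_zero_def by blast
    have "wedge 1 (2 * m) (of_one_form \<theta>) (wedge_power \<Omega> m) X = wedge 1 (2 * m) (of_one_form \<theta>) (wedge_power \<Omega>' m) X"
      by (rule wedge_one_form_pullback[where T="\<lambda>X. X" and \<theta>=\<theta> and \<theta>'=\<theta> and \<Omega>=\<Omega> and \<Omega>'=\<Omega>' and X=X, OF eq refl])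
         (use X in auto)
    with X p show "\<exists>X. (\<forall>i. X i \<in> VF) \<and> wedge 1 (2 * m) (of_one_form \<theta>) (wedge_power \<Omega>' m) X p \<noteq> 0"
      by (intro exI[of _ X]) simp
  qed
  ultimately show ?thesis
    using \<theta> m unfolding almost_cosymplectic_def by blast
qed

lemma closed_two_form_cong:
  assumes eq: "\<And>X Y. X \<in> VF \<Longrightarrow> Y \<in> VF \<Longrightarrow> \<Omega> X Y = \<Omega>' X Y" and "closed_two_form A \<Omega>"
  shows "closed_two_form A \<Omega>'"
  using assms(2) unfolding closed_two_form_def d2_def by (simp add: eq)

end

section \<open>The sphere of structures\<close>

text \<open>The axis bisects the angle between s and e1, so it is s + e1 normalised; at the antipode
  s = - e1 an axis orthogonal to e1 serves, and e2 is taken.\<close>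

lemma half_turn_axis:
  fixes s :: "nat \<Rightarrow> real"
  assumes "(s 1)\<^sup>2 + (s 2)\<^sup>2 + (s 3)\<^sup>2 = 1"
  obtains \<nu> :: "nat \<Rightarrow> real" where "(\<nu> 1)\<^sup>2 + (\<nu> 2)\<^sup>2 + (\<nu> 3)\<^sup>2 = 1"
    "2 * \<nu> 1 * \<nu> 1 = s 1 + 1" "2 * \<nu> 1 * \<nu> 2 = s 2" "2 * \<nu> 1 * \<nu> 3 = s 3"
proof (cases "s 1 = - 1")
  case True
  then have "(s 2)\<^sup>2 + (s 3)\<^sup>2 = 0" using assms by simp
  then have "s 2 = 0" "s 3 = 0" by (simp_all add: sum_power2_eq_zero_iff)
  then show ?thesis using True by (intro that[of "\<lambda>i. if i = 2 then 1 else 0"]) simp_all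
next
  case False
  have "(s 1)\<^sup>2 \<le> 1" using assms zero_le_power2[of "s 2"] zero_le_power2[of "s 3"] by linarith
  then have "- 1 \<le> s 1" using abs_le_square_iff[of "s 1" 1] by simp
  then have pos: "0 < 2 + 2 * s 1" using False by simp
  \<comment> \<open>The length of s + e1.\<close>
  define r where "r = sqrt (2 + 2 * s 1)"
  have r: "r * r = 2 + 2 * s 1" "r \<noteq> 0" using pos by (simp_all add: r_def)
  define v where "v = (\<lambda>i. s i / r)(1 := (s 1 + 1) / r)"
  have v: "v 1 = (s 1 + 1) / r" "v 2 = s 2 / r" "v 3 = s 3 / r" by (simp_all add: v_def)
  show ?thesis
  proof (rule that[of v])
    have "(v 1)\<^sup>2 + (v 2)\<^sup>2 + (v 3)\<^sup>2 = ((s 1 + 1)\<^sup>2 + (s 2)\<^sup>2 + (s 3)\<^sup>2) / (r * r)"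
      unfolding v by (simp only: power_divide power2_eq_square[of r] add_divide_distrib[symmetric])
    also have "(s 1 + 1)\<^sup>2 + (s 2)\<^sup>2 + (s 3)\<^sup>2 = 2 + 2 * s 1"
      using assms by (simp add: power2_eq_square algebra_simps)
    finally show "(v 1)\<^sup>2 + (v 2)\<^sup>2 + (v 3)\<^sup>2 = 1" using r pos by simp
    show "2 * v 1 * v 1 = s 1 + 1" "2 * v 1 * v 2 = s 2" "2 * v 1 * v 3 = s 3"
      unfolding v using r pos by (simp_all add: divide_simps)
  qed
qed

text \<open>The half turn T is a symmetric involution with T e1 = s, so <e1, T x> = <s, x> and <s, T
  x> = <e1, x>.\<close>

lemma half_turn_swap:
  fixes n1 n2 n3 s1 s2 s3 x1 x2 x3 :: real
  assumes "n1\<^sup>2 + n2\<^sup>2 + n3\<^sup>2 = 1" "2 * n1 * n1 = s1 + 1" "2 * n1 * n2 = s2" "2 * n1 * n3 = s3"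
  shows "2 * n1 * (n1 * x1 + n2 * x2 + n3 * x3) - x1 = s1 * x1 + s2 * x2 + s3 * x3"
    and "s1 * (2 * n1 * (n1 * x1 + n2 * x2 + n3 * x3) - x1) + s2 * (2 * n2 * (n1 * x1 + n2 * x2 + n3 * x3) - x2)
      + s3 * (2 * n3 * (n1 * x1 + n2 * x2 + n3 * x3) - x3) = x1"
proof -
  have s: "s1 = 2 * n1 * n1 - 1" "s2 = 2 * n1 * n2" "s3 = 2 * n1 * n3" using assms by simp_all
  show "2 * n1 * (n1 * x1 + n2 * x2 + n3 * x3) - x1 = s1 * x1 + s2 * x2 + s3 * x3"
    unfolding s by (simp add: algebra_simps)
  show "s1 * (2 * n1 * (n1 * x1 + n2 * x2 + n3 * x3) - x1) + s2 * (2 * n2 * (n1 * x1 + n2 * x2 + n3 * x3) - x2)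
      + s3 * (2 * n3 * (n1 * x1 + n2 * x2 + n3 * x3) - x3) = x1"
    unfolding s using assms(1) by algebra
qed

context smooth_manifold
begin

lemma lie_const:
  assumes "X \<in> VF" "Y \<in> VF"
  shows "lie_bracket X ((\<lambda>_. k) \<odot> Y) = (\<lambda>_. k) \<odot> lie_bracket X Y"
    "lie_bracket ((\<lambda>_. k) \<odot> Y) X = (\<lambda>_. k) \<odot> lie_bracket Y X"
  using lie_fscale[OF assms smooth_const[of k]] VF_const[OF assms(1), of k] by (simp_all add: fscale_simps)

end

text \<open>Apart from the bare bracket, this form of normality is quadratic in the structure, so it
  polarises; the mixed terms are those of \<open>normal_mixed\<close>.\<close>

lemma (in quasi_sasakian_manifold) normal_eq':
  assumes "X \<in> VF" "Y \<in> VF"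
  shows "lie_bracket (\<phi> X) (\<phi> Y) - lie_bracket X Y - \<phi> (lie_bracket (\<phi> X) Y) - \<phi> (lie_bracket X (\<phi> Y))
    + (X (\<eta> Y) - Y (\<eta> X)) \<odot> \<xi> = 0"
  using normal_eq[OF assms] assms by (simp add: phi_sq d1_def fscale_simps algebra_simps)

lemma sphere_cyc: "(a, b, c) \<in> cyc \<Longrightarrow> s \<in> unit_sphere 2 \<longleftrightarrow> (s a)\<^sup>2 + (s b)\<^sup>2 + (s c)\<^sup>2 = 1"
proof -
  assume "(a, b, c) \<in> cyc"
  moreover have "{1..2 + 1} = {1, 2, 3 :: nat}" by auto
  ultimately show ?thesis unfolding unit_sphere_def by (auto simp: cyc_def)
qed

context
  fixes a b c assumes abc: "(a, b, c) \<in> cyc"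
begin

lemma sum_sphere_cyc: "(\<Sum>i = 1..2 + 1. f i) = f a + f b + (f c :: 'b :: ab_group_add)"
proof -
  have "{1..2 + 1} = {1, 2, 3 :: nat}" by auto
  then show ?thesis using cyc_sum[OF abc, of f] by simp
qed

lemma comb_cyc:
  "comb_endo 2 s \<phi> X = (\<lambda>_. s a) \<odot> \<phi> a X + (\<lambda>_. s b) \<odot> \<phi> b X + (\<lambda>_. s c) \<odot> \<phi> c X"
  "comb_vfield 2 s \<xi> = (\<lambda>_. s a) \<odot> \<xi> a + (\<lambda>_. s b) \<odot> \<xi> b + (\<lambda>_. s c) \<odot> \<xi> c"
  "comb_form1 2 s \<eta> X = (\<lambda>_. s a) * \<eta> a X + (\<lambda>_. s b) * \<eta> b X + (\<lambda>_. s c) * \<eta> c X"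
  "comb_form2 2 s \<Omega> X Y = (\<lambda>_. s a) * \<Omega> a X Y + (\<lambda>_. s b) * \<Omega> b X Y + (\<lambda>_. s c) * \<Omega> c X Y"
  unfolding comb_endo_def comb_vfield_def comb_form1_def comb_form2_def sum_sphere_cyc by (rule refl)+

end

context three_quasi_sasakian_manifold
begin

context
  fixes a b c assumes abc: "(a, b, c) \<in> cyc"
begin

interpretation qa: quasi_sasakian_manifold A g "\<phi> a" "\<xi> a" "\<eta> a"
  by (rule qs[OF cyc_index[OF abc]])
interpretation qb: quasi_sasakian_manifold A g "\<phi> b" "\<xi> b" "\<eta> b"
  by (rule qs[OF cyc_index[OF bca[OF abc]]])
interpretation qc: quasi_sasakian_manifold A g "\<phi> c" "\<xi> c" "\<eta> c"
  by (rule qs[OF cyc_index[OF cab[OF abc]]])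
interpretation cone: bracket_module "VF \<times> F" pair_bracket
  by (rule bracket_module_pairs)

text \<open>The first component of \<open>mixed_nijenhuis_zero\<close> for the cone maps of a and b,
  evaluated on fields without d/dt component.\<close>

lemma normal_mixed:
  assumes X: "X \<in> VF" and Y: "Y \<in> VF"
  shows "lie_bracket (\<phi> a X) (\<phi> b Y) + lie_bracket (\<phi> b X) (\<phi> a Y)
    - \<phi> a (lie_bracket (\<phi> b X) Y) - \<phi> a (lie_bracket X (\<phi> b Y))
    - \<phi> b (lie_bracket (\<phi> a X) Y) - \<phi> b (lie_bracket X (\<phi> a Y))
    + (X (\<eta> b Y) - Y (\<eta> b X)) \<odot> \<xi> a + (X (\<eta> a Y) - Y (\<eta> a X)) \<odot> \<xi> b = 0"
proof -
  let ?J = "\<lambda>i. cone_map (\<phi> i) (\<xi> i) (\<eta> i)"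
  \<comment> \<open>On the cone the quaternion relations hold exactly: the corrections by multiples
    of the Reeb fields are absorbed by the function component.\<close>
  have rel: "?J a (?J b x) = ?J c x" "?J b (?J a x) = - ?J c x" "?J c (?J b x) = - ?J a x" "?J a (?J c x) = - ?J b x"
    if "x \<in> VF \<times> F" for x
    using that by (auto simp: cone_map_def cyc_simps[OF abc])
  have V: "\<phi> a X \<in> VF" "\<phi> b X \<in> VF" "\<phi> a Y \<in> VF" "\<phi> b Y \<in> VF" using X Y by (simp_all add: cyc_linear[OF abc])
  have "pair_bracket (?J a (X, 0)) (?J b (Y, 0)) + pair_bracket (?J b (X, 0)) (?J a (Y, 0))
      - ?J a (pair_bracket (?J b (X, 0)) (Y, 0)) - ?J a (pair_bracket (X, 0) (?J b (Y, 0)))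
      - ?J b (pair_bracket (?J a (X, 0)) (Y, 0)) - ?J b (pair_bracket (X, 0) (?J a (Y, 0))) = 0"
    by (rule cone.mixed_nijenhuis_zero[OF qa.additive_cone_map qb.additive_cone_map qc.additive_cone_map
          rel qa.cone_map_sq qb.cone_map_sq qa.nijenhuis_cone_map qb.nijenhuis_cone_map qc.nijenhuis_cone_map])
       (use X Y in auto)
  from arg_cong[OF this, of fst] show ?thesis
    using VF_0_arg[OF V(1)] VF_0_arg[OF V(2)] VF_0_arg[OF V(3)] VF_0_arg[OF V(4)]
    by (simp add: cone_map_def pair_bracket_def fscale_simps algebra_simps)
qed

end

context
  fixes a b c s assumes abc: "(a, b, c) \<in> cyc" and s: "s \<in> unit_sphere 2"
begin

interpretation qa: quasi_sasakian_manifold A g "\<phi> a" "\<xi> a" "\<eta> a"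
  by (rule qs[OF cyc_index[OF abc]])
interpretation qb: quasi_sasakian_manifold A g "\<phi> b" "\<xi> b" "\<eta> b"
  by (rule qs[OF cyc_index[OF bca[OF abc]]])
interpretation qc: quasi_sasakian_manifold A g "\<phi> c" "\<xi> c" "\<eta> c"
  by (rule qs[OF cyc_index[OF cab[OF abc]]])

abbreviation "\<Phi> \<equiv> comb_endo 2 s \<phi>"
abbreviation "\<Xi> \<equiv> comb_vfield 2 s \<xi>"
abbreviation "H \<equiv> comb_form1 2 s \<eta>"

lemmas comb = comb_cyc[OF abc]

lemma sphere_norm: "(s a)\<^sup>2 + (s b)\<^sup>2 + (s c)\<^sup>2 = 1"
  using s sphere_cyc[OF abc] by blast

text \<open>Spreads a term free of \<open>s\<close> over the three squares, so that it can be
  matched with terms quadratic in \<open>s\<close>.\<close>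

lemma norm_mult: "x = s a * (s a * x) + s b * (s b * x) + s c * (s c * x)"
proof -
  have "x = ((s a)\<^sup>2 + (s b)\<^sup>2 + (s c)\<^sup>2) * x" by (simp add: sphere_norm)
  then show ?thesis by (simp add: power2_eq_square algebra_simps)
qed

lemma comb_endo: "endomorphism_field A \<Phi>"
  unfolding endomorphism_field_def comb
  by (auto simp: cyc_linear[OF abc] fscale_simps algebra_simps)

lemma comb_vfield: "\<Xi> \<in> VF"
  unfolding comb by simp

lemma comb_form: "one_form A H"
  unfolding one_form_def comb by (auto simp: cyc_linear[OF abc] algebra_simps)

lemma comb_phi_sq:
  assumes X: "X \<in> VF" shows "\<Phi> (\<Phi> X) = - X + H X \<odot> \<Xi>"
proof (rule vfield_eqI)
  fix f p
  show "\<Phi> (\<Phi> X) f p = (- X + H X \<odot> \<Xi>) f p"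
    using X norm_mult[of "X f p"] unfolding comb by (simp add: cyc_simps[OF abc] algebra_simps)
qed

lemma comb_eta_xi: "H \<Xi> = 1"
proof (rule ext)
  fix p
  show "H \<Xi> p = 1 p"
    using sphere_norm unfolding comb by (simp add: cyc_simps[OF abc] power2_eq_square)
qed

text \<open>Skewness of the three \<phi> moves one \<open>\<Phi>\<close> across the metric, where
  \<open>comb_phi_sq\<close> resolves the square.\<close>

lemma comb_compat:
  assumes X: "X \<in> VF" and Y: "Y \<in> VF"
  shows "g (\<Phi> X) (\<Phi> Y) = g X Y - H X * H Y"
proof -
  have PY: "\<Phi> Y \<in> VF" using endo_VF[OF comb_endo Y] .
  have "g (\<Phi> X) (\<Phi> Y) = - g X (\<Phi> (\<Phi> Y))"
    unfolding comb(1)[of s \<phi> X] comb(1)[of s \<phi> "\<Phi> Y"] using X PY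
    by (simp add: g_arith cyc_linear[OF abc] qa.g_phi_skew qb.g_phi_skew qc.g_phi_skew)
  also have "\<dots> = g X Y - H Y * g X \<Xi>"
    using X Y comb_vfield one_form_smooth[OF comb_form Y] by (simp add: comb_phi_sq g_arith)
  finally have "g (\<Phi> X) (\<Phi> Y) = g X Y - H Y * g X \<Xi>" .
  moreover have "g X \<Xi> = H X"
    unfolding comb using X by (simp add: g_arith qa.g_xi qb.g_xi qc.g_xi)
  ultimately show ?thesis by (simp only: mult.commute)
qed

lemma comb_acm: "almost_contact_metric A \<Phi> \<Xi> H g"
  unfolding almost_contact_metric_def almost_contact_def compatible_metric_def
  using comb_endo comb_vfield comb_form comb_phi_sq comb_eta_xi comb_compat metric by blast

text \<open>The expression expands into s_i^2 times the pure terms and s_i s_j times the mixed ones,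
  the bare bracket being distributed by \<open>norm_mult\<close>; all six vanish by
  \<open>normal_eq'\<close> and \<open>normal_mixed\<close>.\<close>

lemma comb_normal: "normal_structure A \<Phi> \<Xi> H"
  unfolding normal_structure_def
proof (intro ballI)
  fix X Y assume X: "X \<in> VF" and Y: "Y \<in> VF"
  have V: "\<phi> a X \<in> VF" "\<phi> b X \<in> VF" "\<phi> c X \<in> VF" "\<phi> a Y \<in> VF" "\<phi> b Y \<in> VF" "\<phi> c Y \<in> VF"
    using X Y by (simp_all add: cyc_linear[OF abc])
  show "\<Phi> (\<Phi> (lie_bracket X Y)) + lie_bracket (\<Phi> X) (\<Phi> Y) - \<Phi> (lie_bracket (\<Phi> X) Y)
      - \<Phi> (lie_bracket X (\<Phi> Y)) + (X (H Y) - Y (H X) - H (lie_bracket X Y)) \<odot> \<Xi> = 0"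
  proof (rule vfield_eqI)
    fix f :: "'a \<Rightarrow> real" and p :: 'a
    note N = qa.normal_eq'[OF X Y] qb.normal_eq'[OF X Y] qc.normal_eq'[OF X Y]
    note M = normal_mixed[OF abc X Y] normal_mixed[OF bca[OF abc] X Y] normal_mixed[OF cab[OF abc] X Y]
    have at: "Z f p = 0" if "Z = 0" for Z :: "'a vfield" using that by simp
    note e = N[THEN at] M[THEN at]
    have sum: "s a * (s a * N1) + s b * (s b * N2) + s c * (s c * N3) + s a * (s b * M1) + s b * (s c * M2) + s c * (s a * M3) = 0"
      if "N1 = 0" "N2 = 0" "N3 = 0" "M1 = 0" "M2 = 0" "M3 = 0" for N1 N2 N3 M1 M2 M3 :: real
      using that by simp
    have Phi2: "\<Phi> (\<Phi> (lie_bracket X Y)) f p = - lie_bracket X Y f p + H (lie_bracket X Y) p * \<Xi> f p"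
      using comb_phi_sq[of "lie_bracket X Y"] X Y by simp
    show "(\<Phi> (\<Phi> (lie_bracket X Y)) + lie_bracket (\<Phi> X) (\<Phi> Y) - \<Phi> (lie_bracket (\<Phi> X) Y)
      - \<Phi> (lie_bracket X (\<Phi> Y)) + (X (H Y) - Y (H X) - H (lie_bracket X Y)) \<odot> \<Xi>) f p = 0 f p"
      using sum[OF e] norm_mult[of "lie_bracket X Y f p"] X Y V Phi2 unfolding comb
      by (simp add: lie_add lie_const cyc_linear[OF abc] VF_arith[OF X] VF_arith[OF Y] algebra_simps)
  qed
qed

lemma comb_form2_eq:
  assumes "X \<in> VF" "Y \<in> VF"
  shows "fundamental_form g \<Phi> X Y = comb_form2 2 s (\<lambda>\<alpha>. fundamental_form g (\<phi> \<alpha>)) X Y"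
  unfolding comb fundamental_form_def using assms by (simp add: g_arith cyc_linear[OF abc])

lemma comb_form2_closed: "closed_two_form A (comb_form2 2 s (\<lambda>\<alpha>. fundamental_form g (\<phi> \<alpha>)))"
  unfolding closed_two_form_def
proof (intro ballI)
  fix X Y Z assume X: "X \<in> VF" and Y: "Y \<in> VF" and Z: "Z \<in> VF"
  let ?\<Omega> = "\<lambda>\<alpha>. fundamental_form g (\<phi> \<alpha>)"
  have 0: "d2 (?\<Omega> a) X Y Z = 0" "d2 (?\<Omega> b) X Y Z = 0" "d2 (?\<Omega> c) X Y Z = 0"
    using qa.closed qb.closed qc.closed X Y Z unfolding closed_two_form_def by blast+
  have F: "?\<Omega> i V W \<in> F" if "i \<in> {a, b, c}" "V \<in> VF" "W \<in> VF" for i V W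
    using that by (auto simp: fundamental_form_def g_arith cyc_linear[OF abc])
  have "d2 (comb_form2 2 s ?\<Omega>) X Y Z = (\<lambda>_. s a) * d2 (?\<Omega> a) X Y Z + (\<lambda>_. s b) * d2 (?\<Omega> b) X Y Z + (\<lambda>_. s c) * d2 (?\<Omega> c) X Y Z"
    unfolding d2_def comb using X Y Z
    by (simp add: F VF_arith[OF X] VF_arith[OF Y] VF_arith[OF Z] algebra_simps)
  then show "d2 (comb_form2 2 s ?\<Omega>) X Y Z = 0" by (simp add: 0)
qed

lemma comb_quasi_sasakian: "quasi_sasakian A \<Phi> \<Xi> H g"
  unfolding quasi_sasakian_def
  using comb_acm comb_normal closed_two_form_cong[OF comb_form2_eq[symmetric] comb_form2_closed] by blast

lemma comb_almost_cosymplectic: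
  "almost_cosymplectic A H (comb_form2 2 s (\<lambda>\<alpha>. fundamental_form g (\<phi> \<alpha>)))"
proof -
  interpret almost_contact_metric_manifold A g \<Phi> \<Xi> H
    by unfold_locales (rule comb_acm)
  show ?thesis
    by (rule almost_cosymplectic_cong[OF comb_form2_eq almost_cosymplectic_fundamental])
qed

lemma d1_comb:
  assumes X: "X \<in> VF" and Y: "Y \<in> VF"
  shows "d1 H X Y = (\<lambda>_. s a) * d1 (\<eta> a) X Y + (\<lambda>_. s b) * d1 (\<eta> b) X Y + (\<lambda>_. s c) * d1 (\<eta> c) X Y"
  unfolding d1_def comb using X Y by (simp add: cyc_linear[OF abc] VF_arith[OF X] VF_arith[OF Y] algebra_simps)

end

text \<open>The same map \<open>rot \<nu>\<close> is used in both directions of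
  \<open>cartan_class_transfer\<close>, since by \<open>half_turn_swap\<close> the half turn
  exchanges \<open>s\<close> and e1.\<close>

lemma comb_cartan_class:
  assumes s: "s \<in> unit_sphere 2" and "cartan_class A (\<eta> 1) k"
  shows "cartan_class A (comb_form1 2 s \<eta>) k"
proof -
  have c1: "(1, 2, 3) \<in> cyc" by (simp add: cyc_def)
  obtain \<nu> :: "nat \<Rightarrow> real" where \<nu>: "(\<nu> 1)\<^sup>2 + (\<nu> 2)\<^sup>2 + (\<nu> 3)\<^sup>2 = 1"
    and "2 * \<nu> 1 * \<nu> 1 = s 1 + 1" "2 * \<nu> 1 * \<nu> 2 = s 2" "2 * \<nu> 1 * \<nu> 3 = s 3"
    using half_turn_axis s sphere_cyc[OF c1] by metis
  note swap = half_turn_swap[OF this]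
  have \<nu>': "(\<nu> 2)\<^sup>2 + (\<nu> 3)\<^sup>2 + (\<nu> 1)\<^sup>2 = 1" "(\<nu> 3)\<^sup>2 + (\<nu> 1)\<^sup>2 + (\<nu> 2)\<^sup>2 = 1" using \<nu> by simp_all
  note T = rot_VF[OF c1 \<nu>]
  \<comment> \<open>\<open>deta_rot\<close> concerns the first index of a cyclic triple; rotating
    the triple gives the other two.\<close>
  have d: "d1 (\<eta> 1) (rot \<nu> X) (rot \<nu> Y) p
      = 2 * \<nu> 1 * (\<nu> 1 * d1 (\<eta> 1) X Y p + \<nu> 2 * d1 (\<eta> 2) X Y p + \<nu> 3 * d1 (\<eta> 3) X Y p) - d1 (\<eta> 1) X Y p"
    "d1 (\<eta> 2) (rot \<nu> X) (rot \<nu> Y) p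
      = 2 * \<nu> 2 * (\<nu> 1 * d1 (\<eta> 1) X Y p + \<nu> 2 * d1 (\<eta> 2) X Y p + \<nu> 3 * d1 (\<eta> 3) X Y p) - d1 (\<eta> 2) X Y p"
    "d1 (\<eta> 3) (rot \<nu> X) (rot \<nu> Y) p
      = 2 * \<nu> 3 * (\<nu> 1 * d1 (\<eta> 1) X Y p + \<nu> 2 * d1 (\<eta> 2) X Y p + \<nu> 3 * d1 (\<eta> 3) X Y p) - d1 (\<eta> 3) X Y p"
    if "X \<in> VF" "Y \<in> VF" for X Y p
    using deta_rot[OF c1 \<nu> that, of p] deta_rot[OF bca[OF c1] \<nu>'(1) that, of p]
      deta_rot[OF cab[OF c1] \<nu>'(2) that, of p] by (simp_all add: add_ac)
  show ?thesis
  proof (rule cartan_class_transfer[where T="rot \<nu>" and S="rot \<nu>", OF T _ _ T _ _ assms(2)])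
    fix X assume X: "X \<in> VF"
    show "comb_form1 2 s \<eta> (rot \<nu> X) = \<eta> 1 X"
      unfolding comb_cyc[OF c1]
      by (rule ext) (simp only: plus_fun_apply times_fun_apply eta_rot[OF c1 \<nu> X] swap(2))
    show "\<eta> 1 (rot \<nu> X) = comb_form1 2 s \<eta> X"
      unfolding comb_cyc[OF c1]
      by (rule ext) (simp only: plus_fun_apply times_fun_apply eta_rot[OF c1 \<nu> X] swap(1))
  next
    fix X Y assume X: "X \<in> VF" and Y: "Y \<in> VF"
    show "d1 (comb_form1 2 s \<eta>) (rot \<nu> X) (rot \<nu> Y) = d1 (\<eta> 1) X Y"
      unfolding d1_comb[OF c1 s T[OF X] T[OF Y]]
      by (rule ext) (simp only: plus_fun_apply times_fun_apply d[OF X Y] swap(2))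
    show "d1 (\<eta> 1) (rot \<nu> X) (rot \<nu> Y) = d1 (comb_form1 2 s \<eta>) X Y"
      unfolding d1_comb[OF c1 s X Y]
      by (rule ext) (simp only: plus_fun_apply times_fun_apply d[OF X Y] swap(1))
  qed
qed

end

theorem theorem4p7:
  fixes A :: "('a::{t2_space,second_countable_topology}, 'e::euclidean_space) atlas"
    and \<phi> :: "nat \<Rightarrow> 'a vfield \<Rightarrow> 'a vfield"
    and \<xi> :: "nat \<Rightarrow> 'a vfield"
    and \<eta> :: "nat \<Rightarrow> 'a vfield \<Rightarrow> 'a \<Rightarrow> real"
    and g :: "'a vfield \<Rightarrow> 'a vfield \<Rightarrow> 'a \<Rightarrow> real"
    and l :: nat
  assumes "smooth_atlas A"
    and "three_quasi_sasakian_of_rank A \<phi> \<xi> \<eta> g (4 * l + 3)"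
  shows "(\<forall>s\<in>unit_sphere 2.
            quasi_sasakian A (comb_endo 2 s \<phi>) (comb_vfield 2 s \<xi>) (comb_form1 2 s \<eta>) g \<and>
            cartan_class A (comb_form1 2 s \<eta>) (4 * l + 3)) \<and>
         quasi_contact_sphere A 2 \<eta> (\<lambda>\<alpha>. fundamental_form g (\<phi> \<alpha>)) (4 * l + 3)"
proof -
  have qs: "quasi_sasakian A (\<phi> a) (\<xi> a) (\<eta> a) g" and rank: "cartan_class A (\<eta> a) (4 * l + 3)"
    if "a \<in> {1,2,3}" for a
    using assms(2) that unfolding three_quasi_sasakian_of_rank_def three_quasi_sasakian_def by blast+
  have metric: "riemannian_metric A g"
    using qs[of 1] by (simp add: quasi_sasakian_def almost_contact_metric_def compatible_metric_def)
  have "almost_contact_3 A \<phi> \<xi> \<eta>"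
    using assms(2) unfolding three_quasi_sasakian_of_rank_def three_quasi_sasakian_def almost_contact_metric_3_def
    by blast
  note rels = this[unfolded almost_contact_3_def, folded cyc_def, THEN conjunct2]
  have rel: "(\<forall>X\<in>vector_fields A. \<phi> c X = \<phi> a (\<phi> b X) - \<eta> b X \<odot> \<xi> a \<and>
           \<phi> c X = - \<phi> b (\<phi> a X) + \<eta> a X \<odot> \<xi> b) \<and>
        \<xi> c = \<phi> a (\<xi> b) \<and> \<xi> c = - \<phi> b (\<xi> a) \<and>
        (\<forall>X\<in>vector_fields A. \<eta> c X = \<eta> a (\<phi> b X) \<and> \<eta> c X = - \<eta> b (\<phi> a X))"
    if "(a, b, c) \<in> cyc" for a b c
    using bspec[OF rels that] unfolding prod.case .
  interpret metric_manifold A g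
    by unfold_locales (use assms(1) metric in auto)
  have qsm: "quasi_sasakian_manifold A g (\<phi> a) (\<xi> a) (\<eta> a)" if "a \<in> {1,2,3}" for a
    using qs[OF that] by unfold_locales (auto simp: quasi_sasakian_def)
  interpret three_quasi_sasakian_manifold A g \<phi> \<xi> \<eta>
    by (rule three_quasi_sasakian_manifold.intro[OF metric_manifold_axioms],
        rule three_quasi_sasakian_manifold_axioms.intro)
      (erule qsm,
       erule (1) rel[THEN conjunct1, THEN bspec, THEN conjunct1],
       erule (1) rel[THEN conjunct1, THEN bspec, THEN conjunct2],
       erule rel[THEN conjunct2, THEN conjunct1],
       erule rel[THEN conjunct2, THEN conjunct2, THEN conjunct1],
       erule (1) rel[THEN conjunct2, THEN conjunct2, THEN conjunct2, THEN bspec, THEN conjunct1],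
       erule (1) rel[THEN conjunct2, THEN conjunct2, THEN conjunct2, THEN bspec, THEN conjunct2])
  have c1: "(1, 2, 3) \<in> cyc" by (simp add: cyc_def)
  \<comment> \<open>The definition of a sphere asks for its generators separately from their unit
    combinations.\<close>
  have cosymplectic: "almost_cosymplectic A (\<eta> i) (fundamental_form g (\<phi> i))" if "i \<in> {1,2,3}" for i
  proof -
    interpret q: quasi_sasakian_manifold A g "\<phi> i" "\<xi> i" "\<eta> i" by (rule qsm[OF that])
    show ?thesis by (rule q.almost_cosymplectic_fundamental)
  qed
  have "{1..2 + 1} = {1, 2, 3 :: nat}" by auto
  then show ?thesis
    unfolding quasi_contact_sphere_def almost_cosymplectic_sphere_def
    using comb_quasi_sasakian[OF c1] comb_cartan_class rank[of 1] comb_almost_cosymplectic[OF c1]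
      comb_form2_closed[OF c1] cosymplectic by simp
qed

end
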